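(* Let $0<\alpha<2$, $0<H<1$, $H\ne1/\alpha$, and let $\{X(t)\}_{t\in\mathbb{R}}$ be the well-balanced linear fractional stable motion with parameters $(H,\alpha)$. Let $$b_n=\begin{cases}n^{-1/2}&\text{if }H<L+1-\frac2\alpha,\\ n^{\frac{\alpha H-(L+1)\alpha}{4}}&\text{if }H>L+1-\frac2\alpha,\\ \sqrt{\frac{\ln n}{n}}&\text{if }H=L+1-\frac2\alpha.\end{cases}$$ Then for every $\beta\in(-\frac12,0)$ and all $-\frac12<\beta_1<\beta_2<0$, the estimators $\widehat H_n$ (built from $\beta$) and $\hat\alpha_n$ (built from $\beta_1,\beta_2$) satisfy, as $n\to+\infty$, $$\widehat H_n\xrightarrow{\mathbb{P}}H,\quad \hat\alpha_n\xrightarrow{\mathbb{P}}\alpha,\quad \widehat H_n-H=O_{\mathbb{P}}(b_n),\quad \hat\alpha_n-\alpha=O_{\mathbb{P}}(b_n).$$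
   Context: Well-balanced linear fractional stable motion: $X(t)=\int_{-\infty}^{+\infty}\left(|t-x|^{H-1/\alpha}-|x|^{H-1/\alpha}\right)M(dx)$, $t\in\mathbb{R}$, where $M$ is a symmetric $\alpha$-stable random measure on $\mathbb{R}$ with Lebesgue control measure (so for $f\in L^\alpha$, $\mathbb{E}\exp(i\theta\int f\,dM)=\exp(-|\theta|^\alpha\int|f|^\alpha dx)$). Increments: fix integers $L\ge1,K\ge1$ and reals $a_0,\dots,a_K$ with $\sum_{k=0}^K k^q a_k=0$ for all $q\in\{0,\dots,L\}$ and $\sum_{k=0}^K k^{L+1}a_k\ne0$ (convention $0^0=1$). Set $\triangle_{p,n}X=\sum_{k=0}^K a_k X\left(\frac{k+p}{n}\right)$. For $\gamma\in(-\frac12,0)$: $V_n(\gamma)=\frac{1}{n-K+1}\sum_{p=0}^{n-K}|\triangle_{p,n}X|^{\gamma}$ and $W_n(\gamma)=n^{\gamma H}V_n(\gamma)$. When $n/2$ appears, $n$ is even (and large enough). Estimator of $H$: $\widehat H_n=\frac1\beta\log_2\frac{V_{n/2}(\beta)}{V_n(\beta)}$. Estimator of $\alpha$: for $u>v>0$ let $\psi_{u,v}(x,y)=-v\ln x+u\ln y+C(u,v)$ ($x,y>0$) with $C(u,v)=\frac{u-v}{2}\ln\pi+u\ln\Gamma(1+\frac v2)+v\ln\Gamma(\frac{1-u}{2})-v\ln\Gamma(1+\frac u2)-u\ln\Gamma(\frac{1-v}{2})$; $h_{u,v}:(0,+\infty)\to(-\infty,0)$, $h_{u,v}(x)=u\ln\Gamma(1+\frac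 vx)-v\ln\Gamma(1+\frac ux)$, which is a bijection; $\varphi_{u,v}(x)=0$ if $x\ge0$ and $\varphi_{u,v}(x)=h_{u,v}^{-1}(x)$ if $x<0$. Then $\hat\alpha_n=\varphi_{-\beta_1,-\beta_2}\left(\psi_{-\beta_1,-\beta_2}(W_n(\beta_1),W_n(\beta_2))\right)$. $X_n=O_{\mathbb{P}}(1)$ means: for all $\epsilon>0$ there is $M>0$ with $\sup_n\mathbb{P}(|X_n|>M)<\epsilon$; $Y_n=O_{\mathbb{P}}(a_n)$ means $Y_n=a_nX_n$ with $X_n=O_{\mathbb{P}}(1)$. *)

theory Defs
  imports "HOL-Probability.Probability"
begin

section \<open>Stochastic convergence along an index set\<close>

text \<open>
  Some of the sequences considered are only meaningful for \<open>n\<close> in an infinite set \<open>N\<close> (for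
  instance the even integers), so both notions below refer to indices \<open>n \<in> N\<close> only. Measurability
  is part of the definitions, because \<^const>\<open>measure\<close> is \<open>0\<close> on non-measurable sets.
\<close>

definition conv_in_prob ::
  "'w measure \<Rightarrow> nat set \<Rightarrow> (nat \<Rightarrow> 'w \<Rightarrow> real) \<Rightarrow> ('w \<Rightarrow> real) \<Rightarrow> bool" where
  "conv_in_prob P N Y Z \<longleftrightarrow>
     (\<forall>n\<in>N. Y n \<in> borel_measurable P) \<and> Z \<in> borel_measurable P \<and>
     (\<forall>\<epsilon>>0. ((\<lambda>n. measure P {\<omega> \<in> space P. \<bar>Y n \<omega> - Z \<omega>\<bar> > \<epsilon>}) \<longlongrightarrow> 0)
              (inf sequentially (principal N)))"

definition bounded_in_prob :: "'w measure \<Rightarrow> nat set \<Rightarrow> (nat \<Rightarrow> 'w \<Rightarrow> real) \<Rightarrow> bool" where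
  "bounded_in_prob P N Y \<longleftrightarrow>
     (\<forall>n\<in>N. Y n \<in> borel_measurable P) \<and>
     (\<forall>\<epsilon>>0. \<exists>C>0. (SUP n\<in>N. measure P {\<omega> \<in> space P. \<bar>Y n \<omega>\<bar> > C}) < \<epsilon>)"

definition big_O_prob ::
  "'w measure \<Rightarrow> nat set \<Rightarrow> (nat \<Rightarrow> 'w \<Rightarrow> real) \<Rightarrow> (nat \<Rightarrow> real) \<Rightarrow> bool" where
  "big_O_prob P N Y b \<longleftrightarrow>
     (\<exists>Z. bounded_in_prob P N Z \<and> (\<forall>n\<in>N. \<forall>\<omega>\<in>space P. Y n \<omega> = b n * Z n \<omega>))"


section \<open>Stable random measures and integrals\<close>

text \<open>
  A symmetric \<open>\<alpha>\<close>-stable random measure with Lebesgue control measure is defined on the Borel sets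
  of finite Lebesgue measure, is independently scattered and \<open>\<sigma>\<close>-additive (almost surely, with an
  exceptional set that may depend on the sequence), and \<open>M A\<close> is symmetric \<open>\<alpha>\<close>-stable with scale
  parameter \<open>\<lambda>(A)\<^sup>1\<^sup>/\<^sup>\<alpha>\<close>. The values of \<open>M\<close> on other sets are irrelevant.
\<close>

definition finite_borel :: "real set set" where
  "finite_borel = {A \<in> sets lborel. emeasure lborel A < \<infinity>}"

definition stable_random_measure ::
  "'w measure \<Rightarrow> real \<Rightarrow> (real set \<Rightarrow> 'w \<Rightarrow> real) \<Rightarrow> bool" where
  "stable_random_measure P \<alpha> M \<longleftrightarrow>
     prob_space P \<and>
     (\<forall>A\<in>finite_borel. M A \<in> borel_measurable P) \<and>
     (\<forall>A\<in>finite_borel. \<forall>\<theta>.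
        char (distr P borel (M A)) \<theta>
          = complex_of_real (exp (- (\<bar>\<theta>\<bar> powr \<alpha> * measure lborel A)))) \<and>
     (\<forall>(n::nat) A. A ` {..<n} \<subseteq> finite_borel \<and> disjoint_family_on A {..<n} \<longrightarrow>
        prob_space.indep_vars P (\<lambda>_. borel) (\<lambda>i. M (A i)) {..<n}) \<and>
     (\<forall>A :: nat \<Rightarrow> real set.
        range A \<subseteq> finite_borel \<and> disjoint_family A \<and> (\<Union>i. A i) \<in> finite_borel \<longrightarrow>
        (AE \<omega> in P. (\<lambda>i. M (A i) \<omega>) sums M (\<Union>i. A i) \<omega>))"

definition stable_simple_integral ::
  "(real set \<Rightarrow> 'w \<Rightarrow> real) \<Rightarrow> (real \<Rightarrow> real) \<Rightarrow> 'w \<Rightarrow> real" where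
  "stable_simple_integral M s \<omega> = (\<Sum>y\<in>range s - {0}. y * M (s -` {y}) \<omega>)"

text \<open>
  \<open>Y\<close> is a version of the stochastic integral of \<open>f\<close> if it is the limit in probability of the
  integrals of simple functions \<open>s n\<close> with \<open>\<integral>\<bar>f - s n\<bar>\<^sup>\<alpha> \<rightarrow> 0\<close>. The existence of such simple functions
  entails that \<open>f\<close> is in \<open>L\<^sup>\<alpha>\<close>.
\<close>

definition is_stable_integral ::
  "'w measure \<Rightarrow> real \<Rightarrow> (real set \<Rightarrow> 'w \<Rightarrow> real) \<Rightarrow> (real \<Rightarrow> real) \<Rightarrow> ('w \<Rightarrow> real) \<Rightarrow> bool" where
  "is_stable_integral P \<alpha> M f Y \<longleftrightarrow>
     f \<in> borel_measurable lborel \<and>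
     (\<exists>s :: nat \<Rightarrow> real \<Rightarrow> real.
        (\<forall>n. simple_function lborel (s n) \<and> {x. s n x \<noteq> 0} \<in> finite_borel) \<and>
        (\<lambda>n. \<integral>\<^sup>+ x. ennreal (\<bar>f x - s n x\<bar> powr \<alpha>) \<partial>lborel) \<longlonglongrightarrow> 0 \<and>
        conv_in_prob P UNIV (\<lambda>n. stable_simple_integral M (s n)) Y)"

text \<open>
  Since \<open>0 powr c = 0\<close>, the kernel takes conventional values at \<open>x = t\<close> and \<open>x = 0\<close> when
  \<open>H < 1 / \<alpha>\<close>; these points form a Lebesgue null set.
\<close>

definition well_balanced_lfsm ::
  "'w measure \<Rightarrow> real \<Rightarrow> real \<Rightarrow> (real set \<Rightarrow> 'w \<Rightarrow> real) \<Rightarrow> (real \<Rightarrow> 'w \<Rightarrow> real) \<Rightarrow> bool" where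
  "well_balanced_lfsm P H \<alpha> M X \<longleftrightarrow>
     stable_random_measure P \<alpha> M \<and>
     (\<forall>t. is_stable_integral P \<alpha> M
            (\<lambda>x. \<bar>t - x\<bar> powr (H - 1 / \<alpha>) - \<bar>x\<bar> powr (H - 1 / \<alpha>)) (X t))"


section \<open>Increments and their negative power variations\<close>

definition increment ::
  "nat \<Rightarrow> (nat \<Rightarrow> real) \<Rightarrow> (real \<Rightarrow> 'w \<Rightarrow> real) \<Rightarrow> nat \<Rightarrow> nat \<Rightarrow> 'w \<Rightarrow> real" where
  "increment K a X p n \<omega> = (\<Sum>k=0..K. a k * X (real (k + p) / real n) \<omega>)"

text \<open>
  Used for \<open>n \<ge> K\<close> only. The increments are almost surely nonzero, so the convention
  \<open>0 powr \<gamma> = 0\<close> is immaterial.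
\<close>

definition power_variation ::
  "nat \<Rightarrow> (nat \<Rightarrow> real) \<Rightarrow> (real \<Rightarrow> 'w \<Rightarrow> real) \<Rightarrow> real \<Rightarrow> nat \<Rightarrow> 'w \<Rightarrow> real" where
  "power_variation K a X \<gamma> n \<omega> =
     1 / (real n - real K + 1) * (\<Sum>p=0..n - K. \<bar>increment K a X p n \<omega>\<bar> powr \<gamma>)"

definition scaled_variation ::
  "real \<Rightarrow> nat \<Rightarrow> (nat \<Rightarrow> real) \<Rightarrow> (real \<Rightarrow> 'w \<Rightarrow> real) \<Rightarrow> real \<Rightarrow> nat \<Rightarrow> 'w \<Rightarrow> real" where
  "scaled_variation H K a X \<gamma> n \<omega> = real n powr (\<gamma> * H) * power_variation K a X \<gamma> n \<omega>"


section \<open>The estimators\<close>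

definition H_estimator ::
  "nat \<Rightarrow> (nat \<Rightarrow> real) \<Rightarrow> (real \<Rightarrow> 'w \<Rightarrow> real) \<Rightarrow> real \<Rightarrow> nat \<Rightarrow> 'w \<Rightarrow> real" where
  "H_estimator K a X \<beta> n \<omega> =
     1 / \<beta> * log 2 (power_variation K a X \<beta> (n div 2) \<omega> / power_variation K a X \<beta> n \<omega>)"

definition C_const :: "real \<Rightarrow> real \<Rightarrow> real" where
  "C_const u v = (u - v) / 2 * ln pi + u * ln (Gamma (1 + v / 2)) + v * ln (Gamma ((1 - u) / 2))
                 - v * ln (Gamma (1 + u / 2)) - u * ln (Gamma ((1 - v) / 2))"

definition psi_fun :: "real \<Rightarrow> real \<Rightarrow> real \<Rightarrow> real \<Rightarrow> real" where
  "psi_fun u v x y = - v * ln x + u * ln y + C_const u v"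

definition h_fun :: "real \<Rightarrow> real \<Rightarrow> real \<Rightarrow> real" where
  "h_fun u v x = u * ln (Gamma (1 + v / x)) - v * ln (Gamma (1 + u / x))"

text \<open>For \<open>u > v > 0\<close>, \<open>h_fun u v\<close> is a bijection from \<open>{0<..}\<close> onto \<open>{..<0}\<close>.\<close>

definition phi_fun :: "real \<Rightarrow> real \<Rightarrow> real \<Rightarrow> real" where
  "phi_fun u v x = (if x \<ge> 0 then 0 else the_inv_into {0<..} (h_fun u v) x)"

definition alpha_estimator ::
  "real \<Rightarrow> nat \<Rightarrow> (nat \<Rightarrow> real) \<Rightarrow> (real \<Rightarrow> 'w \<Rightarrow> real) \<Rightarrow> real \<Rightarrow> real \<Rightarrow> nat \<Rightarrow> 'w \<Rightarrow> real" where
  "alpha_estimator H K a X \<beta>\<^sub>1 \<beta>\<^sub>2 n \<omega> =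
     phi_fun (- \<beta>\<^sub>1) (- \<beta>\<^sub>2)
       (psi_fun (- \<beta>\<^sub>1) (- \<beta>\<^sub>2) (scaled_variation H K a X \<beta>\<^sub>1 n \<omega>) (scaled_variation H K a X \<beta>\<^sub>2 n \<omega>))"

definition rate :: "real \<Rightarrow> real \<Rightarrow> nat \<Rightarrow> nat \<Rightarrow> real" where
  "rate H \<alpha> L n =
     (if H < real L + 1 - 2 / \<alpha> then real n powr (- 1 / 2)
      else if H > real L + 1 - 2 / \<alpha> then real n powr ((\<alpha> * H - (real L + 1) * \<alpha>) / 4)
      else sqrt (ln (real n) / real n))"

text \<open>
  The estimator of \<open>H\<close> involves \<open>V\<^bsub>n/2\<^esub>\<close>, which needs \<open>n\<close> even and \<open>n / 2 \<ge> K\<close>. The estimator of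
  \<open>\<alpha>\<close> needs \<open>n \<ge> K\<close> only; \<open>n = 1\<close> is left out because \<open>ln 1 = 0\<close> makes the critical rate vanish.
\<close>

definition H_indices :: "nat \<Rightarrow> nat set" where
  "H_indices K = {n. even n \<and> 2 * K \<le> n}"

definition alpha_indices :: "nat \<Rightarrow> nat set" where
  "alpha_indices K = {n. K \<le> n \<and> 2 \<le> n}"

end

theory Submission
  imports Defs
begin

text \<open>
  Both estimators are smooth functions of empirical means of \<open>\<bar>n\<^sup>H \<Delta>\<^sub>p\<bar>\<^sup>-\<^sup>s\<close>, where \<open>\<Delta>\<^sub>p\<close> are the increments
  of order \<open>n\<close> and \<open>0 < s < 1/2\<close>. The proof computes the common expectation of the summands exactly,
  bounds the variance of the empirical mean by a multiple of the squared rate, and finishes with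
  Chebyshev's inequality and a Lipschitz estimate near the limit.

  Vanishing moments of \<open>a\<close> make \<open>n\<^sup>H \<Delta>\<^sub>p\<close> a stable integral whose law, jointly in \<open>p\<close>, is that of the
  integrals of \<open>g (y - p)\<close> for one fixed kernel \<open>g\<close> in \<open>L\<^sup>\<alpha>\<close> (lemma \<open>increment_pair_char\<close>): this combines
  self-similarity and stationarity. The joint characteristic function of two of them is
  \<open>exp (- \<integral>\<bar>u g (y - p) + v g (y - q)\<bar>\<^sup>\<alpha> dy)\<close>.

  A negative power is a mixture of Gaussian functions: up to a constant, \<open>\<bar>y\<bar>\<^sup>-\<^sup>s\<close> is the integral of
  \<open>t\<^sup>s\<^sup>-\<^sup>1 exp (- t\<^sup>2 y\<^sup>2 / 2)\<close> over \<open>t > 0\<close>, and a Gaussian function is itself the characteristic function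
  of a normal variable. Hence negative moments, also of products, are integrals of characteristic
  functions of stable variables against positive weights. All these integrands are nonnegative, so that
  Tonelli's theorem applies, whereas the Fourier integral of \<open>\<bar>y\<bar>\<^sup>-\<^sup>s\<close> converges only conditionally.
  For one variable this gives the closed formula with Gamma functions on which the estimator
  of \<open>\<alpha>\<close> is built (\<open>nn_integral_neg_moment\<close>, \<open>psi_neg_moments\<close>).

  For two variables, \<open>\<bar>\<integral>\<bar>f + h\<bar>\<^sup>\<alpha> - \<integral>\<bar>f\<bar>\<^sup>\<alpha> - \<integral>\<bar>h\<bar>\<^sup>\<alpha>\<bar> \<le> 2 \<integral>\<bar>f h\<bar>\<^sup>\<alpha>\<^sup>/\<^sup>2\<close> shows that the joint characteristic
  function is close to the product of the marginal ones as soon as the overlap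
  \<open>\<integral>\<bar>g (y - p) g (y - q)\<bar>\<^sup>\<alpha>\<^sup>/\<^sup>2 dy\<close> is small; the covariance of the negative powers is therefore at most
  a constant times this overlap (\<open>neg_moment_pair\<close>). If the overlap is not small, the covariance is still
  bounded by the moment of order \<open>- 2 s\<close>, which is finite because \<open>2 s < 1\<close>.

  Finally \<open>L + 1\<close> vanishing moments give \<open>g (y) = O (\<bar>y\<bar>\<^sup>H\<^sup>-\<^sup>1\<^sup>/\<^sup>\<alpha>\<^sup>-\<^sup>L\<^sup>-\<^sup>1)\<close>, and by the Cauchy-Schwarz inequality the
  overlap at distance \<open>j\<close> is \<open>O (j\<^sup>-\<^sup>\<tau>\<^sup>/\<^sup>2)\<close> with \<open>\<tau> = \<alpha> (L + 1 - H)\<close>. The variance is then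
  at most of the order of the Cesaro mean of \<open>j\<^sup>-\<^sup>\<tau>\<^sup>/\<^sup>2\<close>, and the three cases \<open>\<tau> > 2\<close>, \<open>\<tau> < 2\<close> and \<open>\<tau> = 2\<close> are the
  three cases of the rate (\<open>W_variance_rate\<close>).
\<close>

section \<open>Powers of absolute values and their integrals\<close>

text \<open>
  By homogeneity the claim is \<open>1 \<le> r\<^sup>e + (1 - r)\<^sup>e\<close> for \<open>0 \<le> r \<le> 1\<close>, which holds since \<open>r \<le> r\<^sup>e\<close> there.
\<close>

lemma powr_add_le_add_powr:
  fixes x y e :: real
  assumes "0 \<le> x" "0 \<le> y" "0 < e" "e \<le> 1"
  shows "(x + y) powr e \<le> x powr e + y powr e"
proof (cases "x + y = 0")
  case True
  then have "x = 0" "y = 0" using assms by auto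
  then show ?thesis by simp
next
  case False
  define s where "s = x + y"
  have s: "s > 0" using False assms by (simp add: s_def)
  have le: "u / s \<le> (u / s) powr e" if "0 \<le> u" "u \<le> s" for u
    using powr_mono'[of e 1 "u / s"] that s assms by (cases "u = 0") auto
  have "1 = x / s + y / s" using s by (simp add: s_def flip: add_divide_distrib)
  also have "\<dots> \<le> (x / s) powr e + (y / s) powr e"
    by (intro add_mono le) (use assms in \<open>auto simp: s_def\<close>)
  also have "\<dots> = (x powr e + y powr e) / s powr e"
    using assms s by (simp add: powr_divide add_divide_distrib)
  finally show ?thesis using s by (simp add: field_simps s_def)
qed

text \<open>
  With \<open>e = \<alpha> / 2 \<le> 1\<close>, the numbers \<open>A = \<bar>x\<bar>\<^sup>e\<close>, \<open>B = \<bar>y\<bar>\<^sup>e\<close> and \<open>D = \<bar>x + y\<bar>\<^sup>e\<close> satisfy the triangle inequalities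
  \<open>\<bar>A - B\<bar> \<le> D \<le> A + B\<close>; squaring them gives \<open>\<bar>D\<^sup>2 - A\<^sup>2 - B\<^sup>2\<bar> \<le> 2 A B\<close>. This treats \<open>\<alpha> \<le> 1\<close> and \<open>\<alpha> > 1\<close> alike.
\<close>

lemma abs_powr_add_defect:
  fixes x y \<alpha> :: real
  assumes "0 < \<alpha>" "\<alpha> \<le> 2"
  shows "\<bar>\<bar>x + y\<bar> powr \<alpha> - \<bar>x\<bar> powr \<alpha> - \<bar>y\<bar> powr \<alpha>\<bar> \<le> 2 * (\<bar>x\<bar> powr (\<alpha>/2) * \<bar>y\<bar> powr (\<alpha>/2))"
proof -
  define e where "e = \<alpha> / 2"
  have e: "0 < e" "e \<le> 1" using assms by (auto simp: e_def)
  have sub: "\<bar>u + v\<bar> powr e \<le> \<bar>u\<bar> powr e + \<bar>v\<bar> powr e" for u v :: real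
  proof -
    have "\<bar>u + v\<bar> powr e \<le> (\<bar>u\<bar> + \<bar>v\<bar>) powr e" using e by (intro powr_mono2) auto
    also have "\<dots> \<le> \<bar>u\<bar> powr e + \<bar>v\<bar> powr e" using e by (intro powr_add_le_add_powr) auto
    finally show ?thesis .
  qed
  have sq: "\<bar>u\<bar> powr \<alpha> = (\<bar>u\<bar> powr e)\<^sup>2" for u :: real
    by (simp add: e_def power2_eq_square powr_add[symmetric])
  define A B S where "A = \<bar>x\<bar> powr e" and "B = \<bar>y\<bar> powr e" and "S = \<bar>x + y\<bar> powr e"
  have up: "S \<le> A + B" using sub[of x y] by (simp add: A_def B_def S_def)
  have "A \<le> S + B" using sub[of "x + y" "- y"] by (simp add: A_def B_def S_def)
  moreover have "B \<le> S + A" using sub[of "x + y" "- x"] by (simp add: A_def B_def S_def)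
  ultimately have "\<bar>A - B\<bar> \<le> S" by auto
  have "0 \<le> S" by (simp add: S_def)
  have "S\<^sup>2 \<le> (A + B)\<^sup>2" using up \<open>0 \<le> S\<close> by (intro power_mono) auto
  moreover have "(A - B)\<^sup>2 \<le> S\<^sup>2" using power_mono[OF \<open>\<bar>A - B\<bar> \<le> S\<close>, of 2] by simp
  ultimately have "\<bar>S\<^sup>2 - A\<^sup>2 - B\<^sup>2\<bar> \<le> 2 * (A * B)"
    by (simp add: power2_eq_square algebra_simps abs_le_iff)
  then show ?thesis by (simp add: sq A_def B_def S_def e_def)
qed

lemma Cauchy_Schwarz_integral:
  fixes f g :: "'a \<Rightarrow> real"
  assumes [measurable]: "f \<in> borel_measurable M" "g \<in> borel_measurable M"
    and f2: "integrable M (\<lambda>x. (f x)\<^sup>2)" and g2: "integrable M (\<lambda>x. (g x)\<^sup>2)"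
  shows "integrable M (\<lambda>x. f x * g x)"
    and "\<bar>\<integral>x. f x * g x \<partial>M\<bar> \<le> sqrt (\<integral>x. (f x)\<^sup>2 \<partial>M) * sqrt (\<integral>x. (g x)\<^sup>2 \<partial>M)"
proof -
  show *: "integrable M (\<lambda>x. f x * g x)"
  proof (rule Bochner_Integration.integrable_bound)
    show "integrable M (\<lambda>x. (f x)\<^sup>2 + (g x)\<^sup>2)" using f2 g2 by simp
    have "\<bar>f x * g x\<bar> \<le> (f x)\<^sup>2 + (g x)\<^sup>2" for x
    proof -
      have "0 \<le> (\<bar>f x\<bar> - \<bar>g x\<bar>)\<^sup>2" by simp
      then have "2 * (\<bar>f x\<bar> * \<bar>g x\<bar>) \<le> (f x)\<^sup>2 + (g x)\<^sup>2"
        by (simp add: power2_diff algebra_simps)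
      moreover have "0 \<le> \<bar>f x\<bar> * \<bar>g x\<bar>" by simp
      ultimately show ?thesis unfolding abs_mult by linarith
    qed
    then show "AE x in M. norm (f x * g x) \<le> norm ((f x)\<^sup>2 + (g x)\<^sup>2)" by auto
  qed auto
  let ?I = "\<integral>x. \<bar>f x\<bar> * \<bar>g x\<bar> \<partial>M"
  have abs_int: "integrable M (\<lambda>x. \<bar>f x\<bar> * \<bar>g x\<bar>)"
    using integrable_abs[OF *] by (simp add: abs_mult)
  have "(\<integral>\<^sup>+x. ennreal \<bar>f x\<bar> * ennreal \<bar>g x\<bar> \<partial>M)\<^sup>2
      \<le> (\<integral>\<^sup>+x. (ennreal \<bar>f x\<bar>)^2 \<partial>M) * (\<integral>\<^sup>+x. (ennreal \<bar>g x\<bar>)^2 \<partial>M)"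
    by (rule Cauchy_Schwarz_nn_integral) auto
  then have "ennreal (?I\<^sup>2) \<le> ennreal ((\<integral>x. (f x)\<^sup>2 \<partial>M) * (\<integral>x. (g x)\<^sup>2 \<partial>M))"
    using abs_int f2 g2
    by (simp add: ennreal_mult[symmetric] ennreal_power nn_integral_eq_integral)
  then have "?I\<^sup>2 \<le> (\<integral>x. (f x)\<^sup>2 \<partial>M) * (\<integral>x. (g x)\<^sup>2 \<partial>M)"
    by (subst (asm) ennreal_le_iff) auto
  then have "?I \<le> sqrt ((\<integral>x. (f x)\<^sup>2 \<partial>M) * (\<integral>x. (g x)\<^sup>2 \<partial>M))"
    by (rule real_le_rsqrt)
  moreover have "\<bar>\<integral>x. f x * g x \<partial>M\<bar> \<le> ?I"
    using integral_norm_bound[of M "\<lambda>x. f x * g x"] by (simp add: abs_mult)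
  ultimately show "\<bar>\<integral>x. f x * g x \<partial>M\<bar> \<le> sqrt (\<integral>x. (f x)\<^sup>2 \<partial>M) * sqrt (\<integral>x. (g x)\<^sup>2 \<partial>M)"
    by (simp add: real_sqrt_mult)
qed

lemma powr_half_product_integral:
  fixes f g :: "'a \<Rightarrow> real"
  assumes [measurable]: "f \<in> borel_measurable M" "g \<in> borel_measurable M"
    and f2: "integrable M (\<lambda>x. \<bar>f x\<bar> powr \<alpha>)" and g2: "integrable M (\<lambda>x. \<bar>g x\<bar> powr \<alpha>)"
  shows "integrable M (\<lambda>x. \<bar>f x\<bar> powr (\<alpha>/2) * \<bar>g x\<bar> powr (\<alpha>/2))"
    and "(\<integral>x. \<bar>f x\<bar> powr (\<alpha>/2) * \<bar>g x\<bar> powr (\<alpha>/2) \<partial>M)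
           \<le> sqrt (\<integral>x. \<bar>f x\<bar> powr \<alpha> \<partial>M) * sqrt (\<integral>x. \<bar>g x\<bar> powr \<alpha> \<partial>M)"
proof -
  have sq: "(\<bar>u\<bar> powr (\<alpha>/2))\<^sup>2 = \<bar>u\<bar> powr \<alpha>" for u :: real
    by (simp add: power2_eq_square powr_add[symmetric])
  show "integrable M (\<lambda>x. \<bar>f x\<bar> powr (\<alpha>/2) * \<bar>g x\<bar> powr (\<alpha>/2))"
    by (rule Cauchy_Schwarz_integral) (use f2 g2 in \<open>auto simp: sq\<close>)
  have "\<bar>\<integral>x. \<bar>f x\<bar> powr (\<alpha>/2) * \<bar>g x\<bar> powr (\<alpha>/2) \<partial>M\<bar>
           \<le> sqrt (\<integral>x. (\<bar>f x\<bar> powr (\<alpha>/2))\<^sup>2 \<partial>M) * sqrt (\<integral>x. (\<bar>g x\<bar> powr (\<alpha>/2))\<^sup>2 \<partial>M)"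
    by (rule Cauchy_Schwarz_integral) (use f2 g2 in \<open>auto simp: sq\<close>)
  then show "(\<integral>x. \<bar>f x\<bar> powr (\<alpha>/2) * \<bar>g x\<bar> powr (\<alpha>/2) \<partial>M)
           \<le> sqrt (\<integral>x. \<bar>f x\<bar> powr \<alpha> \<partial>M) * sqrt (\<integral>x. \<bar>g x\<bar> powr \<alpha> \<partial>M)"
    by (simp add: sq)
qed

lemma integral_powr_add_defect:
  fixes f g :: "'a \<Rightarrow> real"
  assumes "0 < \<alpha>" "\<alpha> \<le> 2"
    and [measurable]: "f \<in> borel_measurable M" "g \<in> borel_measurable M"
    and f: "integrable M (\<lambda>x. \<bar>f x\<bar> powr \<alpha>)" and g: "integrable M (\<lambda>x. \<bar>g x\<bar> powr \<alpha>)"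
  shows "integrable M (\<lambda>x. \<bar>f x + g x\<bar> powr \<alpha>)"
    and "\<bar>(\<integral>x. \<bar>f x + g x\<bar> powr \<alpha> \<partial>M) - (\<integral>x. \<bar>f x\<bar> powr \<alpha> \<partial>M) - (\<integral>x. \<bar>g x\<bar> powr \<alpha> \<partial>M)\<bar>
           \<le> 2 * (\<integral>x. \<bar>f x\<bar> powr (\<alpha>/2) * \<bar>g x\<bar> powr (\<alpha>/2) \<partial>M)"
proof -
  note fg = powr_half_product_integral[OF assms(3-6)]
  note defect = abs_powr_add_defect[OF assms(1,2)]
  show *: "integrable M (\<lambda>x. \<bar>f x + g x\<bar> powr \<alpha>)"
  proof (rule Bochner_Integration.integrable_bound)
    let ?b = "\<lambda>x. \<bar>f x\<bar> powr \<alpha> + \<bar>g x\<bar> powr \<alpha> + 2 * (\<bar>f x\<bar> powr (\<alpha>/2) * \<bar>g x\<bar> powr (\<alpha>/2))"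
    show "integrable M ?b" using f g fg by simp
    show "AE x in M. norm (\<bar>f x + g x\<bar> powr \<alpha>) \<le> norm (?b x)"
    proof (rule AE_I2)
      fix x
      have "0 \<le> ?b x" by (intro add_nonneg_nonneg mult_nonneg_nonneg) auto
      then show "norm (\<bar>f x + g x\<bar> powr \<alpha>) \<le> norm (?b x)"
        using defect[of "f x" "g x"] by (simp add: abs_le_iff)
    qed
  qed auto
  have "\<bar>\<integral>x. \<bar>f x + g x\<bar> powr \<alpha> - \<bar>f x\<bar> powr \<alpha> - \<bar>g x\<bar> powr \<alpha> \<partial>M\<bar>
     \<le> (\<integral>x. \<bar>\<bar>f x + g x\<bar> powr \<alpha> - \<bar>f x\<bar> powr \<alpha> - \<bar>g x\<bar> powr \<alpha>\<bar> \<partial>M)"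
    by (rule integral_abs_bound)
  also have "\<dots> \<le> (\<integral>x. 2 * (\<bar>f x\<bar> powr (\<alpha>/2) * \<bar>g x\<bar> powr (\<alpha>/2)) \<partial>M)"
    using * f g fg by (intro integral_mono defect) auto
  finally show "\<bar>(\<integral>x. \<bar>f x + g x\<bar> powr \<alpha> \<partial>M) - (\<integral>x. \<bar>f x\<bar> powr \<alpha> \<partial>M) - (\<integral>x. \<bar>g x\<bar> powr \<alpha> \<partial>M)\<bar>
           \<le> 2 * (\<integral>x. \<bar>f x\<bar> powr (\<alpha>/2) * \<bar>g x\<bar> powr (\<alpha>/2) \<partial>M)"
    using * f g by simp
qed

section \<open>Characteristic functions of stable integrals\<close>

locale stable_measure =
  fixes P :: "'w measure" and \<alpha> :: real and M :: "real set \<Rightarrow> 'w \<Rightarrow> real"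
  assumes stable: "stable_random_measure P \<alpha> M" and alpha: "0 < \<alpha>" "\<alpha> \<le> 2"
begin

sublocale prob_space P using stable by (simp add: stable_random_measure_def)

lemma M_measurable: "A \<in> finite_borel \<Longrightarrow> M A \<in> borel_measurable P"
  using stable by (simp add: stable_random_measure_def)

lemma empty_finite_borel: "{} \<in> finite_borel"
  by (simp add: finite_borel_def)

lemma finite_borel_UN: "finite I \<Longrightarrow> A ` I \<subseteq> finite_borel \<Longrightarrow> (\<Union>i\<in>I. A i) \<in> finite_borel"
proof (induction rule: finite_induct)
  case (insert x F)
  have "emeasure lborel (A x \<union> (\<Union>i\<in>F. A i)) \<le> emeasure lborel (A x) + emeasure lborel (\<Union>i\<in>F. A i)"
    using insert by (intro emeasure_subadditive) (auto simp: finite_borel_def)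
  also have "\<dots> < \<infinity>" using insert by (auto simp: finite_borel_def)
  finally show ?case using insert by (auto simp: finite_borel_def)
qed (simp add: empty_finite_borel)

lemma finite_borel_subset: "A \<in> finite_borel \<Longrightarrow> B \<in> sets lborel \<Longrightarrow> B \<subseteq> A \<Longrightarrow> B \<in> finite_borel"
  using emeasure_mono[of B A lborel] by (auto simp: finite_borel_def intro: le_less_trans)

lemma sigma_additive:
  fixes A :: "nat \<Rightarrow> real set"
  assumes "range A \<subseteq> finite_borel" "disjoint_family A" "(\<Union>i. A i) \<in> finite_borel"
  shows "AE \<omega> in P. (\<lambda>i. M (A i) \<omega>) sums M (\<Union>i. A i) \<omega>"
  using stable[unfolded stable_random_measure_def, THEN conjunct2, THEN conjunct2, THEN conjunct2,
      THEN conjunct2, rule_format] assms by simp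

lemma M_char:
  "A \<in> finite_borel \<Longrightarrow>
   char (distr P borel (M A)) \<theta> = complex_of_real (exp (- (\<bar>\<theta>\<bar> powr \<alpha> * measure lborel A)))"
  using stable[unfolded stable_random_measure_def, THEN conjunct2, THEN conjunct2, THEN conjunct1,
      rule_format] .

lemma M_indep:
  fixes A :: "nat \<Rightarrow> real set"
  assumes "A ` {..<n} \<subseteq> finite_borel" "disjoint_family_on A {..<n}"
  shows "indep_vars (\<lambda>_. borel) (\<lambda>i. M (A i)) {..<n}"
  using stable[unfolded stable_random_measure_def, THEN conjunct2, THEN conjunct2, THEN conjunct2,
      THEN conjunct1, rule_format] assms by simp

lemma M_empty: "AE \<omega> in P. M {} \<omega> = 0"
proof -
  have "AE \<omega> in P. (\<lambda>i::nat. M {} \<omega>) sums M (\<Union>i::nat. {}) \<omega>"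
    by (rule sigma_additive) (auto simp: disjoint_family_on_def empty_finite_borel)
  then show ?thesis
    by eventually_elim (simp add: sums_iff summable_const_iff)
qed

lemma M_Un:
  assumes "A \<in> finite_borel" "B \<in> finite_borel" "A \<inter> B = {}"
  shows "AE \<omega> in P. M (A \<union> B) \<omega> = M A \<omega> + M B \<omega>"
proof -
  define D where "D = (\<lambda>i::nat. if i = 0 then A else if i = 1 then B else {})"
  have UD: "(\<Union>i. D i) = A \<union> B"
    by (auto simp: D_def split: if_splits)
  have "A \<union> B \<in> finite_borel"
    using finite_borel_UN[of "{A,B}" "\<lambda>x. x"] assms by simp
  then have "AE \<omega> in P. (\<lambda>i. M (D i) \<omega>) sums M (\<Union>i. D i) \<omega>"
    using assms UD
    by (intro sigma_additive) (auto simp: D_def disjoint_family_on_def empty_finite_borel)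
  with M_empty show ?thesis
  proof eventually_elim
    case (elim \<omega>)
    have "(\<lambda>i. M (D i) \<omega>) sums (\<Sum>i\<in>{0,1}. M (D i) \<omega>)"
      using elim by (intro sums_finite) (auto simp: D_def)
    then have "M (\<Union>i. D i) \<omega> = (\<Sum>i\<in>{0,1}. M (D i) \<omega>)"
      using elim(2) sums_unique2 by blast
    then show ?case unfolding UD by (simp add: D_def)
  qed
qed

lemma M_UN:
  assumes "finite I" "A ` I \<subseteq> finite_borel" "disjoint_family_on A I"
  shows "AE \<omega> in P. M (\<Union>i\<in>I. A i) \<omega> = (\<Sum>i\<in>I. M (A i) \<omega>)"
  using assms
proof (induction rule: finite_induct)
  case empty
  then show ?case using M_empty by simp
next
  case (insert x F)
  have "AE \<omega> in P. M (A x \<union> (\<Union>i\<in>F. A i)) \<omega> = M (A x) \<omega> + M (\<Union>i\<in>F. A i) \<omega>"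
    using insert by (intro M_Un finite_borel_UN) (auto simp: disjoint_family_on_def)
  moreover have "AE \<omega> in P. M (\<Union>i\<in>F. A i) \<omega> = (\<Sum>i\<in>F. M (A i) \<omega>)"
    using insert by (auto intro: disjoint_family_on_mono[of F])
  ultimately show ?case
    by eventually_elim (simp add: insert.hyps)
qed

text \<open>
  Coefficients may repeat or vanish: two simple functions can then be written over one and the same
  family of disjoint sets, which is what linearity of the integral needs.
\<close>

definition step_sum :: "nat \<Rightarrow> (nat \<Rightarrow> real) \<Rightarrow> (nat \<Rightarrow> real set) \<Rightarrow> real \<Rightarrow> real" where
  "step_sum n c A x = (\<Sum>i<n. c i * indicator (A i) x)"

lemma step_sum_eq:
  assumes "disjoint_family_on A {..<n}" "x \<in> A i" "i < n"
  shows "step_sum n c A x = c i"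
proof -
  have "(\<Sum>j<n. c j * indicator (A j) x) = (\<Sum>j<n. if j = i then c i else 0)"
    using assms by (intro sum.cong) (auto simp: disjoint_family_on_def indicator_def)
  then show ?thesis using assms by (simp add: step_sum_def)
qed

lemma step_sum_eq_0: "(\<And>i. i < n \<Longrightarrow> x \<notin> A i) \<Longrightarrow> step_sum n c A x = 0"
  by (simp add: step_sum_def)

lemma step_sum_comp:
  assumes "disjoint_family_on A {..<n}" "F 0 = 0"
  shows "F (step_sum n c A x) = step_sum n (\<lambda>i. F (c i)) A x"
proof (cases "\<exists>i<n. x \<in> A i")
  case True
  then obtain i where i: "x \<in> A i" "i < n" by blast
  show ?thesis by (simp only: step_sum_eq[OF assms(1) i])
next
  case False
  then have "step_sum n d A x = 0" for d by (intro step_sum_eq_0) blast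
  then show ?thesis by (simp only: assms(2))
qed

text \<open>
  The integral sums over the distinct nonzero values, so the sets carrying the same value have to be
  merged by additivity of \<open>M\<close>. Additivity holds outside a null set only, and finitely many such null
  sets occur.
\<close>

lemma simple_integral_step_sum:
  assumes A: "A ` {..<n} \<subseteq> finite_borel" "disjoint_family_on A {..<n}"
  shows "AE \<omega> in P. stable_simple_integral M (step_sum n c A) \<omega> = (\<Sum>i<n. c i * M (A i) \<omega>)"
proof -
  let ?s = "step_sum n c A"
  define R where "R = c ` {..<n} - {0}"
  have "range ?s - {0} \<subseteq> R"
  proof (rule subsetI)
    fix y assume "y \<in> range ?s - {0}"
    then obtain x where y: "y = ?s x" and *: "?s x \<noteq> 0" by blast
    then obtain i where i: "i < n" "x \<in> A i" using step_sum_eq_0[of n x A c] by metis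
    then show "y \<in> R" using * step_sum_eq[OF A(2) i(2,1), of c] by (auto simp: R_def y)
  qed
  have vimage: "?s -` {y} = (\<Union>i\<in>{i. i < n \<and> c i = y}. A i)" if "y \<noteq> 0" for y
  proof (intro equalityI subsetI)
    fix x assume x: "x \<in> ?s -` {y}"
    then have "?s x \<noteq> 0" using that by simp
    then obtain i where i: "i < n" "x \<in> A i" using step_sum_eq_0[of n x A c] by metis
    then show "x \<in> (\<Union>i\<in>{i. i < n \<and> c i = y}. A i)"
      using x step_sum_eq[OF A(2) i(2,1), of c] by auto
  next
    fix x assume "x \<in> (\<Union>i\<in>{i. i < n \<and> c i = y}. A i)"
    then obtain i where i: "i < n" "x \<in> A i" "c i = y" by auto
    then show "x \<in> ?s -` {y}" using step_sum_eq[OF A(2) i(2,1), of c] by simp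
  qed
  have "AE \<omega> in P. \<forall>y\<in>R. M (?s -` {y}) \<omega> = (\<Sum>i\<in>{i. i < n \<and> c i = y}. M (A i) \<omega>)"
  proof (rule AE_finite_allI)
    show "finite R" by (simp add: R_def)
    fix y assume "y \<in> R"
    then have "y \<noteq> 0" by (auto simp: R_def)
    show "AE \<omega> in P. M (?s -` {y}) \<omega> = (\<Sum>i\<in>{i. i < n \<and> c i = y}. M (A i) \<omega>)"
      unfolding vimage[OF \<open>y \<noteq> 0\<close>]
      using A by (intro M_UN) (auto simp: disjoint_family_on_def)
  qed
  with M_empty show ?thesis
  proof eventually_elim
    case (elim \<omega>)
    have "stable_simple_integral M ?s \<omega> = (\<Sum>y\<in>R. y * M (?s -` {y}) \<omega>)"
      unfolding stable_simple_integral_def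
    proof (rule sum.mono_neutral_left)
      show "\<forall>y\<in>R - (range ?s - {0}). y * M (?s -` {y}) \<omega> = 0"
      proof
        fix y assume "y \<in> R - (range ?s - {0})"
        then have "y \<notin> range ?s" by (auto simp: R_def)
        then have "?s -` {y} = {}" by blast
        then show "y * M (?s -` {y}) \<omega> = 0" using elim(1) by simp
      qed
        show "finite R" by (simp add: R_def)
      show "range ?s - {0} \<subseteq> R" by fact
    qed
    also have "\<dots> = (\<Sum>y\<in>R. \<Sum>i\<in>{i. i < n \<and> c i = y}. c i * M (A i) \<omega>)"
      using elim(2) by (intro sum.cong) (auto simp: sum_distrib_left)
    also have "\<dots> = (\<Sum>y\<in>c ` {..<n}. \<Sum>i\<in>{i. i < n \<and> c i = y}. c i * M (A i) \<omega>)"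
      by (rule sum.mono_neutral_left) (auto simp: R_def intro!: sum.neutral)
    also have "\<dots> = (\<Sum>i<n. c i * M (A i) \<omega>)"
      using sum.group[of "{..<n}" "c ` {..<n}" c "\<lambda>i. c i * M (A i) \<omega>"] by simp
    finally show ?case .
  qed
qed

lemma char_simple_sum:
  fixes n :: nat
  assumes A: "A ` {..<n} \<subseteq> finite_borel" "disjoint_family_on A {..<n}"
  shows "char (distr P borel (\<lambda>\<omega>. \<Sum>i<n. c i * M (A i) \<omega>)) \<theta>
     = exp (- (\<bar>\<theta>\<bar> powr \<alpha> * (\<Sum>i<n. \<bar>c i\<bar> powr \<alpha> * measure lborel (A i))))"
proof -
  have [measurable]: "M (A i) \<in> borel_measurable P" if "i < n" for i
    using A that by (intro M_measurable) auto
  have "indep_vars (\<lambda>_. borel) (\<lambda>i. M (A i)) {..<n}"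
    using A by (rule M_indep)
  then have ind: "indep_vars (\<lambda>_. borel) (\<lambda>i \<omega>. c i * M (A i) \<omega>) {..<n}"
    by (rule indep_vars_compose2[where Y="\<lambda>i x. c i * x"]) auto
  have "char (distr P borel (\<lambda>\<omega>. c i * M (A i) \<omega>)) \<theta>
      = exp (- (\<bar>\<theta>\<bar> powr \<alpha> * (\<bar>c i\<bar> powr \<alpha> * measure lborel (A i))))" if "i < n" for i
  proof -
    have "char (distr P borel (\<lambda>\<omega>. c i * M (A i) \<omega>)) \<theta> = char (distr P borel (M (A i))) (c i * \<theta>)"
      unfolding char_def using that by (simp add: integral_distr mult_ac)
    also have "\<dots> = exp (- (\<bar>c i * \<theta>\<bar> powr \<alpha> * measure lborel (A i)))"
      using A that by (intro M_char) auto
    finally show ?thesis by (simp add: abs_mult powr_mult mult_ac)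
  qed
  then have "char (distr P borel (\<lambda>\<omega>. \<Sum>i<n. c i * M (A i) \<omega>)) \<theta>
     = (\<Prod>i<n. exp (- (\<bar>\<theta>\<bar> powr \<alpha> * (\<bar>c i\<bar> powr \<alpha> * measure lborel (A i)))))"
    by (subst char_distr_sum[OF ind]) simp
  then show ?thesis
    by (simp add: exp_sum[symmetric] exp_of_real sum_distrib_left sum_negf flip: of_real_prod)
qed

lemma step_sum_integral:
  assumes A: "A ` {..<n} \<subseteq> finite_borel"
  shows "integrable lborel (step_sum n c A)"
    and "(\<integral>x. step_sum n c A x \<partial>lborel) = (\<Sum>i<n. c i * measure lborel (A i))"
proof -
  have "integrable lborel (indicator (A i) :: real \<Rightarrow> real)" if "i < n" for i
    using A that by (intro integrable_real_indicator) (auto simp: finite_borel_def)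
  then have *: "integrable lborel (\<lambda>x. c i * indicator (A i) x :: real)" if "i < n" for i
    using that by (intro integrable_mult_right) auto
  then show "integrable lborel (step_sum n c A)"
    unfolding step_sum_def[abs_def] by (intro Bochner_Integration.integrable_sum) simp
  have "A i \<inter> space lborel = A i" for i by simp
  then show "(\<integral>x. step_sum n c A x \<partial>lborel) = (\<Sum>i<n. c i * measure lborel (A i))"
    unfolding step_sum_def[abs_def] using *
    by (simp_all del: space_lborel sum_mult_indicator integrable_mult_right_iff
          add: Bochner_Integration.integral_sum)
qed

definition fin_simple :: "(real \<Rightarrow> real) \<Rightarrow> bool" where
  "fin_simple s \<longleftrightarrow> simple_function lborel s \<and> {x. s x \<noteq> 0} \<in> finite_borel"

text \<open>
  The sets are the joint fibres of \<open>s\<close> and \<open>t\<close>. The fibre over \<open>(0, 0)\<close> is left out, as it has infinite measure.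
\<close>

lemma common_refinement:
  assumes s: "fin_simple s" and t: "fin_simple t"
  obtains n A c d where "A ` {..<n} \<subseteq> finite_borel" "disjoint_family_on A {..<n}"
    "s = step_sum n c A" "t = step_sum n d A"
proof -
  define J where "J = range s \<times> range t - {(0,0)}"
  define B where "B = (\<lambda>(y,z). s -` {y} \<inter> t -` {z})"
  have "finite J" using s t by (auto simp: J_def fin_simple_def simple_function_def)
  then obtain h where h: "bij_betw h {0..<card J} J" using ex_bij_betw_nat_finite by blast
  define n A c d where "n = card J" and "A = B \<circ> h" and "c = fst \<circ> h" and "d = snd \<circ> h"
  have inj: "inj_on h {..<n}" and img: "h ` {..<n} = J"
    using h by (auto simp: bij_betw_def n_def lessThan_atLeast0)
  have meas: "s -` {y} \<in> sets lborel" "t -` {y} \<in> sets lborel" for y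
    using s t simple_functionD(2)[of lborel s "{y}"] simple_functionD(2)[of lborel t "{y}"]
    by (auto simp: fin_simple_def)
  have "A ` {..<n} \<subseteq> finite_borel"
  proof safe
    fix i assume "i < n"
    then have "h i \<in> J" using img by auto
    then have nz: "fst (h i) \<noteq> 0 \<or> snd (h i) \<noteq> 0" by (auto simp: J_def prod_eq_iff)
    have m: "A i \<in> sets lborel" using meas by (auto simp: A_def B_def case_prod_unfold)
    from nz have "A i \<subseteq> {x. s x \<noteq> 0} \<or> A i \<subseteq> {x. t x \<noteq> 0}"
      by (auto simp: A_def B_def case_prod_unfold)
    then show "A i \<in> finite_borel"
      using finite_borel_subset[OF _ m] s t unfolding fin_simple_def by blast
  qed
  moreover have dis: "disjoint_family_on A {..<n}"
    unfolding disjoint_family_on_def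
  proof (intro ballI impI)
    fix i j assume "i \<in> {..<n}" "j \<in> {..<n}" "i \<noteq> j"
    then have "h i \<noteq> h j" using inj by (auto simp: inj_on_def)
    then show "A i \<inter> A j = {}" by (auto simp: A_def B_def case_prod_unfold prod_eq_iff)
  qed
  moreover have "s x = step_sum n c A x \<and> t x = step_sum n d A x" for x
  proof (cases "s x = 0 \<and> t x = 0")
    case True
    have "x \<notin> A i" if "i < n" for i
    proof -
      have "h i \<in> J" using img that by auto
      then show ?thesis using True by (auto simp: A_def B_def case_prod_unfold J_def prod_eq_iff)
    qed
    then show ?thesis using True by (simp add: step_sum_eq_0)
  next
    case False
    then have "(s x, t x) \<in> J" by (auto simp: J_def)
    then obtain i where i: "i < n" "h i = (s x, t x)" using img by (metis imageE lessThan_iff)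
    then have "x \<in> A i" by (simp add: A_def B_def)
    from step_sum_eq[OF dis this i(1)] show ?thesis using i by (simp add: c_def d_def)
  qed
  then have "s = step_sum n c A" "t = step_sum n d A" by auto
  ultimately show ?thesis using that by blast
qed

lemma simple_integral_measurable:
  assumes "fin_simple s"
  shows "stable_simple_integral M s \<in> borel_measurable P"
proof -
  have "M (s -` {y}) \<in> borel_measurable P" if "y \<noteq> 0" for y
  proof (rule M_measurable, rule finite_borel_subset)
    show "{x. s x \<noteq> 0} \<in> finite_borel" using assms by (simp add: fin_simple_def)
    show "s -` {y} \<in> sets lborel"
      using assms simple_functionD(2)[of lborel s "{y}"] by (simp add: fin_simple_def)
  qed (use that in auto)
  then have "(\<lambda>\<omega>. \<Sum>y\<in>range s - {0}. y * M (s -` {y}) \<omega>) \<in> borel_measurable P"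
    by (intro borel_measurable_sum borel_measurable_times) auto
  then show ?thesis by (simp add: stable_simple_integral_def[abs_def])
qed

lemma simple_integral_linear:
  assumes s: "fin_simple s" and t: "fin_simple t"
  shows "fin_simple (\<lambda>x. u * s x + v * t x)"
    and "AE \<omega> in P. stable_simple_integral M (\<lambda>x. u * s x + v * t x) \<omega>
           = u * stable_simple_integral M s \<omega> + v * stable_simple_integral M t \<omega>"
proof -
  obtain n A c d where A: "A ` {..<n} \<subseteq> finite_borel" "disjoint_family_on A {..<n}"
    and st: "s = step_sum n c A" "t = step_sum n d A"
    using common_refinement[OF s t] .
  have *: "(\<lambda>x. u * s x + v * t x) = step_sum n (\<lambda>i. u * c i + v * d i) A"
    by (rule ext) (simp add: st step_sum_def sum_distrib_left sum.distrib distrib_right mult.assoc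
        del: sum_mult_indicator)
  from simple_integral_step_sum[OF A, of c] simple_integral_step_sum[OF A, of d]
    simple_integral_step_sum[OF A, of "\<lambda>i. u * c i + v * d i"]
  show "AE \<omega> in P. stable_simple_integral M (\<lambda>x. u * s x + v * t x) \<omega>
           = u * stable_simple_integral M s \<omega> + v * stable_simple_integral M t \<omega>"
    unfolding *
    by eventually_elim (simp add: st sum_distrib_left sum.distrib distrib_right mult.assoc)
  have sf: "simple_function lborel (\<lambda>x. u * s x + v * t x)"
    using s t unfolding fin_simple_def by (intro simple_function_add simple_function_mult) auto
  have "{x. u * s x + v * t x \<noteq> 0} \<in> sets lborel"
    using borel_measurable_simple_function[OF sf] by measurable
  moreover have "{x. s x \<noteq> 0} \<union> {x. t x \<noteq> 0} \<in> finite_borel"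
    using s t finite_borel_UN[of "{{x. s x \<noteq> 0}, {x. t x \<noteq> 0}}" "\<lambda>x. x"] by (simp add: fin_simple_def)
  ultimately show "fin_simple (\<lambda>x. u * s x + v * t x)"
    using sf finite_borel_subset[of "{x. s x \<noteq> 0} \<union> {x. t x \<noteq> 0}" "{x. u * s x + v * t x \<noteq> 0}"]
    by (fastforce simp: fin_simple_def)
qed

lemma fin_simple_powr_integrable:
  assumes s: "fin_simple s"
  shows "integrable lborel (\<lambda>x. \<bar>s x\<bar> powr \<alpha>)"
  and "char (distr P borel (stable_simple_integral M s)) \<theta>
         = exp (- (\<bar>\<theta>\<bar> powr \<alpha> * (\<integral>x. \<bar>s x\<bar> powr \<alpha> \<partial>lborel)))"
proof -
  obtain n A c d where A: "A ` {..<n} \<subseteq> finite_borel" "disjoint_family_on A {..<n}"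
    and st: "s = step_sum n c A" "s = step_sum n d A"
    using common_refinement[OF s s] .
  have *: "(\<lambda>x. \<bar>s x\<bar> powr \<alpha>) = step_sum n (\<lambda>i. \<bar>c i\<bar> powr \<alpha>) A"
    using step_sum_comp[OF A(2), of "\<lambda>y. \<bar>y\<bar> powr \<alpha>" c] by (auto simp: st(1))
  show "integrable lborel (\<lambda>x. \<bar>s x\<bar> powr \<alpha>)"
    using step_sum_integral(1)[OF A(1)] by (simp add: *)
  have [measurable]: "M (A i) \<in> borel_measurable P" if "i < n" for i
    using A that by (intro M_measurable) auto
  note [measurable] = simple_integral_measurable[OF s]
  have "char (distr P borel (stable_simple_integral M s)) \<theta>
      = char (distr P borel (\<lambda>\<omega>. \<Sum>i<n. c i * M (A i) \<omega>)) \<theta>"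
    using simple_integral_step_sum[OF A, of c]
    by (intro arg_cong[where f="\<lambda>D. char D \<theta>"] distr_cong_AE) (auto simp: st(1)[symmetric])
  also have "\<dots> = exp (- (\<bar>\<theta>\<bar> powr \<alpha> * (\<integral>x. \<bar>s x\<bar> powr \<alpha> \<partial>lborel)))"
    by (simp add: char_simple_sum[OF A] * step_sum_integral(2)[OF A(1)])
  finally show "char (distr P borel (stable_simple_integral M s)) \<theta>
         = exp (- (\<bar>\<theta>\<bar> powr \<alpha> * (\<integral>x. \<bar>s x\<bar> powr \<alpha> \<partial>lborel)))" .
qed
lemma is_stable_integral_iff:
  "is_stable_integral P \<alpha> M f Y \<longleftrightarrow> f \<in> borel_measurable borel \<and>
     (\<exists>s. (\<forall>n. fin_simple (s n)) \<and>
        (\<lambda>n. \<integral>\<^sup>+ x. ennreal (\<bar>f x - s n x\<bar> powr \<alpha>) \<partial>lborel) \<longlonglongrightarrow> 0 \<and>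
        conv_in_prob P UNIV (\<lambda>n. stable_simple_integral M (s n)) Y)"
  by (simp add: is_stable_integral_def fin_simple_def)

lemma stable_integral_measurable:
  "is_stable_integral P \<alpha> M f Y \<Longrightarrow> Y \<in> borel_measurable P"
  "is_stable_integral P \<alpha> M f Y \<Longrightarrow> f \<in> borel_measurable borel"
  by (auto simp: is_stable_integral_def conv_in_prob_def)

lemma fin_simple_measurable: "fin_simple s \<Longrightarrow> s \<in> borel_measurable borel"
  using borel_measurable_simple_function[of lborel s] by (simp add: fin_simple_def)

lemma stable_integral_zero: "is_stable_integral P \<alpha> M (\<lambda>_. 0) (\<lambda>_. 0)"
proof -
  have "stable_simple_integral M (\<lambda>_. 0) = (\<lambda>_. 0)"
    by (rule ext) (simp add: stable_simple_integral_def)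
  then show ?thesis
    unfolding is_stable_integral_def
    by (auto intro!: exI[of _ "\<lambda>_ _. 0"] simp: empty_finite_borel conv_in_prob_def)
qed

lemma abs_powr_add_le: "\<bar>x + y\<bar> powr \<alpha> \<le> 2 * \<bar>x\<bar> powr \<alpha> + 2 * \<bar>y\<bar> powr \<alpha>"
proof -
  have sq: "\<bar>u\<bar> powr \<alpha> = (\<bar>u\<bar> powr (\<alpha>/2))\<^sup>2" for u :: real
    by (simp add: power2_eq_square powr_add[symmetric])
  have "0 \<le> (\<bar>x\<bar> powr (\<alpha>/2) - \<bar>y\<bar> powr (\<alpha>/2))\<^sup>2" by simp
  then have "2 * (\<bar>x\<bar> powr (\<alpha>/2) * \<bar>y\<bar> powr (\<alpha>/2)) \<le> \<bar>x\<bar> powr \<alpha> + \<bar>y\<bar> powr \<alpha>"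
    unfolding sq by (simp add: power2_diff algebra_simps)
  then show ?thesis using abs_powr_add_defect[OF alpha, of x y] by (simp add: abs_le_iff)
qed

text \<open>
  The equation for \<open>W\<close> is only required almost surely because simple integrals are only almost surely
  linear in the integrand.
\<close>

lemma conv_in_prob_linear:
  assumes Y: "conv_in_prob P UNIV Yn Y" and Z: "conv_in_prob P UNIV Zn Z"
    and Wm: "\<And>n. W n \<in> borel_measurable P"
    and W: "\<And>n. AE \<omega> in P. W n \<omega> = u * Yn n \<omega> + v * Zn n \<omega>"
  shows "conv_in_prob P UNIV W (\<lambda>\<omega>. u * Y \<omega> + v * Z \<omega>)"
proof -
  have [measurable]: "\<And>n. Yn n \<in> borel_measurable P" "\<And>n. Zn n \<in> borel_measurable P"
    "Y \<in> borel_measurable P" "Z \<in> borel_measurable P"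
    using Y Z by (auto simp: conv_in_prob_def)
  note [measurable] = Wm
  have lim: "(\<lambda>n. measure P {\<omega> \<in> space P. \<bar>W n \<omega> - (u * Y \<omega> + v * Z \<omega>)\<bar> > \<epsilon>}) \<longlonglongrightarrow> 0" if "\<epsilon> > 0" for \<epsilon>
  proof -
    define \<delta> where "\<delta> = \<epsilon> / (2 * (\<bar>u\<bar> + \<bar>v\<bar> + 1))"
    have \<delta>: "\<delta> > 0" using that by (simp add: \<delta>_def add_pos_nonneg)
    have \<delta>2: "\<bar>u\<bar> * \<delta> + \<bar>v\<bar> * \<delta> \<le> \<epsilon>"
    proof -
      have "0 < 2 * (\<bar>u\<bar> + \<bar>v\<bar> + 1)" by (simp add: add_nonneg_pos)
      then have "(\<bar>u\<bar> + \<bar>v\<bar>) / (2 * (\<bar>u\<bar> + \<bar>v\<bar> + 1)) \<le> 1" by (simp only: pos_divide_le_eq) simp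
      then have "\<epsilon> * ((\<bar>u\<bar> + \<bar>v\<bar>) / (2 * (\<bar>u\<bar> + \<bar>v\<bar> + 1))) \<le> \<epsilon> * 1"
        using that by (intro mult_left_mono) auto
      then show ?thesis by (simp add: \<delta>_def add_divide_distrib distrib_left mult.commute)
    qed
    have le: "measure P {\<omega> \<in> space P. \<bar>W n \<omega> - (u * Y \<omega> + v * Z \<omega>)\<bar> > \<epsilon>}
       \<le> measure P {\<omega> \<in> space P. \<bar>Yn n \<omega> - Y \<omega>\<bar> > \<delta>} + measure P {\<omega> \<in> space P. \<bar>Zn n \<omega> - Z \<omega>\<bar> > \<delta>}" for n
    proof -
      have "measure P {\<omega> \<in> space P. \<bar>W n \<omega> - (u * Y \<omega> + v * Z \<omega>)\<bar> > \<epsilon>}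
        \<le> measure P ({\<omega> \<in> space P. \<bar>Yn n \<omega> - Y \<omega>\<bar> > \<delta>} \<union> {\<omega> \<in> space P. \<bar>Zn n \<omega> - Z \<omega>\<bar> > \<delta>})"
      proof (rule finite_measure_mono_AE)
        show "AE \<omega> in P. \<omega> \<in> {\<omega> \<in> space P. \<bar>W n \<omega> - (u * Y \<omega> + v * Z \<omega>)\<bar> > \<epsilon>} \<longrightarrow>
          \<omega> \<in> {\<omega> \<in> space P. \<bar>Yn n \<omega> - Y \<omega>\<bar> > \<delta>} \<union> {\<omega> \<in> space P. \<bar>Zn n \<omega> - Z \<omega>\<bar> > \<delta>}"
          using W[of n]
        proof eventually_elim
          case (elim \<omega>)
          have "\<bar>W n \<omega> - (u * Y \<omega> + v * Z \<omega>)\<bar> \<le> \<epsilon>" if "\<bar>Yn n \<omega> - Y \<omega>\<bar> \<le> \<delta>" "\<bar>Zn n \<omega> - Z \<omega>\<bar> \<le> \<delta>"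
          proof -
            have "W n \<omega> - (u * Y \<omega> + v * Z \<omega>) = u * (Yn n \<omega> - Y \<omega>) + v * (Zn n \<omega> - Z \<omega>)"
              by (simp add: elim algebra_simps)
            then have "\<bar>W n \<omega> - (u * Y \<omega> + v * Z \<omega>)\<bar> \<le> \<bar>u\<bar> * \<bar>Yn n \<omega> - Y \<omega>\<bar> + \<bar>v\<bar> * \<bar>Zn n \<omega> - Z \<omega>\<bar>"
              using abs_triangle_ineq by (metis abs_mult)
            also have "\<dots> \<le> \<bar>u\<bar> * \<delta> + \<bar>v\<bar> * \<delta>"
              using that by (intro add_mono mult_left_mono) auto
            finally show ?thesis using \<delta>2 by simp
          qed
          then show ?case by fastforce
        qed
      qed measurable
      also have "\<dots> \<le> measure P {\<omega> \<in> space P. \<bar>Yn n \<omega> - Y \<omega>\<bar> > \<delta>} + measure P {\<omega> \<in> space P. \<bar>Zn n \<omega> - Z \<omega>\<bar> > \<delta>}"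
        by (rule measure_Un_le) measurable
      finally show ?thesis .
    qed
    have "(\<lambda>n. measure P {\<omega> \<in> space P. \<bar>Yn n \<omega> - Y \<omega>\<bar> > \<delta>} + measure P {\<omega> \<in> space P. \<bar>Zn n \<omega> - Z \<omega>\<bar> > \<delta>}) \<longlonglongrightarrow> 0 + 0"
      using Y Z \<delta> by (intro tendsto_add) (auto simp: conv_in_prob_def)
    then have "(\<lambda>n. measure P {\<omega> \<in> space P. \<bar>Yn n \<omega> - Y \<omega>\<bar> > \<delta>} + measure P {\<omega> \<in> space P. \<bar>Zn n \<omega> - Z \<omega>\<bar> > \<delta>}) \<longlonglongrightarrow> 0"
      by simp
    then show ?thesis
      by (rule Lim_null_comparison[rotated]) (use le in auto)
  qed
  then show ?thesis by (simp add: conv_in_prob_def)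
qed

lemma stable_integral_linear:
  assumes f: "is_stable_integral P \<alpha> M f Y" and g: "is_stable_integral P \<alpha> M g Z"
  shows "is_stable_integral P \<alpha> M (\<lambda>x. u * f x + v * g x) (\<lambda>\<omega>. u * Y \<omega> + v * Z \<omega>)"
proof -
  obtain s t where s: "\<And>n. fin_simple (s n)"
      "(\<lambda>n. \<integral>\<^sup>+ x. ennreal (\<bar>f x - s n x\<bar> powr \<alpha>) \<partial>lborel) \<longlonglongrightarrow> 0"
      "conv_in_prob P UNIV (\<lambda>n. stable_simple_integral M (s n)) Y"
    and t: "\<And>n. fin_simple (t n)"
      "(\<lambda>n. \<integral>\<^sup>+ x. ennreal (\<bar>g x - t n x\<bar> powr \<alpha>) \<partial>lborel) \<longlonglongrightarrow> 0"
      "conv_in_prob P UNIV (\<lambda>n. stable_simple_integral M (t n)) Z"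
    using f g unfolding is_stable_integral_iff by blast
  have [measurable]: "f \<in> borel_measurable borel" "g \<in> borel_measurable borel"
    using f g stable_integral_measurable by auto
  have [measurable]: "s n \<in> borel_measurable borel" "t n \<in> borel_measurable borel" for n
    using s t fin_simple_measurable by auto
  define r where "r = (\<lambda>n x. u * s n x + v * t n x)"
  let ?F = "\<lambda>n. \<integral>\<^sup>+ x. ennreal (\<bar>f x - s n x\<bar> powr \<alpha>) \<partial>lborel"
  let ?G = "\<lambda>n. \<integral>\<^sup>+ x. ennreal (\<bar>g x - t n x\<bar> powr \<alpha>) \<partial>lborel"
  have le: "(\<integral>\<^sup>+ x. ennreal (\<bar>(u * f x + v * g x) - r n x\<bar> powr \<alpha>) \<partial>lborel)
      \<le> ennreal (2 * \<bar>u\<bar> powr \<alpha>) * ?F n + ennreal (2 * \<bar>v\<bar> powr \<alpha>) * ?G n" for n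
  proof -
    have "(\<integral>\<^sup>+ x. ennreal (\<bar>(u * f x + v * g x) - r n x\<bar> powr \<alpha>) \<partial>lborel)
      \<le> (\<integral>\<^sup>+ x. ennreal (2 * \<bar>u\<bar> powr \<alpha>) * ennreal (\<bar>f x - s n x\<bar> powr \<alpha>)
             + ennreal (2 * \<bar>v\<bar> powr \<alpha>) * ennreal (\<bar>g x - t n x\<bar> powr \<alpha>) \<partial>lborel)"
    proof (rule nn_integral_mono)
      fix x
      have "(u * f x + v * g x) - r n x = u * (f x - s n x) + v * (g x - t n x)"
        by (simp add: r_def algebra_simps)
      then have "\<bar>(u * f x + v * g x) - r n x\<bar> powr \<alpha>
         \<le> 2 * \<bar>u\<bar> powr \<alpha> * \<bar>f x - s n x\<bar> powr \<alpha> + 2 * \<bar>v\<bar> powr \<alpha> * \<bar>g x - t n x\<bar> powr \<alpha>"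
        using abs_powr_add_le[of "u * (f x - s n x)" "v * (g x - t n x)"]
        by (simp add: abs_mult powr_mult)
      then show "ennreal (\<bar>(u * f x + v * g x) - r n x\<bar> powr \<alpha>)
        \<le> ennreal (2 * \<bar>u\<bar> powr \<alpha>) * ennreal (\<bar>f x - s n x\<bar> powr \<alpha>)
             + ennreal (2 * \<bar>v\<bar> powr \<alpha>) * ennreal (\<bar>g x - t n x\<bar> powr \<alpha>)"
        by (simp add: ennreal_mult[symmetric] ennreal_plus[symmetric] del: ennreal_plus)
    qed
    also have "\<dots> = ennreal (2 * \<bar>u\<bar> powr \<alpha>) * ?F n + ennreal (2 * \<bar>v\<bar> powr \<alpha>) * ?G n"
      by (subst nn_integral_add) (auto simp: nn_integral_cmult)
    finally show ?thesis .
  qed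
  have "(\<lambda>n. ennreal (2 * \<bar>u\<bar> powr \<alpha>) * ?F n + ennreal (2 * \<bar>v\<bar> powr \<alpha>) * ?G n)
      \<longlonglongrightarrow> ennreal (2 * \<bar>u\<bar> powr \<alpha>) * 0 + ennreal (2 * \<bar>v\<bar> powr \<alpha>) * 0"
    by (intro tendsto_add ennreal_tendsto_cmult s t) auto
  then have lim: "(\<lambda>n. ennreal (2 * \<bar>u\<bar> powr \<alpha>) * ?F n + ennreal (2 * \<bar>v\<bar> powr \<alpha>) * ?G n) \<longlonglongrightarrow> 0"
    by simp
  have "(\<lambda>n. \<integral>\<^sup>+ x. ennreal (\<bar>(u * f x + v * g x) - r n x\<bar> powr \<alpha>) \<partial>lborel) \<longlonglongrightarrow> 0"
    by (rule tendsto_sandwich[OF _ _ tendsto_const lim]) (auto intro!: always_eventually le)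
  moreover have "conv_in_prob P UNIV (\<lambda>n. stable_simple_integral M (r n)) (\<lambda>\<omega>. u * Y \<omega> + v * Z \<omega>)"
    unfolding r_def
    by (rule conv_in_prob_linear[OF s(3) t(3)])
      (simp_all only: simple_integral_measurable simple_integral_linear s t)
  moreover have "\<forall>n. fin_simple (r n)"
    unfolding r_def using simple_integral_linear(1)[OF s(1) t(1)] by simp
  ultimately show ?thesis unfolding is_stable_integral_iff by (intro conjI exI[of _ r]) auto
qed

text \<open>
  This turns increments of the process into single integrals, so that their joint laws follow from the
  law of one integral.
\<close>

lemma stable_integral_sum:
  assumes "finite I" "\<And>k. k \<in> I \<Longrightarrow> is_stable_integral P \<alpha> M (f k) (Y k)"
  shows "is_stable_integral P \<alpha> M (\<lambda>x. \<Sum>k\<in>I. a k * f k x) (\<lambda>\<omega>. \<Sum>k\<in>I. a k * Y k \<omega>)"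
  using assms
proof (induction rule: finite_induct)
  case empty
  then show ?case using stable_integral_zero by simp
next
  case (insert k I)
  then show ?case
    using stable_integral_linear[of "f k" "Y k" "\<lambda>x. \<Sum>k\<in>I. a k * f k x" "\<lambda>\<omega>. \<Sum>k\<in>I. a k * Y k \<omega>" "a k" 1]
    by simp
qed

text \<open>
  Since \<open>y \<mapsto> exp (i \<theta> y)\<close> is bounded and Lipschitz, the expectations differ by at most \<open>\<bar>\<theta>\<bar> \<epsilon>\<close> plus twice
  the probability that the variables differ by more than \<open>\<epsilon>\<close>.
\<close>

lemma char_conv_in_prob:
  assumes "conv_in_prob P UNIV Yn Y"
  shows "(\<lambda>n. char (distr P borel (Yn n)) \<theta>) \<longlonglongrightarrow> char (distr P borel Y) \<theta>"
proof (rule LIMSEQ_I)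
  fix r :: real assume "r > 0"
  have [measurable]: "\<And>n. Yn n \<in> borel_measurable P" "Y \<in> borel_measurable P"
    using assms by (auto simp: conv_in_prob_def)
  define \<epsilon> where "\<epsilon> = r / (2 * (\<bar>\<theta>\<bar> + 1))"
  have \<epsilon>: "\<epsilon> > 0" using \<open>r > 0\<close> by (simp add: \<epsilon>_def add_nonneg_pos)
  have "\<bar>\<theta>\<bar> * \<epsilon> \<le> (\<bar>\<theta>\<bar> + 1) * \<epsilon>" using \<epsilon> by simp
  also have "\<dots> = r / 2"
    using \<epsilon> by (simp add: \<epsilon>_def field_simps)
  finally have \<epsilon>2: "\<bar>\<theta>\<bar> * \<epsilon> \<le> r / 2" .
  define B where "B = (\<lambda>n. {\<omega> \<in> space P. \<bar>Yn n \<omega> - Y \<omega>\<bar> > \<epsilon>})"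
  have [measurable]: "B n \<in> sets P" for n unfolding B_def by measurable
  have "(\<lambda>n. measure P (B n)) \<longlonglongrightarrow> 0"
    using assms \<epsilon> by (simp add: conv_in_prob_def B_def)
  then have "eventually (\<lambda>n. measure P (B n) < r / 4) sequentially"
    using \<open>r > 0\<close> by (intro order_tendstoD(2)) auto
  then obtain N where N: "\<And>n. n \<ge> N \<Longrightarrow> measure P (B n) < r / 4"
    by (auto simp: eventually_sequentially)
  have ii: "cmod (iexp a - iexp b) \<le> \<bar>a - b\<bar>" for a b :: real
  proof -
    have "iexp a - iexp b = iexp b * (iexp (a - b) - 1)"
      by (simp add: algebra_simps exp_diff)
    then have "cmod (iexp a - iexp b) = cmod (iexp (a - b) - 1)"
      by (simp add: norm_mult)
    also have "\<dots> \<le> \<bar>a - b\<bar>"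
      using iexp_approx1[of "a - b" 0] by simp
    finally show ?thesis .
  qed
  have int: "integrable P (\<lambda>\<omega>. iexp (\<theta> * Z \<omega>))" if "Z \<in> borel_measurable P" for Z
    using that by (intro integrable_const_bound[of _ 1]) auto
  have "norm (char (distr P borel (Yn n)) \<theta> - char (distr P borel Y) \<theta>) < r" if "n \<ge> N" for n
  proof -
    have "char (distr P borel (Yn n)) \<theta> - char (distr P borel Y) \<theta>
      = (CLINT \<omega>|P. iexp (\<theta> * Yn n \<omega>) - iexp (\<theta> * Y \<omega>))"
      unfolding char_def using int by (simp add: integral_distr)
    also have "norm \<dots> \<le> (LINT \<omega>|P. cmod (iexp (\<theta> * Yn n \<omega>) - iexp (\<theta> * Y \<omega>)))"
      by (rule integral_norm_bound)
    also have "\<dots> \<le> (LINT \<omega>|P. r / 2 + 2 * indicator (B n) \<omega>)"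
    proof (rule integral_mono)
      show "integrable P (\<lambda>\<omega>. r / 2 + 2 * indicator (B n) \<omega>)"
        by (intro Bochner_Integration.integrable_add integrable_mult_right integrable_real_indicator)
          (auto simp: emeasure_eq_measure)
      fix \<omega> assume "\<omega> \<in> space P"
      show "cmod (iexp (\<theta> * Yn n \<omega>) - iexp (\<theta> * Y \<omega>)) \<le> r / 2 + 2 * indicator (B n) \<omega>"
      proof (cases "\<omega> \<in> B n")
        case True
        have "cmod (iexp (\<theta> * Yn n \<omega>) - iexp (\<theta> * Y \<omega>)) \<le> 1 + 1"
          by (rule order_trans[OF norm_triangle_ineq4]) (simp del: of_real_mult)
        then show ?thesis using True \<open>r > 0\<close> by simp
      next
        case False
        then have "\<bar>Yn n \<omega> - Y \<omega>\<bar> \<le> \<epsilon>" using \<open>\<omega> \<in> space P\<close> by (simp add: B_def)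
        then have "\<bar>\<theta>\<bar> * \<bar>Yn n \<omega> - Y \<omega>\<bar> \<le> \<bar>\<theta>\<bar> * \<epsilon>" by (intro mult_left_mono) auto
        then have "\<bar>\<theta> * Yn n \<omega> - \<theta> * Y \<omega>\<bar> \<le> r / 2"
          using \<epsilon>2 by (simp add: right_diff_distrib[symmetric] abs_mult)
        then show ?thesis using ii[of "\<theta> * Yn n \<omega>" "\<theta> * Y \<omega>"] False by simp
      qed
    qed (use int in auto)
    also have "\<dots> = r / 2 + 2 * measure P (B n)"
      by (subst Bochner_Integration.integral_add) (auto simp: emeasure_eq_measure prob_space)
    also have "\<dots> < r" using N[OF that] by simp
    finally show ?thesis .
  qed
  then show "\<exists>no. \<forall>n\<ge>no. norm (char (distr P borel (Yn n)) \<theta> - char (distr P borel Y) \<theta>) < r"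
    by blast
qed

text \<open>
  The formula passes from simple functions to the limit. Convergence of \<open>\<integral>\<bar>s\<^sub>n\<bar>\<^sup>\<alpha>\<close> for \<open>\<alpha> < 1\<close>, where \<open>L\<^sup>\<alpha>\<close> is
  not normed, and for \<open>\<alpha> \<ge> 1\<close> both follow from the estimate for \<open>\<integral>\<bar>f + h\<bar>\<^sup>\<alpha>\<close> applied to \<open>f\<close> and \<open>s\<^sub>n - f\<close>.
\<close>

theorem stable_integral_char:
  assumes f: "is_stable_integral P \<alpha> M f Y"
  shows "integrable lborel (\<lambda>x. \<bar>f x\<bar> powr \<alpha>)"
    and "char (distr P borel Y) \<theta> = exp (- (\<bar>\<theta>\<bar> powr \<alpha> * (\<integral>x. \<bar>f x\<bar> powr \<alpha> \<partial>lborel)))"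
proof -
  obtain s where s: "\<And>n. fin_simple (s n)"
      "(\<lambda>n. \<integral>\<^sup>+ x. ennreal (\<bar>f x - s n x\<bar> powr \<alpha>) \<partial>lborel) \<longlonglongrightarrow> 0"
      "conv_in_prob P UNIV (\<lambda>n. stable_simple_integral M (s n)) Y"
    using f unfolding is_stable_integral_iff by blast
  have [measurable]: "f \<in> borel_measurable borel"
    using f stable_integral_measurable by auto
  have [measurable]: "s n \<in> borel_measurable borel" for n
    using s fin_simple_measurable by auto
  have "eventually (\<lambda>n. (\<integral>\<^sup>+ x. ennreal (\<bar>f x - s n x\<bar> powr \<alpha>) \<partial>lborel) < 1) sequentially"
    using s(2) by (intro order_tendstoD(2)) auto
  then have ev: "eventually (\<lambda>n. integrable lborel (\<lambda>x. \<bar>f x - s n x\<bar> powr \<alpha>)) sequentially"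
    by eventually_elim (auto simp: integrable_iff_bounded intro: less_trans)
  then obtain n0 where n0: "integrable lborel (\<lambda>x. \<bar>f x - s n0 x\<bar> powr \<alpha>)"
    by (auto simp: eventually_sequentially)
  have "integrable lborel (\<lambda>x. \<bar>(f x - s n0 x) + s n0 x\<bar> powr \<alpha>)"
    by (rule integral_powr_add_defect(1)[OF alpha]) (use n0 fin_simple_powr_integrable(1)[OF s(1)] in auto)
  then show fint: "integrable lborel (\<lambda>x. \<bar>f x\<bar> powr \<alpha>)" by simp
  define I where "I = (\<integral>x. \<bar>f x\<bar> powr \<alpha> \<partial>lborel)"
  define d where "d = (\<lambda>n. \<integral>x. \<bar>f x - s n x\<bar> powr \<alpha> \<partial>lborel)"
  have d0: "d \<longlonglongrightarrow> 0"
  proof -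
    have "(\<lambda>n. enn2real (\<integral>\<^sup>+ x. ennreal (\<bar>f x - s n x\<bar> powr \<alpha>) \<partial>lborel)) \<longlonglongrightarrow> enn2real 0"
      using s(2) by (intro tendsto_enn2real) auto
    then show ?thesis
      by (simp add: d_def integral_eq_nn_integral)
  qed
  have "eventually (\<lambda>n. norm ((\<integral>x. \<bar>s n x\<bar> powr \<alpha> \<partial>lborel) - I) \<le> d n + 2 * (sqrt I * sqrt (d n))) sequentially"
    using ev
  proof eventually_elim
    case (elim n)
    then have el: "integrable lborel (\<lambda>x. \<bar>s n x - f x\<bar> powr \<alpha>)"
      and dn: "d n = (\<integral>x. \<bar>s n x - f x\<bar> powr \<alpha> \<partial>lborel)"
      by (simp_all add: abs_minus_commute d_def)
    have "\<bar>(\<integral>x. \<bar>f x + (s n x - f x)\<bar> powr \<alpha> \<partial>lborel) - I - d n\<bar>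
      \<le> 2 * (\<integral>x. \<bar>f x\<bar> powr (\<alpha>/2) * \<bar>s n x - f x\<bar> powr (\<alpha>/2) \<partial>lborel)"
      unfolding I_def dn
      by (rule integral_powr_add_defect(2)[OF alpha]) (use el fint in auto)
    moreover have "(\<integral>x. \<bar>f x\<bar> powr (\<alpha>/2) * \<bar>s n x - f x\<bar> powr (\<alpha>/2) \<partial>lborel) \<le> sqrt I * sqrt (d n)"
      unfolding I_def dn
      by (rule powr_half_product_integral(2)) (use el fint in auto)
    moreover have "0 \<le> d n" by (simp add: d_def)
    ultimately show ?case by (simp add: abs_le_iff)
  qed
  moreover have "(\<lambda>n. d n + 2 * (sqrt I * sqrt (d n))) \<longlonglongrightarrow> 0"
  proof -
    have "(\<lambda>n. d n + 2 * (sqrt I * sqrt (d n))) \<longlonglongrightarrow> 0 + 2 * (sqrt I * sqrt 0)"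
      by (intro tendsto_intros d0)
    then show ?thesis by simp
  qed
  ultimately have "(\<lambda>n. (\<integral>x. \<bar>s n x\<bar> powr \<alpha> \<partial>lborel) - I) \<longlonglongrightarrow> 0"
    by (rule Lim_null_comparison)
  then have sI: "(\<lambda>n. \<integral>x. \<bar>s n x\<bar> powr \<alpha> \<partial>lborel) \<longlonglongrightarrow> I"
    by (simp add: LIM_zero_iff)
  have "(\<lambda>n. char (distr P borel (stable_simple_integral M (s n))) \<theta>) \<longlonglongrightarrow> char (distr P borel Y) \<theta>"
    by (rule char_conv_in_prob[OF s(3)])
  moreover have "(\<lambda>n. char (distr P borel (stable_simple_integral M (s n))) \<theta>)
      \<longlonglongrightarrow> complex_of_real (exp (- (\<bar>\<theta>\<bar> powr \<alpha> * I)))"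
    unfolding fin_simple_powr_integrable(2)[OF s(1)] by (intro tendsto_intros sI)
  ultimately show "char (distr P borel Y) \<theta> = exp (- (\<bar>\<theta>\<bar> powr \<alpha> * (\<integral>x. \<bar>f x\<bar> powr \<alpha> \<partial>lborel)))"
    unfolding I_def by (rule LIMSEQ_unique)
qed

end

section \<open>Negative moments of stable variables\<close>

text \<open>
  Substituting \<open>t = c s\<^sup>a\<close> turns the Gamma integral at \<open>p / a\<close> into this one. It is used with \<open>a = 2\<close> for the Gaussian
  function and with \<open>a = \<alpha>\<close> for stable characteristic functions.
\<close>

lemma nn_integral_powr_exp:
  fixes a c p :: real
  assumes "a > 0" "c > 0" "p > 0"
  shows "(\<integral>\<^sup>+ s. ennreal (indicator {0<..} s * (s powr (p - 1) * exp (- (c * s powr a)))) \<partial>lborel)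
           = ennreal (Gamma (p / a) / (a * c powr (p / a)))"
proof -
  define q where "q = p / a"
  have q: "q > 0" using assms by (simp add: q_def)
  define f where "f = (\<lambda>t::real. t powr (q - 1) / exp t)"
  have "((\<lambda>t. if t \<in> {0<..} then f t else 0) has_integral Gamma q) {0..}"
    by (rule has_integral_spike[OF _ _ Gamma_integral_real[OF q], of "{0}"]) (auto simp: f_def)
  then have f_int: "(f has_integral Gamma q) {0<..}"
    by (subst (asm) has_integral_restrict) auto
  have f_abs: "f absolutely_integrable_on {0<..}"
    by (rule nonnegative_absolutely_integrable_1) (use f_int in \<open>auto simp: f_def\<close>)
  define g where "g = (\<lambda>s::real. c * s powr a)"
  define g' where "g' = (\<lambda>s::real. c * (a * s powr (a - 1)))"
  have img: "g ` {0<..} = {0<..}"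
  proof (intro equalityI subsetI)
    fix t :: real assume t: "t \<in> {0<..}"
    then have "t = g ((t / c) powr (1 / a))" using assms by (simp add: g_def powr_powr)
    then show "t \<in> g ` {0<..}"
      by (rule image_eqI) (use t assms in simp)
  qed (use assms in \<open>auto simp: g_def\<close>)
  have "(\<lambda>x. \<bar>g' x\<bar> * f (g x)) absolutely_integrable_on {0<..} \<and>
           integral {0<..} (\<lambda>x. \<bar>g' x\<bar> * f (g x)) = Gamma q
     \<longleftrightarrow> f absolutely_integrable_on (g ` {0<..}) \<and> integral (g ` {0<..}) f = Gamma q"
  proof (rule has_absolute_integral_change_of_variables_1')
    fix x :: real assume "x \<in> {0<..}"
    then show "(g has_field_derivative g' x) (at x within {0<..})"
      unfolding g_def g'_def
      by (intro DERIV_cmult[OF has_field_derivative_at_within[OF has_real_derivative_powr]]) simp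
  next
    show "inj_on g {0<..}"
    proof (rule inj_onI)
      fix x y :: real assume xy: "x \<in> {0<..}" "y \<in> {0<..}" "g x = g y"
      then have "(x powr a) powr (1 / a) = (y powr a) powr (1 / a)" using assms by (simp add: g_def)
      then show "x = y" using xy assms by (simp add: powr_powr)
    qed
  qed auto
  then have *: "(\<lambda>x. \<bar>g' x\<bar> * f (g x)) absolutely_integrable_on {0<..}"
      "integral {0<..} (\<lambda>x. \<bar>g' x\<bar> * f (g x)) = Gamma q"
    using f_abs f_int by (auto simp: img)
  then have "((\<lambda>x. \<bar>g' x\<bar> * f (g x)) has_integral Gamma q) {0<..}"
    unfolding absolutely_integrable_on_def using integrable_integral by metis
  moreover have "\<bar>g' s\<bar> * f (g s) = (a * c powr q) * (s powr (p - 1) * exp (- (c * s powr a)))"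
    if "s \<in> {0<..}" for s
  proof -
    have "\<bar>g' s\<bar> * f (g s) = c * c powr (q - 1) * a * (s powr (a - 1) * s powr (a * (q - 1))) * exp (- (c * s powr a))"
      using that assms by (simp add: g'_def f_def g_def powr_mult powr_powr exp_minus divide_inverse mult_ac)
    also have "c * c powr (q - 1) = c powr q"
      using assms by (simp add: powr_mult_base)
    also have "s powr (a - 1) * s powr (a * (q - 1)) = s powr (p - 1)"
      using assms by (simp add: powr_add[symmetric] q_def algebra_simps)
    finally show ?thesis by (simp add: mult_ac)
  qed
  ultimately have "((\<lambda>s. (a * c powr q) * (s powr (p - 1) * exp (- (c * s powr a)))) has_integral Gamma q) {0<..}"
    by (rule has_integral_eq[rotated])
  then have "((\<lambda>s. inverse (a * c powr q) * ((a * c powr q) * (s powr (p - 1) * exp (- (c * s powr a)))))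
      has_integral inverse (a * c powr q) * Gamma q) {0<..}"
    by (rule has_integral_mult_right)
  moreover have "inverse (a * c powr q) * ((a * c powr q) * u) = u" for u
  proof -
    have "inverse k * (k * u) = u" if "k \<noteq> 0" for k :: real using that by simp
    from this[of "a * c powr q"] show ?thesis using assms by simp
  qed
  ultimately have "((\<lambda>s. s powr (p - 1) * exp (- (c * s powr a))) has_integral inverse (a * c powr q) * Gamma q) {0<..}"
    by (simp only:)
  from nn_integral_has_integral_lebesgue[OF _ this]
  show ?thesis by (simp add: q_def divide_inverse mult_ac)
qed

definition powr_weight :: "real \<Rightarrow> real \<Rightarrow> real" where
  "powr_weight p s = indicator {0<..} s * s powr (p - 1)"

lemma powr_weight_nonneg [simp]: "0 \<le> powr_weight p s"
  by (simp add: powr_weight_def)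

lemma powr_weight_measurable [measurable]: "powr_weight p \<in> borel_measurable borel"
  unfolding powr_weight_def[abs_def] by measurable

definition gauss_const :: "real \<Rightarrow> real" where
  "gauss_const p = Gamma (p / 2) * 2 powr (p / 2 - 1)"

lemma gauss_const_pos: "p > 0 \<Longrightarrow> gauss_const p > 0"
  by (simp add: gauss_const_def)

text \<open>
  The mixture of Gaussian functions that represents \<open>\<bar>y\<bar>\<^sup>-\<^sup>p\<close>. Unlike that power, whose value at \<open>0\<close> is \<open>0\<close> by
  convention, it is infinite at \<open>y = 0\<close>; finiteness of its expectation hence excludes an atom at \<open>0\<close>.
\<close>

definition gauss_mix :: "real \<Rightarrow> real \<Rightarrow> ennreal" where
  "gauss_mix p y = (\<integral>\<^sup>+ s. ennreal (powr_weight p s * exp (- ((s * y)\<^sup>2 / 2))) \<partial>lborel)"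

lemma gauss_mix_eq:
  assumes "p > 0" "y \<noteq> 0"
  shows "gauss_mix p y = ennreal (gauss_const p * \<bar>y\<bar> powr (- p))"
proof -
  have "gauss_mix p y = (\<integral>\<^sup>+ s. ennreal (indicator {0<..} s * (s powr (p - 1) * exp (- ((y\<^sup>2 / 2) * s powr 2)))) \<partial>lborel)"
    unfolding gauss_mix_def
    by (intro nn_integral_cong) (auto simp: powr_weight_def indicator_def power_mult_distrib mult_ac)
  also have "\<dots> = ennreal (Gamma (p / 2) / (2 * (y\<^sup>2 / 2) powr (p / 2)))"
    using assms by (intro nn_integral_powr_exp) auto
  also have "(y\<^sup>2 / 2) powr (p / 2) = \<bar>y\<bar> powr p / 2 powr (p / 2)"
  proof -
    have "(y\<^sup>2) powr (p / 2) = (\<bar>y\<bar> powr 2) powr (p / 2)" using assms by simp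
    also have "\<dots> = \<bar>y\<bar> powr p" by (simp only: powr_powr) simp
    finally show ?thesis by (simp add: powr_divide)
  qed
  also have "Gamma (p / 2) / (2 * (\<bar>y\<bar> powr p / 2 powr (p / 2))) = gauss_const p * \<bar>y\<bar> powr (- p)"
  proof -
    have e: "(2::real) powr (p / 2 - 1) = 2 powr (p / 2) / 2" unfolding powr_diff by simp
    have "G / (2 * (Y / T)) = G * (T / 2) * inverse Y" for G T Y :: real
      by (cases "T = 0"; cases "Y = 0") (simp_all add: field_simps)
    then show ?thesis unfolding gauss_const_def e powr_minus .
  qed
  finally show ?thesis .
qed

text \<open>
  The mixture is largest at \<open>0\<close>, and its values at \<open>y \<noteq> 0\<close> are unbounded.
\<close>

lemma gauss_mix_0:
  assumes "p > 0"
  shows "gauss_mix p 0 = \<infinity>"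
proof (rule ccontr)
  assume "gauss_mix p 0 \<noteq> \<infinity>"
  then obtain r where r: "r \<ge> 0" "gauss_mix p 0 = ennreal r" by (cases "gauss_mix p 0") auto
  define A where "A = gauss_const p"
  have A: "A > 0" using assms by (simp add: A_def gauss_const_pos)
  \<comment> \<open>The mixture takes the value \<open>r + 1\<close> at this point.\<close>
  define y where "y = ((r + 1) / A) powr (- 1 / p)"
  have y: "y > 0" using r A by (simp add: y_def)
  have "y powr (- p) = (r + 1) / A"
    using r A assms by (simp add: y_def powr_powr)
  then have "ennreal (r + 1) = gauss_mix p y"
    using gauss_mix_eq[OF assms, of y] y A by (simp add: A_def[symmetric])
  also have "\<dots> \<le> gauss_mix p 0"
    unfolding gauss_mix_def
    by (intro nn_integral_mono ennreal_leI mult_left_mono) auto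
  finally show False using r by (simp add: ennreal_le_iff)
qed

text \<open>
  By symmetry this is twice an integral over the positive half line, namely the one above with \<open>a = 2\<close>
  and \<open>c = 1 / 2\<close>.
\<close>

lemma nn_integral_normal_abs_powr:
  assumes "p > - 1"
  shows "(\<integral>\<^sup>+ z. ennreal (\<bar>z\<bar> powr p) \<partial>std_normal_distribution)
           = ennreal (2 powr (p / 2) * Gamma ((p + 1) / 2) / sqrt pi)"
proof -
  let ?F = "\<lambda>z::real. ennreal (indicator {0<..} z * (z powr (p + 1 - 1) * exp (- ((1/2) * z powr 2))))"
  let ?c = "ennreal (1 / sqrt (2 * pi))"
  have I: "integral\<^sup>N lborel ?F = ennreal (Gamma ((p + 1) / 2) / (2 * (1/2) powr ((p + 1) / 2)))"
    using assms by (intro nn_integral_powr_exp) auto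
  have neg: "(\<integral>\<^sup>+ z. ?F (- z) \<partial>lborel) = integral\<^sup>N lborel ?F"
    by (subst (2) nn_integral_real_affine[where c="-1" and t=0]) (auto simp: ennreal_mult)
  have "(\<integral>\<^sup>+ z. ennreal (\<bar>z\<bar> powr p) \<partial>std_normal_distribution)
      = (\<integral>\<^sup>+ z. ?c * (?F z + ?F (- z)) \<partial>lborel)"
  proof (subst nn_integral_density)
    show "(\<integral>\<^sup>+ z. ennreal (std_normal_density z) * ennreal (\<bar>z\<bar> powr p) \<partial>lborel)
        = (\<integral>\<^sup>+ z. ?c * (?F z + ?F (- z)) \<partial>lborel)"
    proof (rule nn_integral_cong_AE)
      have "ennreal (std_normal_density z) * ennreal (\<bar>z\<bar> powr p) = ?c * (?F z + ?F (- z))" if "z \<noteq> 0" for z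
        using that by (auto simp: std_normal_density_def indicator_def ennreal_mult[symmetric] mult_ac)
      then show "AE z in lborel. ennreal (std_normal_density z) * ennreal (\<bar>z\<bar> powr p) = ?c * (?F z + ?F (- z))"
        by (intro eventually_mono[OF AE_lborel_singleton[of 0]]) auto
    qed
  qed auto
  also have "\<dots> = ?c * (integral\<^sup>N lborel ?F + integral\<^sup>N lborel ?F)"
  proof -
    have "(\<integral>\<^sup>+ z. ?F z + ?F (- z) \<partial>lborel) = integral\<^sup>N lborel ?F + (\<integral>\<^sup>+ z. ?F (- z) \<partial>lborel)"
      by (rule nn_integral_add) measurable
    then show ?thesis unfolding neg by (subst nn_integral_cmult) simp_all
  qed
  also have "\<dots> = ennreal (1 / sqrt (2 * pi) * (2 * (Gamma ((p + 1) / 2) / (2 * (1/2) powr ((p + 1) / 2)))))"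
    unfolding I using assms
    by (simp add: ennreal_mult[symmetric] ennreal_plus[symmetric] del: ennreal_plus)
  also have "1 / sqrt (2 * pi) * (2 * (Gamma ((p + 1) / 2) / (2 * (1/2) powr ((p + 1) / 2))))
     = 2 powr (p / 2) * Gamma ((p + 1) / 2) / sqrt pi"
  proof -
    have "(2 :: real) powr ((p + 1) / 2) = 2 powr (p / 2) * 2 powr (1 / 2)"
      unfolding powr_add[symmetric] by (simp add: add_divide_distrib)
    then have *: "(1/2 :: real) powr ((p + 1) / 2) = inverse (2 powr (p / 2) * sqrt 2)"
      by (simp add: powr_divide powr_half_sqrt inverse_eq_divide)
    have "1 / (a * b) * (2 * (G / (2 * inverse (T * a)))) = T * G / b" if "a > 0" "b > 0" "T > 0"
      for a b T G :: real
      using that by (simp add: field_simps)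
    then show ?thesis unfolding * real_sqrt_mult by simp
  qed
  finally show ?thesis .
qed

lemma prob_space_std_normal: "prob_space std_normal_distribution"
  using real_dist_normal_dist by (simp add: real_distribution_def)

lemma gauss_cf:
  "complex_of_real (exp (- ((s * y)\<^sup>2 / 2))) = (CLINT z|std_normal_distribution. iexp (s * y * z))"
  using fun_cong[OF char_std_normal_distribution, of "s * y"] by (simp add: char_def)

lemma bounded_Fubini:
  fixes f :: "'a \<Rightarrow> 'b \<Rightarrow> complex"
  assumes "prob_space A" "prob_space B"
    and [measurable]: "case_prod f \<in> borel_measurable (A \<Otimes>\<^sub>M B)" and "\<And>x y. norm (f x y) \<le> 1"
  shows "(\<integral>x. \<integral>y. f x y \<partial>B \<partial>A) = (\<integral>y. \<integral>x. f x y \<partial>A \<partial>B)"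
proof -
  interpret A: prob_space A by fact
  interpret B: prob_space B by fact
  interpret pair_prob_space A B ..
  have "integrable (A \<Otimes>\<^sub>M B) (case_prod f)"
    using assms(4) by (intro P.integrable_const_bound[of _ 1]) auto
  from Fubini_integral[OF this] show ?thesis by simp
qed

abbreviation stdnorm :: "real measure" where "stdnorm \<equiv> std_normal_distribution"

lemma AE_stdnorm_nonzero: "AE z in stdnorm. z \<noteq> 0"
  by (subst AE_density) (auto intro!: eventually_mono[OF AE_lborel_singleton[of 0]])

text \<open>
  The value of the integrals over the mixing variable and the normal variable that remain when the
  characteristic function of a stable variable is inserted. The parameter \<open>b\<close> is \<open>0\<close> for
  moments and \<open>\<alpha> / 2\<close> for the error term in covariances.
\<close>

definition mix_val :: "real \<Rightarrow> real \<Rightarrow> real \<Rightarrow> real \<Rightarrow> real" where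
  "mix_val p b c \<alpha> = Gamma ((p + b) / \<alpha>) / (\<alpha> * c powr ((p + b) / \<alpha>))
                      * (2 powr (- p / 2) * Gamma ((1 - p) / 2) / sqrt pi)"

lemma mix_val_pos: "0 < p \<Longrightarrow> p < 1 \<Longrightarrow> 0 \<le> b \<Longrightarrow> 0 < c \<Longrightarrow> 0 < \<alpha> \<Longrightarrow> 0 < mix_val p b c \<alpha>"
  by (simp add: mix_val_def)

text \<open>
  After exchanging the integrals, the integral over \<open>s\<close> is a Gamma integral equal to a constant times
  \<open>\<bar>z\<bar>\<^sup>-\<^sup>p\<close>, whatever \<open>b\<close> is, and the remaining normal moment is finite because \<open>p < 1\<close>.
\<close>

lemma nn_integral_mix:
  assumes "0 < p" "p < 1" "0 \<le> b" "0 < c" "0 < \<alpha>"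
  shows "(\<integral>\<^sup>+ s. ennreal (powr_weight p s) *
            (\<integral>\<^sup>+ z. ennreal (\<bar>s * z\<bar> powr b * exp (- (c * \<bar>s * z\<bar> powr \<alpha>))) \<partial>stdnorm) \<partial>lborel)
          = ennreal (mix_val p b c \<alpha>)"
proof -
  let ?F = "\<lambda>s z. ennreal (powr_weight p s) * ennreal (\<bar>s * z\<bar> powr b * exp (- (c * \<bar>s * z\<bar> powr \<alpha>)))"
  let ?g = "Gamma ((p + b) / \<alpha>) / (\<alpha> * c powr ((p + b) / \<alpha>))"
  interpret N: prob_space stdnorm by (rule prob_space_std_normal)
  interpret pair_sigma_finite lborel stdnorm ..
  have inner: "(\<integral>\<^sup>+ s. ?F s z \<partial>lborel) = ennreal ?g * ennreal (\<bar>z\<bar> powr (- p))" if z: "z \<noteq> 0" for z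
  proof -
    have "(\<integral>\<^sup>+ s. ?F s z \<partial>lborel) = (\<integral>\<^sup>+ s. ennreal (\<bar>z\<bar> powr b) * ennreal (indicator {0<..} s *
        (s powr ((p + b) - 1) * exp (- ((c * \<bar>z\<bar> powr \<alpha>) * s powr \<alpha>)))) \<partial>lborel)"
    proof (rule nn_integral_cong)
      fix s :: real
      have "s powr (p - 1) * s powr b = s powr (p + b - 1)" by (simp add: powr_add[symmetric] algebra_simps)
      then have "powr_weight p s * (\<bar>s * z\<bar> powr b * exp (- (c * \<bar>s * z\<bar> powr \<alpha>))) =
         \<bar>z\<bar> powr b * (indicator {0<..} s * (s powr ((p + b) - 1) * exp (- ((c * \<bar>z\<bar> powr \<alpha>) * s powr \<alpha>))))"
        by (cases "s > 0") (simp_all add: powr_weight_def abs_mult powr_mult mult_ac)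
      then show "?F s z = ennreal (\<bar>z\<bar> powr b) * ennreal (indicator {0<..} s *
        (s powr ((p + b) - 1) * exp (- ((c * \<bar>z\<bar> powr \<alpha>) * s powr \<alpha>))))"
        by (simp add: ennreal_mult[symmetric])
    qed
    also have "\<dots> = ennreal (\<bar>z\<bar> powr b) * ennreal (Gamma ((p + b) / \<alpha>) / (\<alpha> * (c * \<bar>z\<bar> powr \<alpha>) powr ((p + b) / \<alpha>)))"
      using z assms by (subst nn_integral_cmult) (simp_all add: nn_integral_powr_exp)
    also have "\<dots> = ennreal (\<bar>z\<bar> powr b * (Gamma ((p + b) / \<alpha>) / (\<alpha> * (c * \<bar>z\<bar> powr \<alpha>) powr ((p + b) / \<alpha>))))"
      using assms by (subst ennreal_mult) auto
    also have "(c * \<bar>z\<bar> powr \<alpha>) powr ((p + b) / \<alpha>) = c powr ((p + b) / \<alpha>) * (\<bar>z\<bar> powr p * \<bar>z\<bar> powr b)"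
      using assms by (simp add: powr_mult powr_powr powr_add)
    also have "\<bar>z\<bar> powr b * (Gamma ((p + b) / \<alpha>) / (\<alpha> * (c powr ((p + b) / \<alpha>) * (\<bar>z\<bar> powr p * \<bar>z\<bar> powr b))))
        = ?g * \<bar>z\<bar> powr (- p)"
      using z by (simp add: powr_minus field_simps)
    also have "ennreal \<dots> = ennreal ?g * ennreal (\<bar>z\<bar> powr (- p))"
      using assms by (subst ennreal_mult) auto
    finally show ?thesis .
  qed
  have "(\<integral>\<^sup>+ s. ennreal (powr_weight p s) *
            (\<integral>\<^sup>+ z. ennreal (\<bar>s * z\<bar> powr b * exp (- (c * \<bar>s * z\<bar> powr \<alpha>))) \<partial>stdnorm) \<partial>lborel)
      = (\<integral>\<^sup>+ s. \<integral>\<^sup>+ z. ?F s z \<partial>stdnorm \<partial>lborel)"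
    by (intro nn_integral_cong nn_integral_cmult[symmetric]) measurable
  also have "\<dots> = (\<integral>\<^sup>+ z. \<integral>\<^sup>+ s. ?F s z \<partial>lborel \<partial>stdnorm)"
    by (rule Fubini'[symmetric]) measurable
  also have "\<dots> = (\<integral>\<^sup>+ z. ennreal ?g * ennreal (\<bar>z\<bar> powr (- p)) \<partial>stdnorm)"
    by (intro nn_integral_cong_AE eventually_mono[OF AE_stdnorm_nonzero] inner)
  also have "\<dots> = ennreal ?g * ennreal (2 powr (- p / 2) * Gamma ((- p + 1) / 2) / sqrt pi)"
    using assms by (subst nn_integral_cmult) (auto simp: nn_integral_normal_abs_powr)
  also have "\<dots> = ennreal (mix_val p b c \<alpha>)"
    unfolding mix_val_def using assms by (subst ennreal_mult[symmetric]) (auto simp: add.commute)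
  finally show ?thesis .
qed

text \<open>
  Here \<open>a = \<bar>u\<bar>\<^sup>\<alpha>\<^sup>/\<^sup>2\<close> and \<open>b = \<bar>v\<bar>\<^sup>\<alpha>\<^sup>/\<^sup>2\<close>. By the mean value theorem the difference is at most the difference of
  the exponents times \<open>exp (- l)\<close> for a common lower bound \<open>l\<close> of the exponents; for small \<open>r\<close> half of the sum
  of the marginal exponents is such a bound. The result is again of product form, so it
  can be integrated in both variables separately.
\<close>

lemma exp_defect:
  fixes S r a b n :: real
  assumes "0 \<le> r" "2 * r \<le> S" "0 \<le> a" "0 \<le> b"
    and n: "\<bar>n - S * a\<^sup>2 - S * b\<^sup>2\<bar> \<le> 2 * r * (a * b)"
  shows "\<bar>exp (- n) - exp (- (S * a\<^sup>2)) * exp (- (S * b\<^sup>2))\<bar>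
      \<le> 2 * r * ((a * exp (- (S / 2 * a\<^sup>2))) * (b * exp (- (S / 2 * b\<^sup>2))))"
proof -
  define m where "m = S * a\<^sup>2 + S * b\<^sup>2"
  have le: "\<bar>exp (- x) - exp (- y)\<bar> \<le> \<bar>x - y\<bar> * exp (- l)" if "l \<le> x" "l \<le> y" for x y l :: real
  proof -
    have *: "exp (- x) - exp (- y) \<le> (y - x) * exp (- l)" if "l \<le> x" "x \<le> y" for x y
    proof -
      have "exp (- x) - exp (- y) = (1 - exp (- (y - x))) * exp (- x)"
        by (simp add: left_diff_distrib exp_add[symmetric])
      also have "\<dots> \<le> (y - x) * exp (- l)"
      proof (rule mult_mono)
        show "1 - exp (- (y - x)) \<le> y - x"
          using exp_ge_add_one_self[of "- (y - x)"] by linarith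
      qed (use that in auto)
      finally show ?thesis .
    qed
    show ?thesis
    proof (cases "x \<le> y")
      case True
      then show ?thesis using *[of x y] that by simp
    next
      case False
      then show ?thesis using *[of y x] that by simp
    qed
  qed
  have "0 \<le> (a - b)\<^sup>2" by simp
  then have ab: "2 * (a * b) \<le> a\<^sup>2 + b\<^sup>2" by (simp add: power2_diff)
  have "2 * r * (a * b) \<le> S * (a * b)" using assms by (intro mult_right_mono) auto
  also have "\<dots> \<le> S * ((a\<^sup>2 + b\<^sup>2) / 2)" using assms ab by (intro mult_left_mono) auto
  finally have "2 * r * (a * b) \<le> m / 2" by (simp add: m_def algebra_simps)
  moreover have nm: "\<bar>n - m\<bar> \<le> 2 * r * (a * b)" using n by (simp add: m_def algebra_simps)
  moreover have "0 \<le> m" using assms by (simp add: m_def)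
  ultimately have "m / 2 \<le> n" "m / 2 \<le> m" by auto
  then have "\<bar>exp (- n) - exp (- m)\<bar> \<le> \<bar>n - m\<bar> * exp (- (m / 2))" by (rule le)
  also have "\<dots> \<le> (2 * r * (a * b)) * exp (- (m / 2))" using nm by (intro mult_right_mono) auto
  finally have "\<bar>exp (- n) - exp (- m)\<bar> \<le> (2 * r * (a * b)) * exp (- (m / 2))" .
  moreover have "exp (- m) = exp (- (S * a\<^sup>2)) * exp (- (S * b\<^sup>2))" by (simp add: m_def exp_add[symmetric])
  moreover have "exp (- (m / 2)) = exp (- (S / 2 * a\<^sup>2)) * exp (- (S / 2 * b\<^sup>2))"
    by (simp add: m_def exp_add[symmetric] add_divide_distrib)
  ultimately show ?thesis by (simp add: mult_ac)
qed

context prob_space begin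

text \<open>
  Each Gaussian factor is the expectation of \<open>exp (i s Y z)\<close> over an independent standard normal \<open>z\<close>, so
  integrating \<open>\<omega>\<close> out first leaves the joint characteristic function \<open>J\<close> at random arguments.
\<close>

lemma gauss_pair:
  fixes J :: "real \<Rightarrow> real \<Rightarrow> real"
  assumes [measurable]: "Y1 \<in> borel_measurable M" "Y2 \<in> borel_measurable M"
    and J: "\<And>u v. (CLINT \<omega>|M. iexp (u * Y1 \<omega> + v * Y2 \<omega>)) = complex_of_real (J u v)"
    and J0: "\<And>u v. 0 \<le> J u v"
  shows "case_prod J \<in> borel_measurable (borel \<Otimes>\<^sub>M borel)"
    and "(\<integral>\<^sup>+ \<omega>. ennreal (exp (- ((s * Y1 \<omega>)\<^sup>2 / 2)) * exp (- ((t * Y2 \<omega>)\<^sup>2 / 2))) \<partial>M)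
       = (\<integral>\<^sup>+ z. \<integral>\<^sup>+ z'. ennreal (J (s * z) (t * z')) \<partial>stdnorm \<partial>stdnorm)"
proof -
  interpret N: prob_space stdnorm by (rule prob_space_std_normal)
  have "(\<lambda>(u, v). Re (CLINT \<omega>|M. iexp (u * Y1 \<omega> + v * Y2 \<omega>))) \<in> borel_measurable (borel \<Otimes>\<^sub>M borel)"
    by measurable
  then show Jm[measurable]: "case_prod J \<in> borel_measurable (borel \<Otimes>\<^sub>M borel)"
    by (simp only: J Re_complex_of_real)
  have J1: "J u v \<le> 1" for u v
  proof -
    have "norm (complex_of_real (J u v)) \<le> (LINT \<omega>|M. norm (iexp (u * Y1 \<omega> + v * Y2 \<omega>)))"
      unfolding J[symmetric] by (rule integral_norm_bound)
    then show ?thesis using J0[of u v] by (simp add: prob_space del: of_real_add of_real_mult)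
  qed
  let ?e = "\<lambda>\<omega> z z'. iexp (s * z * Y1 \<omega> + t * z' * Y2 \<omega>)"
  let ?E = "LINT \<omega>|M. exp (- ((s * Y1 \<omega>)\<^sup>2 / 2)) * exp (- ((t * Y2 \<omega>)\<^sup>2 / 2))"
  have "complex_of_real ?E = (CLINT \<omega>|M. complex_of_real (exp (- ((s * Y1 \<omega>)\<^sup>2 / 2))) * complex_of_real (exp (- ((t * Y2 \<omega>)\<^sup>2 / 2))))"
    unfolding of_real_mult[symmetric] by (rule integral_complex_of_real[symmetric])
  also have "\<dots> = (CLINT \<omega>|M. CLINT z|stdnorm. CLINT z'|stdnorm. ?e \<omega> z z')"
  proof (rule Bochner_Integration.integral_cong[OF refl])
    fix \<omega>
    have "complex_of_real (exp (- ((s * Y1 \<omega>)\<^sup>2 / 2))) * complex_of_real (exp (- ((t * Y2 \<omega>)\<^sup>2 / 2)))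
       = (CLINT z|stdnorm. iexp (s * Y1 \<omega> * z)) * (CLINT z'|stdnorm. iexp (t * Y2 \<omega> * z'))"
      by (simp only: gauss_cf)
    also have "\<dots> = (CLINT z|stdnorm. iexp (s * Y1 \<omega> * z) * (CLINT z'|stdnorm. iexp (t * Y2 \<omega> * z')))"
      by (rule integral_mult_left_zero[symmetric])
    also have "\<dots> = (CLINT z|stdnorm. CLINT z'|stdnorm. iexp (s * Y1 \<omega> * z) * iexp (t * Y2 \<omega> * z'))"
      by (intro Bochner_Integration.integral_cong refl integral_mult_right_zero[symmetric])
    also have "\<dots> = (CLINT z|stdnorm. CLINT z'|stdnorm. ?e \<omega> z z')"
      by (intro Bochner_Integration.integral_cong refl) (simp add: exp_add[symmetric] algebra_simps)
    finally show "complex_of_real (exp (- ((s * Y1 \<omega>)\<^sup>2 / 2))) * complex_of_real (exp (- ((t * Y2 \<omega>)\<^sup>2 / 2)))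
       = (CLINT z|stdnorm. CLINT z'|stdnorm. ?e \<omega> z z')" .
  qed
  also have "\<dots> = (CLINT z|stdnorm. CLINT \<omega>|M. CLINT z'|stdnorm. ?e \<omega> z z')"
  proof (rule bounded_Fubini)
    have "(\<lambda>x. CLINT z'|stdnorm. ?e (fst x) (snd x) z') \<in> borel_measurable (M \<Otimes>\<^sub>M stdnorm)"
      by measurable
    then show "(\<lambda>(\<omega>, z). CLINT z'|stdnorm. ?e \<omega> z z') \<in> borel_measurable (M \<Otimes>\<^sub>M stdnorm)"
      by (simp add: case_prod_beta)
    fix \<omega> z
    have "cmod (CLINT z'|stdnorm. ?e \<omega> z z') \<le> (LINT z'|stdnorm. cmod (?e \<omega> z z'))"
      by (rule integral_norm_bound)
    then show "cmod (CLINT z'|stdnorm. ?e \<omega> z z') \<le> 1"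
      using N.prob_space by (simp del: of_real_add of_real_mult)
  qed unfold_locales
  also have "\<dots> = (CLINT z|stdnorm. CLINT z'|stdnorm. CLINT \<omega>|M. ?e \<omega> z z')"
    by (intro Bochner_Integration.integral_cong refl bounded_Fubini)
      (auto simp del: of_real_add of_real_mult intro: prob_space_axioms N.prob_space_axioms)
  also have "\<dots> = (CLINT z|stdnorm. CLINT z'|stdnorm. complex_of_real (J (s * z) (t * z')))"
    by (simp only: J)
  also have "\<dots> = complex_of_real (LINT z|stdnorm. LINT z'|stdnorm. J (s * z) (t * z'))"
    by (simp only: integral_complex_of_real)
  finally have E: "?E = (LINT z|stdnorm. LINT z'|stdnorm. J (s * z) (t * z'))"
    by (simp only: of_real_eq_iff)
  have ij: "integrable stdnorm (\<lambda>z'. J x (t * z'))" for x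
    using J0 J1 by (intro N.integrable_const_bound[of _ 1]) auto
  have "(\<integral>\<^sup>+ \<omega>. ennreal (exp (- ((s * Y1 \<omega>)\<^sup>2 / 2)) * exp (- ((t * Y2 \<omega>)\<^sup>2 / 2))) \<partial>M) = ennreal ?E"
  proof (rule nn_integral_eq_integral)
    have "\<bar>exp (- ((s * Y1 \<omega>)\<^sup>2 / 2)) * exp (- ((t * Y2 \<omega>)\<^sup>2 / 2))\<bar> \<le> 1" for \<omega>
      unfolding abs_mult by (intro mult_le_one) auto
    then show "integrable M (\<lambda>\<omega>. exp (- ((s * Y1 \<omega>)\<^sup>2 / 2)) * exp (- ((t * Y2 \<omega>)\<^sup>2 / 2)))"
      by (intro integrable_const_bound[of _ 1]) auto
  qed auto
  also have "\<dots> = (\<integral>\<^sup>+ z. ennreal (LINT z'|stdnorm. J (s * z) (t * z')) \<partial>stdnorm)"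
    unfolding E
  proof (rule nn_integral_eq_integral[symmetric])
    have "(LINT z'|stdnorm. J (s * z) (t * z')) \<le> (LINT z'|stdnorm. 1)" for z
      using ij J1 by (intro integral_mono) auto
    then have "(LINT z'|stdnorm. J (s * z) (t * z')) \<le> 1" for z
      using N.prob_space by simp
    then show "integrable stdnorm (\<lambda>z. LINT z'|stdnorm. J (s * z) (t * z'))"
      by (intro N.integrable_const_bound[of _ 1]) (auto simp: J0)
  qed (auto simp: J0)
  also have "\<dots> = (\<integral>\<^sup>+ z. \<integral>\<^sup>+ z'. ennreal (J (s * z) (t * z')) \<partial>stdnorm \<partial>stdnorm)"
    by (intro nn_integral_cong nn_integral_eq_integral[symmetric] ij) (auto simp: J0)
  finally show "(\<integral>\<^sup>+ \<omega>. ennreal (exp (- ((s * Y1 \<omega>)\<^sup>2 / 2)) * exp (- ((t * Y2 \<omega>)\<^sup>2 / 2))) \<partial>M)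
       = (\<integral>\<^sup>+ z. \<integral>\<^sup>+ z'. ennreal (J (s * z) (t * z')) \<partial>stdnorm \<partial>stdnorm)" .
qed

lemma gauss_mix_measurable [measurable]: "gauss_mix p \<in> borel_measurable borel"
  unfolding gauss_mix_def[abs_def] by measurable

lemma nn_integral_gauss_mix_pair:
  assumes [measurable]: "Y1 \<in> borel_measurable M" "Y2 \<in> borel_measurable M"
  shows "(\<integral>\<^sup>+ \<omega>. gauss_mix p (Y1 \<omega>) * gauss_mix p (Y2 \<omega>) \<partial>M)
    = (\<integral>\<^sup>+ s. ennreal (powr_weight p s) * (\<integral>\<^sup>+ t. ennreal (powr_weight p t) *
        (\<integral>\<^sup>+ \<omega>. ennreal (exp (- ((s * Y1 \<omega>)\<^sup>2 / 2)) * exp (- ((t * Y2 \<omega>)\<^sup>2 / 2))) \<partial>M) \<partial>lborel) \<partial>lborel)"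
proof -
  let ?w = "\<lambda>s. ennreal (powr_weight p s)" and ?e = "\<lambda>s y. ennreal (exp (- ((s * y)\<^sup>2 / 2)))"
  interpret L: pair_sigma_finite lborel M ..
  have "gauss_mix p (Y1 \<omega>) * gauss_mix p (Y2 \<omega>)
      = (\<integral>\<^sup>+ s. ?w s * (\<integral>\<^sup>+ t. ?w t * (?e s (Y1 \<omega>) * ?e t (Y2 \<omega>)) \<partial>lborel) \<partial>lborel)" for \<omega>
  proof -
    have "gauss_mix p (Y1 \<omega>) * gauss_mix p (Y2 \<omega>)
        = (\<integral>\<^sup>+ s. ?w s * ?e s (Y1 \<omega>) * gauss_mix p (Y2 \<omega>) \<partial>lborel)"
      unfolding gauss_mix_def[of p "Y1 \<omega>"] by (subst nn_integral_multc) (auto simp: ennreal_mult)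
    also have "\<dots> = (\<integral>\<^sup>+ s. ?w s * (\<integral>\<^sup>+ t. ?w t * (?e s (Y1 \<omega>) * ?e t (Y2 \<omega>)) \<partial>lborel) \<partial>lborel)"
    proof (rule nn_integral_cong)
      fix s
      have "(\<integral>\<^sup>+ t. ?w t * (?e s (Y1 \<omega>) * ?e t (Y2 \<omega>)) \<partial>lborel) = (\<integral>\<^sup>+ t. ?e s (Y1 \<omega>) * (?w t * ?e t (Y2 \<omega>)) \<partial>lborel)"
        by (simp add: mult_ac)
      also have "\<dots> = ?e s (Y1 \<omega>) * gauss_mix p (Y2 \<omega>)"
        unfolding gauss_mix_def by (subst nn_integral_cmult) (auto simp: ennreal_mult)
      finally show "?w s * ?e s (Y1 \<omega>) * gauss_mix p (Y2 \<omega>) = ?w s * (\<integral>\<^sup>+ t. ?w t * (?e s (Y1 \<omega>) * ?e t (Y2 \<omega>)) \<partial>lborel)"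
        by (simp add: mult.assoc)
    qed
    finally show ?thesis .
  qed
  then have "(\<integral>\<^sup>+ \<omega>. gauss_mix p (Y1 \<omega>) * gauss_mix p (Y2 \<omega>) \<partial>M)
    = (\<integral>\<^sup>+ \<omega>. \<integral>\<^sup>+ s. ?w s * (\<integral>\<^sup>+ t. ?w t * (?e s (Y1 \<omega>) * ?e t (Y2 \<omega>)) \<partial>lborel) \<partial>lborel \<partial>M)"
    by simp
  also have "\<dots> = (\<integral>\<^sup>+ s. \<integral>\<^sup>+ \<omega>. ?w s * (\<integral>\<^sup>+ t. ?w t * (?e s (Y1 \<omega>) * ?e t (Y2 \<omega>)) \<partial>lborel) \<partial>M \<partial>lborel)"
    by (rule L.Fubini') measurable
  also have "\<dots> = (\<integral>\<^sup>+ s. ?w s * (\<integral>\<^sup>+ \<omega>. \<integral>\<^sup>+ t. ?w t * (?e s (Y1 \<omega>) * ?e t (Y2 \<omega>)) \<partial>lborel \<partial>M) \<partial>lborel)"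
    by (intro nn_integral_cong nn_integral_cmult) measurable
  also have "\<dots> = (\<integral>\<^sup>+ s. ?w s * (\<integral>\<^sup>+ t. \<integral>\<^sup>+ \<omega>. ?w t * (?e s (Y1 \<omega>) * ?e t (Y2 \<omega>)) \<partial>M \<partial>lborel) \<partial>lborel)"
    by (intro nn_integral_cong arg_cong2[where f="(*)"] refl L.Fubini') measurable
  also have "\<dots> = (\<integral>\<^sup>+ s. ?w s * (\<integral>\<^sup>+ t. ?w t * (\<integral>\<^sup>+ \<omega>. ?e s (Y1 \<omega>) * ?e t (Y2 \<omega>) \<partial>M) \<partial>lborel) \<partial>lborel)"
    by (intro nn_integral_cong arg_cong2[where f="(*)"] refl nn_integral_cmult) measurable
  finally show ?thesis by (simp add: ennreal_mult[symmetric])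
qed

end

definition neg_moment :: "real \<Rightarrow> real \<Rightarrow> real \<Rightarrow> real" where
  "neg_moment p S \<alpha> = mix_val p 0 S \<alpha> / gauss_const p"

lemma neg_moment_pos: "0 < p \<Longrightarrow> p < 1 \<Longrightarrow> 0 < S \<Longrightarrow> 0 < \<alpha> \<Longrightarrow> 0 < neg_moment p S \<alpha>"
  by (simp add: neg_moment_def mix_val_pos gauss_const_pos)

text \<open>
  The first summand bounds the covariance for weakly dependent pairs, the second one for all others.
\<close>

definition cov_const :: "real \<Rightarrow> real \<Rightarrow> real \<Rightarrow> real" where
  "cov_const p S \<alpha> = 2 * (mix_val p (\<alpha>/2) (S/2) \<alpha> / gauss_const p)\<^sup>2
      + 2 * (neg_moment (2 * p) S \<alpha> + (neg_moment p S \<alpha>)\<^sup>2) / S"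

lemma weighted_double_integral_add:
  fixes w f g :: "real \<Rightarrow> ennreal" and K :: "real \<Rightarrow> real \<Rightarrow> ennreal"
  assumes [measurable]: "w \<in> borel_measurable borel" "g \<in> borel_measurable borel"
    "case_prod K \<in> borel_measurable (borel \<Otimes>\<^sub>M borel)"
  shows "(\<integral>\<^sup>+ s. w s * (\<integral>\<^sup>+ t. w t * (K s t + c * (g s * g t)) \<partial>lborel) \<partial>lborel)
    = (\<integral>\<^sup>+ s. w s * (\<integral>\<^sup>+ t. w t * K s t \<partial>lborel) \<partial>lborel) + c * (\<integral>\<^sup>+ s. w s * g s \<partial>lborel)\<^sup>2"
proof -
  define G where "G = (\<integral>\<^sup>+ s. w s * g s \<partial>lborel)"
  have "(\<integral>\<^sup>+ t. w t * (K s t + c * (g s * g t)) \<partial>lborel) = (\<integral>\<^sup>+ t. w t * K s t \<partial>lborel) + c * g s * G" for s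
  proof -
    have "(\<integral>\<^sup>+ t. w t * (K s t + c * (g s * g t)) \<partial>lborel) = (\<integral>\<^sup>+ t. w t * K s t + (c * g s) * (w t * g t) \<partial>lborel)"
      by (simp add: distrib_left mult_ac)
    also have "\<dots> = (\<integral>\<^sup>+ t. w t * K s t \<partial>lborel) + c * g s * G"
      unfolding G_def by (subst nn_integral_add) (auto simp: nn_integral_cmult)
    finally show ?thesis .
  qed
  then have "(\<integral>\<^sup>+ s. w s * (\<integral>\<^sup>+ t. w t * (K s t + c * (g s * g t)) \<partial>lborel) \<partial>lborel)
    = (\<integral>\<^sup>+ s. w s * (\<integral>\<^sup>+ t. w t * K s t \<partial>lborel) + (c * G) * (w s * g s) \<partial>lborel)"
    by (simp add: distrib_left mult_ac)
  also have "\<dots> = (\<integral>\<^sup>+ s. w s * (\<integral>\<^sup>+ t. w t * K s t \<partial>lborel) \<partial>lborel) + (c * G) * G"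
    by (subst nn_integral_add) (auto simp: nn_integral_cmult G_def)
  finally show ?thesis by (simp add: G_def power2_eq_square mult_ac)
qed

lemma weighted_double_integral_prod:
  fixes w f :: "real \<Rightarrow> ennreal"
  assumes [measurable]: "w \<in> borel_measurable borel" "f \<in> borel_measurable borel"
  shows "(\<integral>\<^sup>+ s. w s * (\<integral>\<^sup>+ t. w t * (f s * f t) \<partial>lborel) \<partial>lborel) = (\<integral>\<^sup>+ s. w s * f s \<partial>lborel)\<^sup>2"
  using weighted_double_integral_add[of w f "\<lambda>_ _. 0" 1] by simp

context prob_space begin

text \<open>
  The expectation of the Gaussian mixture is computed first,
  its finiteness shows that \<open>Y\<close> is almost surely nonzero, and outside zero the mixture is the negative power.
\<close>

lemma
  assumes [measurable]: "Y \<in> borel_measurable M"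
    and cf: "\<And>u. (CLINT \<omega>|M. iexp (u * Y \<omega>)) = complex_of_real (exp (- (S * \<bar>u\<bar> powr \<alpha>)))"
    and S: "0 < S" "0 < \<alpha>" and p: "0 < p" "p < 1"
  shows nn_integral_gauss_mix: "(\<integral>\<^sup>+ \<omega>. gauss_mix p (Y \<omega>) \<partial>M) = ennreal (mix_val p 0 S \<alpha>)"
    and AE_stable_nonzero: "AE \<omega> in M. Y \<omega> \<noteq> 0"
    and nn_integral_neg_moment: "(\<integral>\<^sup>+ \<omega>. ennreal (\<bar>Y \<omega>\<bar> powr (- p)) \<partial>M) = ennreal (neg_moment p S \<alpha>)"
proof -
  interpret N: prob_space stdnorm by (rule prob_space_std_normal)
  interpret L: pair_sigma_finite lborel M ..
  let ?w = "\<lambda>s. ennreal (powr_weight p s)" and ?e = "\<lambda>s y. ennreal (exp (- ((s * y)\<^sup>2 / 2)))"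
  have "(\<integral>\<^sup>+ \<omega>. gauss_mix p (Y \<omega>) \<partial>M) = (\<integral>\<^sup>+ \<omega>. \<integral>\<^sup>+ s. ?w s * ?e s (Y \<omega>) \<partial>lborel \<partial>M)"
    unfolding gauss_mix_def by (simp add: ennreal_mult)
  also have "\<dots> = (\<integral>\<^sup>+ s. \<integral>\<^sup>+ \<omega>. ?w s * ?e s (Y \<omega>) \<partial>M \<partial>lborel)"
    by (rule L.Fubini') measurable
  also have "\<dots> = (\<integral>\<^sup>+ s. ?w s * (\<integral>\<^sup>+ \<omega>. ?e s (Y \<omega>) \<partial>M) \<partial>lborel)"
    by (intro nn_integral_cong nn_integral_cmult) measurable
  also have "\<dots> = (\<integral>\<^sup>+ s. ?w s * (\<integral>\<^sup>+ z. ennreal (\<bar>s * z\<bar> powr 0 * exp (- (S * \<bar>s * z\<bar> powr \<alpha>))) \<partial>stdnorm) \<partial>lborel)"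
  proof (rule nn_integral_cong)
    fix s
    show "?w s * (\<integral>\<^sup>+ \<omega>. ?e s (Y \<omega>) \<partial>M) = ?w s * (\<integral>\<^sup>+ z. ennreal (\<bar>s * z\<bar> powr 0 * exp (- (S * \<bar>s * z\<bar> powr \<alpha>))) \<partial>stdnorm)"
    proof (cases "s = 0")
      case True
      then show ?thesis by (simp add: powr_weight_def)
    next
      case False
      have "(\<integral>\<^sup>+ \<omega>. ?e s (Y \<omega>) \<partial>M)
         = (\<integral>\<^sup>+ z. \<integral>\<^sup>+ z'. ennreal (exp (- (S * \<bar>s * z\<bar> powr \<alpha>))) \<partial>stdnorm \<partial>stdnorm)"
        using gauss_pair(2)[of Y "\<lambda>_. 0" "\<lambda>u v. exp (- (S * \<bar>u\<bar> powr \<alpha>))" s 0] cf by simp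
      also have "\<dots> = (\<integral>\<^sup>+ z. ennreal (exp (- (S * \<bar>s * z\<bar> powr \<alpha>))) \<partial>stdnorm)"
        using N.emeasure_space_1 by simp
      also have "\<dots> = (\<integral>\<^sup>+ z. ennreal (\<bar>s * z\<bar> powr 0 * exp (- (S * \<bar>s * z\<bar> powr \<alpha>))) \<partial>stdnorm)"
        by (intro nn_integral_cong_AE eventually_mono[OF AE_stdnorm_nonzero]) (use False in auto)
      finally show ?thesis by simp
    qed
  qed
  also have "\<dots> = ennreal (mix_val p 0 S \<alpha>)"
    using S p by (intro nn_integral_mix) auto
  finally show *: "(\<integral>\<^sup>+ \<omega>. gauss_mix p (Y \<omega>) \<partial>M) = ennreal (mix_val p 0 S \<alpha>)" .
  have "AE \<omega> in M. gauss_mix p (Y \<omega>) \<noteq> \<infinity>"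
    by (rule nn_integral_noteq_infinite) (auto simp: *)
  then show nz: "AE \<omega> in M. Y \<omega> \<noteq> 0"
    by eventually_elim (use gauss_mix_0[OF p(1)] in auto)
  define A where "A = gauss_const p"
  have A: "A > 0" using p by (simp add: A_def gauss_const_pos)
  have "ennreal (mix_val p 0 S \<alpha>) = (\<integral>\<^sup>+ \<omega>. ennreal A * ennreal (\<bar>Y \<omega>\<bar> powr (- p)) \<partial>M)"
    unfolding *[symmetric] using nz
    by (intro nn_integral_cong_AE) (auto elim!: eventually_mono simp: gauss_mix_eq[OF p(1)] A_def ennreal_mult'' )
  also have "\<dots> = ennreal A * (\<integral>\<^sup>+ \<omega>. ennreal (\<bar>Y \<omega>\<bar> powr (- p)) \<partial>M)"
    by (rule nn_integral_cmult) measurable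
  finally have eq: "ennreal A * (\<integral>\<^sup>+ \<omega>. ennreal (\<bar>Y \<omega>\<bar> powr (- p)) \<partial>M) = ennreal (mix_val p 0 S \<alpha>)" ..
  have "(\<integral>\<^sup>+ \<omega>. ennreal (\<bar>Y \<omega>\<bar> powr (- p)) \<partial>M)
      = ennreal (inverse A) * (ennreal A * (\<integral>\<^sup>+ \<omega>. ennreal (\<bar>Y \<omega>\<bar> powr (- p)) \<partial>M))"
    using A by (simp add: mult.assoc[symmetric] ennreal_mult[symmetric])
  also have "\<dots> = ennreal (neg_moment p S \<alpha>)"
    unfolding eq using A mix_val_pos[of p 0 S \<alpha>] S p
    by (simp add: ennreal_mult[symmetric] neg_moment_def A_def divide_inverse mult.commute)
  finally show "(\<integral>\<^sup>+ \<omega>. ennreal (\<bar>Y \<omega>\<bar> powr (- p)) \<partial>M) = ennreal (neg_moment p S \<alpha>)" .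
qed

lemma neg_moment:
  assumes [measurable]: "Y \<in> borel_measurable M"
    and cf: "\<And>u. (CLINT \<omega>|M. iexp (u * Y \<omega>)) = complex_of_real (exp (- (S * \<bar>u\<bar> powr \<alpha>)))"
    and S: "0 < S" "0 < \<alpha>" and p: "0 < p" "p < 1"
  shows "integrable M (\<lambda>\<omega>. \<bar>Y \<omega>\<bar> powr (- p))"
    and "expectation (\<lambda>\<omega>. \<bar>Y \<omega>\<bar> powr (- p)) = neg_moment p S \<alpha>"
proof -
  note * = nn_integral_neg_moment[OF assms]
  show "integrable M (\<lambda>\<omega>. \<bar>Y \<omega>\<bar> powr (- p))"
    by (rule integrableI_nonneg) (auto simp: *)
  show "expectation (\<lambda>\<omega>. \<bar>Y \<omega>\<bar> powr (- p)) = neg_moment p S \<alpha>"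
    using neg_moment_pos[of p S \<alpha>] S p by (simp add: integral_eq_nn_integral *)
qed

text \<open>
  The assumption on \<open>n\<close> with \<open>v = 0\<close> or \<open>u = 0\<close> implies that both variables have the characteristic function
  \<open>exp (- S \<bar>u\<bar>\<^sup>\<alpha>)\<close>. Integrating the bound
  of \<open>exp_defect\<close> against the mixing weights compares the mixed moment with the product of the moments.
  The comparison is made by two inequalities between nonnegative integrals, since a difference of
  such integrals is meaningful only once they are known to be finite.
\<close>

lemma neg_moment_pair_small:
  assumes [measurable]: "Y1 \<in> borel_measurable M" "Y2 \<in> borel_measurable M"
    and J: "\<And>u v. (CLINT \<omega>|M. iexp (u * Y1 \<omega> + v * Y2 \<omega>)) = complex_of_real (exp (- n u v))"
    and n: "\<And>u v. \<bar>n u v - S * \<bar>u\<bar> powr \<alpha> - S * \<bar>v\<bar> powr \<alpha>\<bar> \<le> 2 * r * (\<bar>u\<bar> powr (\<alpha>/2) * \<bar>v\<bar> powr (\<alpha>/2))"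
    and S: "0 < S" "0 < \<alpha>" and r: "0 \<le> r" "2 * r \<le> S" and p: "0 < p" "p < 1"
  shows "integrable M (\<lambda>\<omega>. \<bar>Y1 \<omega>\<bar> powr (- p) * \<bar>Y2 \<omega>\<bar> powr (- p))"
    and "\<bar>expectation (\<lambda>\<omega>. \<bar>Y1 \<omega>\<bar> powr (- p) * \<bar>Y2 \<omega>\<bar> powr (- p)) - (neg_moment p S \<alpha>)\<^sup>2\<bar>
           \<le> 2 * r * (mix_val p (\<alpha>/2) (S/2) \<alpha> / gauss_const p)\<^sup>2"
proof -
  have cf1: "(CLINT \<omega>|M. iexp (u * Y1 \<omega>)) = complex_of_real (exp (- (S * \<bar>u\<bar> powr \<alpha>)))" for u
    using J[of u 0] n[of u 0] by simp
  have cf2: "(CLINT \<omega>|M. iexp (v * Y2 \<omega>)) = complex_of_real (exp (- (S * \<bar>v\<bar> powr \<alpha>)))" for v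
    using J[of 0 v] n[of 0 v] by simp
  have sq: "(\<bar>u\<bar> powr (\<alpha>/2))\<^sup>2 = \<bar>u\<bar> powr \<alpha>" for u :: real
    by (simp add: power2_eq_square powr_add[symmetric])
  have [measurable]: "case_prod (\<lambda>u v. exp (- n u v)) \<in> borel_measurable (borel \<Otimes>\<^sub>M borel)"
    by (rule gauss_pair(1)[OF assms(1,2) J]) auto
  let ?w = "\<lambda>s. ennreal (powr_weight p s)"
  define e where "e = (\<lambda>u. exp (- (S * \<bar>u\<bar> powr \<alpha>)))"
  define q where "q = (\<lambda>u. \<bar>u\<bar> powr (\<alpha>/2) * exp (- (S / 2 * \<bar>u\<bar> powr \<alpha>)))"
  have [measurable]: "e \<in> borel_measurable borel" "q \<in> borel_measurable borel"
    unfolding e_def[abs_def] q_def[abs_def] by measurable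
  have eq0: "0 \<le> e u" "0 \<le> q u" for u by (simp_all add: e_def q_def)
  have defect: "\<bar>exp (- n u v) - e u * e v\<bar> \<le> 2 * r * (q u * q v)" for u v
    using exp_defect[of r S "\<bar>u\<bar> powr (\<alpha>/2)" "\<bar>v\<bar> powr (\<alpha>/2)" "n u v"] n[of u v] r
    unfolding sq e_def q_def by simp
  define K where "K = (\<lambda>s t. \<integral>\<^sup>+ z. \<integral>\<^sup>+ z'. ennreal (exp (- n (s * z) (t * z'))) \<partial>stdnorm \<partial>stdnorm)"
  define kE where "kE = (\<lambda>s. \<integral>\<^sup>+ z. ennreal (e (s * z)) \<partial>stdnorm)"
  define kq where "kq = (\<lambda>s. \<integral>\<^sup>+ z. ennreal (q (s * z)) \<partial>stdnorm)"
  interpret N: prob_space stdnorm by (rule prob_space_std_normal)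
  have Km[measurable]: "case_prod K \<in> borel_measurable (borel \<Otimes>\<^sub>M borel)"
    unfolding K_def by measurable
  have [measurable]: "kE \<in> borel_measurable borel" "kq \<in> borel_measurable borel"
    unfolding kE_def kq_def by measurable
  have K_le: "K s t \<le> kE s * kE t + ennreal (2 * r) * (kq s * kq t)" for s t
  proof -
    have "K s t \<le> (\<integral>\<^sup>+ z. \<integral>\<^sup>+ z'. ennreal (e (s * z)) * ennreal (e (t * z'))
        + ennreal (2 * r) * (ennreal (q (s * z)) * ennreal (q (t * z'))) \<partial>stdnorm \<partial>stdnorm)"
      unfolding K_def
    proof (intro nn_integral_mono)
      fix z z'
      have "exp (- n (s * z) (t * z')) \<le> e (s * z) * e (t * z') + 2 * r * (q (s * z) * q (t * z'))"
        using defect[of "s * z" "t * z'"] by (simp add: abs_le_iff)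
      then show "ennreal (exp (- n (s * z) (t * z'))) \<le> ennreal (e (s * z)) * ennreal (e (t * z'))
        + ennreal (2 * r) * (ennreal (q (s * z)) * ennreal (q (t * z')))"
        using eq0 r by (simp add: ennreal_mult[symmetric] ennreal_plus[symmetric] del: ennreal_plus)
    qed
    also have "\<dots> = kE s * kE t + ennreal (2 * r) * (kq s * kq t)"
      unfolding kE_def kq_def by (simp add: nn_integral_add nn_integral_cmult nn_integral_multc)
    finally show ?thesis .
  qed
  have le_K: "kE s * kE t \<le> K s t + ennreal (2 * r) * (kq s * kq t)" for s t
  proof -
    have "kE s * kE t = (\<integral>\<^sup>+ z. \<integral>\<^sup>+ z'. ennreal (e (s * z)) * ennreal (e (t * z')) \<partial>stdnorm \<partial>stdnorm)"
      unfolding kE_def by (simp add: nn_integral_cmult nn_integral_multc)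
    also have "\<dots> \<le> (\<integral>\<^sup>+ z. \<integral>\<^sup>+ z'. ennreal (exp (- n (s * z) (t * z')))
        + ennreal (2 * r) * (ennreal (q (s * z)) * ennreal (q (t * z'))) \<partial>stdnorm \<partial>stdnorm)"
    proof (intro nn_integral_mono)
      fix z z'
      have "e (s * z) * e (t * z') \<le> exp (- n (s * z) (t * z')) + 2 * r * (q (s * z) * q (t * z'))"
        using defect[of "s * z" "t * z'"] by (simp add: abs_le_iff)
      then show "ennreal (e (s * z)) * ennreal (e (t * z')) \<le> ennreal (exp (- n (s * z) (t * z')))
        + ennreal (2 * r) * (ennreal (q (s * z)) * ennreal (q (t * z')))"
        using eq0 r by (simp add: ennreal_mult[symmetric] ennreal_plus[symmetric] del: ennreal_plus)
    qed
    also have "\<dots> = K s t + ennreal (2 * r) * (kq s * kq t)"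
      unfolding K_def kq_def by (simp add: nn_integral_add nn_integral_cmult nn_integral_multc)
    finally show ?thesis .
  qed
  define V where "V = mix_val p 0 S \<alpha>"
  define Q where "Q = mix_val p (\<alpha>/2) (S/2) \<alpha>"
  have V0: "0 \<le> V" "0 \<le> Q"
    using mix_val_pos[of p 0 S \<alpha>] mix_val_pos[of p "\<alpha>/2" "S/2" \<alpha>] p S by (auto simp: V_def Q_def)
  have intq: "(\<integral>\<^sup>+ s. ?w s * kq s \<partial>lborel) = ennreal Q"
    unfolding kq_def q_def Q_def using p S by (intro nn_integral_mix) auto
  have intE: "(\<integral>\<^sup>+ s. ?w s * kE s \<partial>lborel) = ennreal V"
  proof -
    have "(\<integral>\<^sup>+ s. ?w s * kE s \<partial>lborel)
        = (\<integral>\<^sup>+ s. ?w s * (\<integral>\<^sup>+ z. ennreal (\<bar>s * z\<bar> powr 0 * exp (- (S * \<bar>s * z\<bar> powr \<alpha>))) \<partial>stdnorm) \<partial>lborel)"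
    proof (rule nn_integral_cong)
      fix s
      have "kE s = (\<integral>\<^sup>+ z. ennreal (\<bar>s * z\<bar> powr 0 * exp (- (S * \<bar>s * z\<bar> powr \<alpha>))) \<partial>stdnorm)" if "s \<noteq> 0"
        unfolding kE_def e_def
        by (intro nn_integral_cong_AE eventually_mono[OF AE_stdnorm_nonzero]) (use that in auto)
      then show "?w s * kE s = ?w s * (\<integral>\<^sup>+ z. ennreal (\<bar>s * z\<bar> powr 0 * exp (- (S * \<bar>s * z\<bar> powr \<alpha>))) \<partial>stdnorm)"
        by (cases "s = 0") (simp_all add: powr_weight_def)
    qed
    also have "\<dots> = ennreal V"
      unfolding V_def using p S by (intro nn_integral_mix) auto
    finally show ?thesis .
  qed
  define I where "I = (\<integral>\<^sup>+ s. ?w s * (\<integral>\<^sup>+ t. ?w t * K s t \<partial>lborel) \<partial>lborel)"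
  have I_le: "I \<le> ennreal (V\<^sup>2 + 2 * r * Q\<^sup>2)"
  proof -
    have "I \<le> (\<integral>\<^sup>+ s. ?w s * (\<integral>\<^sup>+ t. ?w t * (kE s * kE t + ennreal (2 * r) * (kq s * kq t)) \<partial>lborel) \<partial>lborel)"
      unfolding I_def by (intro nn_integral_mono mult_left_mono K_le) auto
    also have "\<dots> = (ennreal V)\<^sup>2 + ennreal (2 * r) * (ennreal Q)\<^sup>2"
      by (subst weighted_double_integral_add) (simp_all add: weighted_double_integral_prod intq intE)
    also have "\<dots> = ennreal (V\<^sup>2 + 2 * r * Q\<^sup>2)"
      using V0 r by (simp add: ennreal_power ennreal_mult)
    finally show ?thesis .
  qed
  have le_I: "ennreal (V\<^sup>2) \<le> I + ennreal (2 * r * Q\<^sup>2)"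
  proof -
    have "ennreal (V\<^sup>2) = (\<integral>\<^sup>+ s. ?w s * (\<integral>\<^sup>+ t. ?w t * (kE s * kE t) \<partial>lborel) \<partial>lborel)"
      using V0 by (simp add: weighted_double_integral_prod intE ennreal_power)
    also have "\<dots> \<le> (\<integral>\<^sup>+ s. ?w s * (\<integral>\<^sup>+ t. ?w t * (K s t + ennreal (2 * r) * (kq s * kq t)) \<partial>lborel) \<partial>lborel)"
      by (intro nn_integral_mono mult_left_mono le_K) auto
    also have "\<dots> = I + ennreal (2 * r * Q\<^sup>2)"
      using V0 r by (subst weighted_double_integral_add) (simp_all add: intq I_def ennreal_power ennreal_mult)
    finally show ?thesis .
  qed
  define A where "A = gauss_const p"
  have A: "A > 0" using p by (simp add: A_def gauss_const_pos)
  let ?Z = "\<lambda>\<omega>. \<bar>Y1 \<omega>\<bar> powr (- p) * \<bar>Y2 \<omega>\<bar> powr (- p)"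
  have nz: "AE \<omega> in M. Y1 \<omega> \<noteq> 0" "AE \<omega> in M. Y2 \<omega> \<noteq> 0"
    using AE_stable_nonzero[OF assms(1) cf1 S p] AE_stable_nonzero[OF assms(2) cf2 S p] by auto
  have "I = (\<integral>\<^sup>+ \<omega>. gauss_mix p (Y1 \<omega>) * gauss_mix p (Y2 \<omega>) \<partial>M)"
    unfolding nn_integral_gauss_mix_pair[OF assms(1,2)] I_def K_def
    using gauss_pair(2)[OF assms(1,2) J] by simp
  also have "\<dots> = (\<integral>\<^sup>+ \<omega>. ennreal (A\<^sup>2) * ennreal (?Z \<omega>) \<partial>M)"
    using nz
    by (intro nn_integral_cong_AE)
      (auto elim!: eventually_elim2 simp: gauss_mix_eq[OF p(1)] A_def[symmetric] ennreal_mult[symmetric]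
        power2_eq_square mult_ac A less_imp_le)
  also have "\<dots> = ennreal (A\<^sup>2) * (\<integral>\<^sup>+ \<omega>. ennreal (?Z \<omega>) \<partial>M)"
    by (rule nn_integral_cmult) measurable
  finally have IZ: "I = ennreal (A\<^sup>2) * (\<integral>\<^sup>+ \<omega>. ennreal (?Z \<omega>) \<partial>M)" .
  have fin: "(\<integral>\<^sup>+ \<omega>. ennreal (?Z \<omega>) \<partial>M) < \<infinity>"
  proof (rule ccontr)
    assume "\<not> ?thesis"
    then have "(\<integral>\<^sup>+ \<omega>. ennreal (?Z \<omega>) \<partial>M) = \<infinity>" by (simp add: less_top[symmetric])
    then have "I = \<infinity>" using A by (simp add: IZ ennreal_mult_top)
    then show False using I_le by (simp add: top_unique)
  qed
  then show int: "integrable M ?Z" by (intro integrableI_nonneg) auto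
  define x where "x = expectation ?Z"
  have "(\<integral>\<^sup>+ \<omega>. ennreal (?Z \<omega>) \<partial>M) = ennreal x"
    unfolding x_def using int by (intro nn_integral_eq_integral) auto
  moreover have x0: "0 \<le> x" by (simp add: x_def)
  ultimately have I_eq: "I = ennreal (A\<^sup>2 * x)" by (simp add: IZ ennreal_mult)
  have 1: "A\<^sup>2 * x \<le> V\<^sup>2 + 2 * r * Q\<^sup>2"
    using I_le r unfolding I_eq by (subst (asm) ennreal_le_iff) auto
  have "ennreal (V\<^sup>2) \<le> ennreal (A\<^sup>2 * x + 2 * r * Q\<^sup>2)"
    using le_I x0 r unfolding I_eq by (simp add: ennreal_plus)
  then have 2: "V\<^sup>2 \<le> A\<^sup>2 * x + 2 * r * Q\<^sup>2"
    using x0 r by (subst (asm) ennreal_le_iff) auto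
  have "A\<^sup>2 * \<bar>x - (V / A)\<^sup>2\<bar> = \<bar>A\<^sup>2 * x - V\<^sup>2\<bar>"
  proof -
    have "A\<^sup>2 * (x - (V / A)\<^sup>2) = A\<^sup>2 * x - V\<^sup>2"
      using A by (simp add: right_diff_distrib power_divide)
    then show ?thesis using abs_mult[of "A\<^sup>2" "x - (V / A)\<^sup>2"] by simp
  qed
  also have "\<dots> \<le> A\<^sup>2 * (2 * r * (Q / A)\<^sup>2)"
    using 1 2 A by (simp add: abs_le_iff power_divide)
  finally have "\<bar>x - (V / A)\<^sup>2\<bar> \<le> 2 * r * (Q / A)\<^sup>2"
    using A by (simp add: mult_le_cancel_left)
  then show "\<bar>expectation ?Z - (neg_moment p S \<alpha>)\<^sup>2\<bar> \<le> 2 * r * (mix_val p (\<alpha>/2) (S/2) \<alpha> / gauss_const p)\<^sup>2"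
    by (simp add: x_def V_def A_def Q_def neg_moment_def)
qed

text \<open>
  For \<open>2 r > S\<close> the bound need not be small and the trivial estimate \<open>2 x y \<le> x\<^sup>2 + y\<^sup>2\<close> is sufficient. It involves the
  moment of order \<open>- 2 p\<close>, which is where \<open>p < 1/2\<close> enters.
\<close>

lemma neg_moment_pair:
  assumes [measurable]: "Y1 \<in> borel_measurable M" "Y2 \<in> borel_measurable M"
    and J: "\<And>u v. (CLINT \<omega>|M. iexp (u * Y1 \<omega> + v * Y2 \<omega>)) = complex_of_real (exp (- n u v))"
    and n: "\<And>u v. \<bar>n u v - S * \<bar>u\<bar> powr \<alpha> - S * \<bar>v\<bar> powr \<alpha>\<bar> \<le> 2 * r * (\<bar>u\<bar> powr (\<alpha>/2) * \<bar>v\<bar> powr (\<alpha>/2))"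
    and S: "0 < S" "0 < \<alpha>" and r: "0 \<le> r" and p: "0 < p" "p < 1/2"
  shows "integrable M (\<lambda>\<omega>. \<bar>Y1 \<omega>\<bar> powr (- p) * \<bar>Y2 \<omega>\<bar> powr (- p))"
    and "\<bar>expectation (\<lambda>\<omega>. \<bar>Y1 \<omega>\<bar> powr (- p) * \<bar>Y2 \<omega>\<bar> powr (- p)) - (neg_moment p S \<alpha>)\<^sup>2\<bar>
           \<le> cov_const p S \<alpha> * r"
proof -
  let ?Z = "\<lambda>\<omega>. \<bar>Y1 \<omega>\<bar> powr (- p) * \<bar>Y2 \<omega>\<bar> powr (- p)"
  have cf1: "(CLINT \<omega>|M. iexp (u * Y1 \<omega>)) = complex_of_real (exp (- (S * \<bar>u\<bar> powr \<alpha>)))" for u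
    using J[of u 0] n[of u 0] by simp
  have cf2: "(CLINT \<omega>|M. iexp (v * Y2 \<omega>)) = complex_of_real (exp (- (S * \<bar>v\<bar> powr \<alpha>)))" for v
    using J[of 0 v] n[of 0 v] by simp
  define m2 where "m2 = neg_moment (2 * p) S \<alpha>"
  define m where "m = neg_moment p S \<alpha>"
  define q where "q = (mix_val p (\<alpha>/2) (S/2) \<alpha> / gauss_const p)\<^sup>2"
  note M1 = neg_moment[OF assms(1) cf1 S, of "2 * p"] and M2 = neg_moment[OF assms(2) cf2 S, of "2 * p"]
  have m2: "m2 > 0" unfolding m2_def using S p by (intro neg_moment_pos) auto
  have bound: "?Z \<omega> \<le> (\<bar>Y1 \<omega>\<bar> powr (- (2 * p)) + \<bar>Y2 \<omega>\<bar> powr (- (2 * p))) / 2" for \<omega>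
  proof -
    have sq: "\<bar>x\<bar> powr (- (2 * p)) = (\<bar>x\<bar> powr (- p))\<^sup>2" for x :: real
      by (simp add: power2_eq_square powr_add[symmetric])
    have "0 \<le> (\<bar>Y1 \<omega>\<bar> powr (- p) - \<bar>Y2 \<omega>\<bar> powr (- p))\<^sup>2" by simp
    then show ?thesis unfolding sq by (simp add: power2_diff)
  qed
  have int2: "integrable M (\<lambda>\<omega>. (\<bar>Y1 \<omega>\<bar> powr (- (2 * p)) + \<bar>Y2 \<omega>\<bar> powr (- (2 * p))) / 2)"
    using M1(1) M2(1) p by simp
  show int: "integrable M ?Z"
  proof (rule Bochner_Integration.integrable_bound[OF int2])
    show "AE \<omega> in M. norm (?Z \<omega>) \<le> norm ((\<bar>Y1 \<omega>\<bar> powr (- (2 * p)) + \<bar>Y2 \<omega>\<bar> powr (- (2 * p))) / 2)"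
    proof (rule AE_I2)
      fix \<omega>
      have "norm (?Z \<omega>) = ?Z \<omega>" by simp
      then show "norm (?Z \<omega>) \<le> norm ((\<bar>Y1 \<omega>\<bar> powr (- (2 * p)) + \<bar>Y2 \<omega>\<bar> powr (- (2 * p))) / 2)"
        using bound[of \<omega>] by simp
    qed
  qed measurable
  have q0: "0 \<le> q" by (simp add: q_def)
  have cc: "cov_const p S \<alpha> * r = 2 * r * q + (m2 + m\<^sup>2) * (2 * r / S)"
    by (simp add: cov_const_def q_def m2_def m_def algebra_simps add_divide_distrib)
  show "\<bar>expectation ?Z - (neg_moment p S \<alpha>)\<^sup>2\<bar> \<le> cov_const p S \<alpha> * r"
  proof (cases "2 * r \<le> S")
    case True
    have "\<bar>expectation ?Z - m\<^sup>2\<bar> \<le> 2 * r * q"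
      unfolding q_def m_def using p by (intro neg_moment_pair_small(2)[OF assms(1,2) J n S r True]) auto
    moreover have "0 \<le> (m2 + m\<^sup>2) * (2 * r / S)" using m2 r S by simp
    ultimately show ?thesis unfolding cc by (simp add: m_def)
  next
    case False
    have "expectation ?Z \<le> expectation (\<lambda>\<omega>. (\<bar>Y1 \<omega>\<bar> powr (- (2 * p)) + \<bar>Y2 \<omega>\<bar> powr (- (2 * p))) / 2)"
      by (intro integral_mono int int2 bound)
    also have "\<dots> = m2" using M1 M2 p by (simp add: m2_def)
    finally have "expectation ?Z \<le> m2" .
    moreover have "0 \<le> expectation ?Z" by simp
    moreover have "0 \<le> m\<^sup>2" by simp
    ultimately have "\<bar>expectation ?Z - m\<^sup>2\<bar> \<le> (m2 + m\<^sup>2) * 1"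
      using m2 \<open>0 \<le> m\<^sup>2\<close> unfolding mult_1_right by (intro abs_leI) linarith+
    also have "\<dots> \<le> (m2 + m\<^sup>2) * (2 * r / S)"
      using False S m2 by (intro mult_left_mono) (auto simp: field_simps)
    also have "\<dots> \<le> cov_const p S \<alpha> * r" unfolding cc using r q0 by simp
    finally show ?thesis by (simp add: m_def)
  qed
qed

end

section \<open>Decay of the increment kernel\<close>

lemma binomial_remainder:
  fixes c :: real and m :: nat
  obtains B where "0 \<le> B"
    "\<And>z. \<bar>z\<bar> \<le> 1/2 \<Longrightarrow> \<bar>(1 + z) powr c - (\<Sum>q<m. (c gchoose q) * z ^ q)\<bar> \<le> B * \<bar>z\<bar> ^ m"
proof -
  let ?b = "\<lambda>n. c gchoose n"
  have "summable (\<lambda>n. ?b n * (3/4) ^ n)"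
    using gen_binomial_real[of "3/4" c] by (simp add: sums_iff)
  then have "summable (\<lambda>n. norm (?b n * (1/2) ^ n))"
    by (rule powser_insidea) simp
  then have "summable (\<lambda>n. norm (?b (n + m) * (1/2) ^ (n + m)))"
    by (subst summable_iff_shift)
  then have "summable (\<lambda>n. 2 ^ m * norm (?b (n + m) * (1/2) ^ (n + m)))"
    by (rule summable_mult)
  then have sB: "summable (\<lambda>n. \<bar>?b (n + m)\<bar> * (1/2) ^ n)"
    by (simp add: abs_mult power_add power_divide mult_ac)
  define B where "B = (\<Sum>n. \<bar>?b (n + m)\<bar> * (1/2) ^ n)"
  have "0 \<le> B" unfolding B_def by (intro suminf_nonneg sB) auto
  moreover have "\<bar>(1 + z) powr c - (\<Sum>q<m. ?b q * z ^ q)\<bar> \<le> B * \<bar>z\<bar> ^ m" if z: "\<bar>z\<bar> \<le> 1/2" for z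
  proof -
    have s: "(\<lambda>n. ?b n * z ^ n) sums (1 + z) powr c"
      using z by (intro gen_binomial_real) auto
    then have "(1 + z) powr c - (\<Sum>q<m. ?b q * z ^ q) = (\<Sum>n. ?b (n + m) * z ^ (n + m))"
      using suminf_split_initial_segment[of "\<lambda>n. ?b n * z ^ n" m] by (simp add: sums_iff)
    also have "norm \<dots> \<le> (\<Sum>n. \<bar>z\<bar> ^ m * (\<bar>?b (n + m)\<bar> * (1/2) ^ n))"
    proof (rule norm_suminf_le)
      show "summable (\<lambda>n. \<bar>z\<bar> ^ m * (\<bar>?b (n + m)\<bar> * (1/2) ^ n))" by (rule summable_mult[OF sB])
      fix n
      have "\<bar>z\<bar> ^ n \<le> (1/2) ^ n" using z by (intro power_mono) auto
      then have "\<bar>z\<bar> ^ m * (\<bar>?b (n + m)\<bar> * \<bar>z\<bar> ^ n) \<le> \<bar>z\<bar> ^ m * (\<bar>?b (n + m)\<bar> * (1/2) ^ n)"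
        by (intro mult_left_mono) auto
      then show "norm (?b (n + m) * z ^ (n + m)) \<le> \<bar>z\<bar> ^ m * (\<bar>?b (n + m)\<bar> * (1/2) ^ n)"
        by (simp add: abs_mult power_add power_abs mult_ac)
    qed
    also have "\<dots> = \<bar>z\<bar> ^ m * B" unfolding B_def by (rule suminf_mult[OF sB])
    finally show ?thesis by (simp add: mult.commute)
  qed
  ultimately show ?thesis using that by blast
qed

lemma nn_integral_powr_tail:
  fixes R \<tau> :: real
  assumes "R > 0" "\<tau> > 0"
  shows "(\<integral>\<^sup>+ y. ennreal (y powr (- \<tau> - 1)) * indicator {R..} y \<partial>lborel) = ennreal (R powr (- \<tau>) / \<tau>)"
proof -
  have "(\<integral>\<^sup>+ y. ennreal (y powr (- \<tau> - 1)) * indicator {R..} y \<partial>lborel) = ennreal (0 - (- (R powr (- \<tau>) / \<tau>)))"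
  proof (rule nn_integral_FTC_atLeast[where F="\<lambda>y. - (y powr (- \<tau>) / \<tau>)"])
    fix y assume "R \<le> y"
    then have "y > 0" using assms by simp
    then show "((\<lambda>y. - (y powr (- \<tau>) / \<tau>)) has_real_derivative y powr (- \<tau> - 1)) (at y)"
      using assms by (auto intro!: derivative_eq_intros)
  next
    have "((\<lambda>y. - (y powr (- \<tau>) / \<tau>)) \<longlongrightarrow> - (0 / \<tau>)) at_top"
      using assms by (intro tendsto_intros tendsto_neg_powr filterlim_ident) auto
    then show "((\<lambda>y. - (y powr (- \<tau>) / \<tau>)) \<longlongrightarrow> 0) at_top" by simp
  qed auto
  then show ?thesis by simp
qed

text \<open>
  In the application \<open>c = H - 1 / \<alpha>\<close>, and the assumption \<open>decay\<close> is \<open>H < L + 1\<close>.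
\<close>

locale increment_kernel =
  fixes \<alpha> c :: real and K L :: nat and a :: "nat \<Rightarrow> real"
  assumes alpha: "0 < \<alpha>" "\<alpha> \<le> 2" and c: "c < 1" "c \<noteq> 0"
    and decay: "0 < \<alpha> * (real L + 1 - c) - 1"
    and moments: "\<And>q. q \<le> L \<Longrightarrow> (\<Sum>k=0..K. real k ^ q * a k) = 0"
    and moment_nz: "(\<Sum>k=0..K. real k ^ (L + 1) * a k) \<noteq> 0"
begin

definition g :: "real \<Rightarrow> real" where
  "g y = (\<Sum>k=0..K. a k * \<bar>real k - y\<bar> powr c)"

definition \<tau> :: real where "\<tau> = \<alpha> * (real L + 1 - c) - 1"

lemma \<tau>_pos: "\<tau> > 0" using decay by (simp add: \<tau>_def)

lemma g_measurable [measurable]: "g \<in> borel_measurable borel"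
  unfolding g_def[abs_def] by measurable

text \<open>
  Writing \<open>\<bar>k - y\<bar>\<^sup>c = \<bar>y\<bar>\<^sup>c (1 - k / y)\<^sup>c\<close>, which is valid for both signs of \<open>y\<close>, and expanding the last factor, the
  coefficients \<open>a\<close> enter only through their moments.
\<close>

lemma g_expansion:
  obtains B where "0 \<le> B"
    "\<And>y. y \<noteq> 0 \<Longrightarrow> 2 * real K \<le> \<bar>y\<bar> \<Longrightarrow>
      \<bar>g y - \<bar>y\<bar> powr c * (\<Sum>q<m. (c gchoose q) * (- 1 / y) ^ q * (\<Sum>k=0..K. real k ^ q * a k))\<bar>
        \<le> B * \<bar>y\<bar> powr (c - real m)"
proof -
  obtain B where B: "0 \<le> B"
    "\<And>z. \<bar>z\<bar> \<le> 1/2 \<Longrightarrow> \<bar>(1 + z) powr c - (\<Sum>q<m. (c gchoose q) * z ^ q)\<bar> \<le> B * \<bar>z\<bar> ^ m"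
    using binomial_remainder[of c m] by blast
  define D where "D = B * (\<Sum>k=0..K. \<bar>a k\<bar> * real k ^ m)"
  have "0 \<le> D" unfolding D_def using B by (intro mult_nonneg_nonneg sum_nonneg) auto
  moreover have "\<bar>g y - \<bar>y\<bar> powr c * (\<Sum>q<m. (c gchoose q) * (- 1 / y) ^ q * (\<Sum>k=0..K. real k ^ q * a k))\<bar>
        \<le> D * \<bar>y\<bar> powr (c - real m)" if y: "y \<noteq> 0" "2 * real K \<le> \<bar>y\<bar>" for y
  proof -
    let ?rem = "\<lambda>z. (1 + z) powr c - (\<Sum>q<m. (c gchoose q) * z ^ q)"
    have z: "\<bar>- real k / y\<bar> \<le> 1/2" if "k \<le> K" for k
      using that y by (simp add: field_simps)
    have tm: "\<bar>real k - y\<bar> powr c = \<bar>y\<bar> powr c * (1 + (- real k / y)) powr c" if "k \<le> K" for k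
    proof -
      have "real k - y = - y * (1 + (- real k / y))" using y by (simp add: field_simps)
      moreover have "0 \<le> 1 + (- real k / y)" using z[OF that] by linarith
      ultimately have "\<bar>real k - y\<bar> = \<bar>y\<bar> * (1 + (- real k / y))" by (simp only: abs_mult abs_minus_cancel abs_of_nonneg)
      then show ?thesis using \<open>0 \<le> 1 + (- real k / y)\<close> by (simp only: powr_mult abs_ge_zero)
    qed
    have "g y = \<bar>y\<bar> powr c * (\<Sum>k=0..K. a k * (1 + (- real k / y)) powr c)"
      unfolding g_def by (simp add: tm sum_distrib_left mult_ac del: minus_divide_left)
    moreover have "(\<Sum>q<m. (c gchoose q) * (- 1 / y) ^ q * (\<Sum>k=0..K. real k ^ q * a k))
       = (\<Sum>k=0..K. a k * (\<Sum>q<m. (c gchoose q) * (- real k / y) ^ q))"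
    proof -
      have pw: "(- real k / y) ^ q = (- 1 / y) ^ q * real k ^ q" for k q
        by (simp add: power_mult_distrib[symmetric])
      show ?thesis
        unfolding pw sum_distrib_left by (subst sum.swap) (simp add: mult_ac)
    qed
    ultimately have eq: "g y - \<bar>y\<bar> powr c * (\<Sum>q<m. (c gchoose q) * (- 1 / y) ^ q * (\<Sum>k=0..K. real k ^ q * a k))
       = \<bar>y\<bar> powr c * (\<Sum>k=0..K. a k * ?rem (- real k / y))"
      by (simp add: right_diff_distrib sum_subtractf)
    have "\<bar>g y - \<bar>y\<bar> powr c * (\<Sum>q<m. (c gchoose q) * (- 1 / y) ^ q * (\<Sum>k=0..K. real k ^ q * a k))\<bar>
        = \<bar>y\<bar> powr c * \<bar>\<Sum>k=0..K. a k * ?rem (- real k / y)\<bar>"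
      unfolding eq by (simp only: abs_mult abs_of_nonneg[OF powr_ge_zero])
    also have "\<dots> \<le> \<bar>y\<bar> powr c * (\<Sum>k=0..K. \<bar>a k\<bar> * (B * (real k ^ m / \<bar>y\<bar> ^ m)))"
    proof (rule mult_left_mono)
      have "\<bar>\<Sum>k=0..K. a k * ?rem (- real k / y)\<bar> \<le> (\<Sum>k=0..K. \<bar>a k * ?rem (- real k / y)\<bar>)"
        by (rule sum_abs[of "\<lambda>k. a k * ?rem (- real k / y)" "{0..K}"])
      also have "\<dots> \<le> (\<Sum>k=0..K. \<bar>a k\<bar> * (B * (real k ^ m / \<bar>y\<bar> ^ m)))"
      proof (rule sum_mono)
        fix k assume "k \<in> {0..K}"
        then have "\<bar>?rem (- real k / y)\<bar> \<le> B * \<bar>- real k / y\<bar> ^ m" by (intro B z) auto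
        also have "\<bar>- real k / y\<bar> ^ m = real k ^ m / \<bar>y\<bar> ^ m" by (simp add: power_divide)
        finally show "\<bar>a k * ?rem (- real k / y)\<bar> \<le> \<bar>a k\<bar> * (B * (real k ^ m / \<bar>y\<bar> ^ m))"
          unfolding abs_mult by (intro mult_left_mono) auto
      qed
      finally show "\<bar>\<Sum>k=0..K. a k * ?rem (- real k / y)\<bar> \<le> (\<Sum>k=0..K. \<bar>a k\<bar> * (B * (real k ^ m / \<bar>y\<bar> ^ m)))" .
    qed auto
    also have "\<dots> = D * (\<bar>y\<bar> powr c / \<bar>y\<bar> ^ m)"
      by (simp add: D_def sum_distrib_left sum_distrib_right sum_divide_distrib mult_ac)
    also have "\<bar>y\<bar> powr c / \<bar>y\<bar> ^ m = \<bar>y\<bar> powr (c - real m)"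
      using y by (simp add: powr_diff powr_realpow)
    finally show ?thesis .
  qed
  ultimately show ?thesis using that by blast
qed

lemma g_decay:
  obtains B where "0 \<le> B"
    "\<And>y. y \<noteq> 0 \<Longrightarrow> 2 * real K \<le> \<bar>y\<bar> \<Longrightarrow> \<bar>g y\<bar> \<le> B * \<bar>y\<bar> powr (c - real (L + 1))"
proof -
  obtain B where B: "0 \<le> B"
    "\<And>y. y \<noteq> 0 \<Longrightarrow> 2 * real K \<le> \<bar>y\<bar> \<Longrightarrow>
      \<bar>g y - \<bar>y\<bar> powr c * (\<Sum>q<L+1. (c gchoose q) * (- 1 / y) ^ q * (\<Sum>k=0..K. real k ^ q * a k))\<bar>
        \<le> B * \<bar>y\<bar> powr (c - real (L + 1))"
    using g_expansion[of "L + 1"] by blast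
  have "(\<Sum>q<L+1. (c gchoose q) * (- 1 / y) ^ q * (\<Sum>k=0..K. real k ^ q * a k)) = 0" for y
    by (intro sum.neutral) (simp add: moments)
  then show ?thesis using B that by (simp del: of_nat_add)
qed

text \<open>
  As \<open>c\<close> is nonzero and less than \<open>1\<close>, it is not a natural number.
\<close>

lemma gchoose_nz: "c gchoose m \<noteq> 0"
proof -
  have "c - real i \<noteq> 0" for i using c by (cases i) auto
  then have "(\<Prod>i=0..<m. c - real i) \<noteq> 0" by simp
  then show ?thesis by (simp add: gbinomial_prod_rev)
qed

text \<open>
  The expansion to one more order has the leading term \<open>\<mu> (- 1 / y)\<^sup>L\<^sup>+\<^sup>1 \<bar>y\<bar>\<^sup>c\<close> with \<open>\<mu> \<noteq> 0\<close>, which dominates for large \<open>y\<close>.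
\<close>

lemma g_eventually_nz: obtains R where "\<And>y. R \<le> y \<Longrightarrow> g y \<noteq> 0"
proof -
  obtain B where B: "0 \<le> B"
    "\<And>y. y \<noteq> 0 \<Longrightarrow> 2 * real K \<le> \<bar>y\<bar> \<Longrightarrow>
      \<bar>g y - \<bar>y\<bar> powr c * (\<Sum>q<L+2. (c gchoose q) * (- 1 / y) ^ q * (\<Sum>k=0..K. real k ^ q * a k))\<bar>
        \<le> B * \<bar>y\<bar> powr (c - real (L + 2))"
    using g_expansion[of "L + 2"] by blast
  define \<mu> where "\<mu> = (c gchoose (L + 1)) * (\<Sum>k=0..K. real k ^ (L + 1) * a k)"
  have \<mu>: "\<mu> \<noteq> 0" using gchoose_nz moment_nz by (simp add: \<mu>_def)
  have "g y \<noteq> 0" if y: "2 * real K + 1 + (B + 1) / \<bar>\<mu>\<bar> \<le> y" for y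
  proof
    assume "g y = 0"
    have q: "0 \<le> (B + 1) / \<bar>\<mu>\<bar>" using B by simp
    have y1: "y > 0" "2 * real K \<le> y" "(B + 1) / \<bar>\<mu>\<bar> \<le> y" using y q by linarith+
    have "(\<Sum>q<L+1. (c gchoose q) * (- 1 / y) ^ q * (\<Sum>k=0..K. real k ^ q * a k)) = 0"
      by (intro sum.neutral) (simp add: moments)
    then have "(\<Sum>q<L+2. (c gchoose q) * (- 1 / y) ^ q * (\<Sum>k=0..K. real k ^ q * a k)) = \<mu> * (- 1 / y) ^ (L + 1)"
      by (simp add: \<mu>_def)
    with B(2)[of y] y1 \<open>g y = 0\<close>
    have "y powr c * (\<bar>\<mu>\<bar> * (1 / y) ^ (L + 1)) \<le> B * y powr (c - real (L + 2))"
      by (simp add: abs_mult power_abs del: of_nat_add power_Suc)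
    also have "y powr (c - real (L + 2)) = y powr c * (1 / y) ^ (L + 1) / y"
      using y1 by (simp add: powr_diff powr_add power_divide powr_realpow power2_eq_square field_simps)
    finally have le: "(y powr c * (1 / y) ^ (L + 1)) * \<bar>\<mu>\<bar> \<le> (y powr c * (1 / y) ^ (L + 1)) * (B / y)"
      by (simp add: mult_ac)
    have "0 < y powr c * (1 / y) ^ (L + 1)" using y1 by simp
    from mult_left_le_imp_le[OF le this] have "\<bar>\<mu>\<bar> \<le> B / y" .
    then have "\<bar>\<mu>\<bar> * y \<le> B" using y1 by (simp add: field_simps)
    moreover have "B + 1 \<le> \<bar>\<mu>\<bar> * y" using y1(3) \<mu> by (simp add: field_simps)
    ultimately show False by simp
  qed
  then show ?thesis using that by blast
qed

end

locale integrable_increment_kernel = increment_kernel +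
  assumes g_int: "integrable lborel (\<lambda>y. \<bar>g y\<bar> powr \<alpha>)"
begin

text \<open>
  The characteristic function of every normalised increment at \<open>u\<close> is \<open>exp (- S \<bar>u\<bar>\<^sup>\<alpha>)\<close>.
\<close>

definition S :: real where "S = (\<integral>y. \<bar>g y\<bar> powr \<alpha> \<partial>lborel)"

text \<open>
  This makes the increments nondegenerate: a kernel vanishing almost everywhere would contradict its
  behaviour at infinity.
\<close>

lemma S_pos: "S > 0"
proof -
  have "0 \<le> S" by (simp add: S_def)
  moreover have "S \<noteq> 0"
  proof
    assume "S = 0"
    then have "AE y in lborel. \<bar>g y\<bar> powr \<alpha> = 0"
      using integral_nonneg_eq_0_iff_AE[OF g_int] by (simp add: S_def)
    obtain R where R: "\<And>y. R \<le> y \<Longrightarrow> g y \<noteq> 0" using g_eventually_nz by blast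
    have "AE y in lborel. y \<notin> {R..R + 1}"
      using \<open>AE y in lborel. \<bar>g y\<bar> powr \<alpha> = 0\<close> by eventually_elim (use R in auto)
    then have "emeasure lborel {R..R + 1} = 0"
      by (subst (asm) AE_iff_measurable[of "{R..R+1}"]) auto
    then show False by simp
  qed
  ultimately show ?thesis by simp
qed

lemma g_shift_int:
  shows "integrable lborel (\<lambda>y. \<bar>g (y - d)\<bar> powr \<alpha>)"
    and "(\<integral>y. \<bar>g (y - d)\<bar> powr \<alpha> \<partial>lborel) = S"
proof -
  show "integrable lborel (\<lambda>y. \<bar>g (y - d)\<bar> powr \<alpha>)"
    using lborel_integrable_real_affine[OF g_int, of 1 "- d"] by simp
  show "(\<integral>y. \<bar>g (y - d)\<bar> powr \<alpha> \<partial>lborel) = S"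
    using lborel_integral_real_affine[of 1 "\<lambda>y. \<bar>g y\<bar> powr \<alpha>" "- d"] by (simp add: S_def)
qed

definition overlap :: "real \<Rightarrow> real" where
  "overlap d = (\<integral>y. \<bar>g y\<bar> powr (\<alpha>/2) * \<bar>g (y - d)\<bar> powr (\<alpha>/2) \<partial>lborel)"

definition tail :: "real \<Rightarrow> real" where
  "tail R = (\<integral>y. \<bar>g y * indicator {y. R \<le> \<bar>y\<bar>} y\<bar> powr \<alpha> \<partial>lborel)"

lemma ind_powr: "\<bar>x * indicator A y\<bar> powr \<alpha> = indicator A y * \<bar>x\<bar> powr \<alpha>" for x :: real
  by (simp add: indicator_def)

lemma tail_int: "integrable lborel (\<lambda>y. \<bar>g y * indicator {y. R \<le> \<bar>y\<bar>} y\<bar> powr \<alpha>)"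
  unfolding ind_powr using integrable_mult_indicator[OF _ g_int, of "{y. R \<le> \<bar>y\<bar>}"] by simp

lemma tail_le:
  obtains B where "0 \<le> B" "\<And>R. 0 < R \<Longrightarrow> 2 * real K \<le> R \<Longrightarrow> tail R \<le> B * R powr (- \<tau>)"
proof -
  obtain B where B: "0 \<le> B"
    "\<And>y. y \<noteq> 0 \<Longrightarrow> 2 * real K \<le> \<bar>y\<bar> \<Longrightarrow> \<bar>g y\<bar> \<le> B * \<bar>y\<bar> powr (c - real (L + 1))"
    using g_decay by blast
  define D where "D = B powr \<alpha>"
  have "tail R \<le> (2 * D / \<tau>) * R powr (- \<tau>)" if R: "0 < R" "2 * real K \<le> R" for R
  proof -
    let ?f = "\<lambda>y. ennreal D * (ennreal (y powr (- \<tau> - 1)) * indicator {R..} y)"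
    have "ennreal (tail R) = (\<integral>\<^sup>+ y. ennreal (\<bar>g y * indicator {y. R \<le> \<bar>y\<bar>} y\<bar> powr \<alpha>) \<partial>lborel)"
      unfolding tail_def by (intro nn_integral_eq_integral[symmetric] tail_int) auto
    also have "\<dots> \<le> (\<integral>\<^sup>+ y. ?f y + ?f (- y) \<partial>lborel)"
    proof (rule nn_integral_mono)
      fix y
      show "ennreal (\<bar>g y * indicator {y. R \<le> \<bar>y\<bar>} y\<bar> powr \<alpha>) \<le> ?f y + ?f (- y)"
      proof (cases "R \<le> \<bar>y\<bar>")
        case True
        then have "\<bar>g y\<bar> \<le> B * \<bar>y\<bar> powr (c - real (L + 1))" using R by (intro B) auto
        then have "\<bar>g y\<bar> powr \<alpha> \<le> (B * \<bar>y\<bar> powr (c - real (L + 1))) powr \<alpha>"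
          using alpha by (intro powr_mono2) auto
        also have "\<dots> = D * \<bar>y\<bar> powr (- \<tau> - 1)"
          using B by (simp add: powr_mult powr_powr D_def \<tau>_def algebra_simps)
        finally have "ennreal (\<bar>g y\<bar> powr \<alpha>) \<le> ennreal D * ennreal (\<bar>y\<bar> powr (- \<tau> - 1))"
          by (simp add: D_def ennreal_mult[symmetric])
        also have "\<dots> \<le> ?f y + ?f (- y)"
          using True R by (cases "y \<ge> 0") auto
        finally show ?thesis using True by simp
      qed simp
    qed
    also have "\<dots> = (\<integral>\<^sup>+ y. ?f y \<partial>lborel) + (\<integral>\<^sup>+ y. ?f (- y) \<partial>lborel)"
      by (rule nn_integral_add) measurable
    also have "(\<integral>\<^sup>+ y. ?f (- y) \<partial>lborel) = (\<integral>\<^sup>+ y. ?f y \<partial>lborel)"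
      by (subst (2) nn_integral_real_affine[where c="-1" and t=0]) (auto simp: one_ennreal_def[symmetric])
    also have "(\<integral>\<^sup>+ y. ?f y \<partial>lborel) = ennreal D * ennreal (R powr (- \<tau>) / \<tau>)"
      using R \<tau>_pos by (subst nn_integral_cmult) (auto simp: nn_integral_powr_tail)
    also have "ennreal D * ennreal (R powr (- \<tau>) / \<tau>) + ennreal D * ennreal (R powr (- \<tau>) / \<tau>)
        = ennreal ((2 * D / \<tau>) * R powr (- \<tau>))"
      using \<tau>_pos by (simp add: D_def ennreal_mult[symmetric] ennreal_plus[symmetric] del: ennreal_plus)
    finally show ?thesis
      using \<tau>_pos by (subst (asm) ennreal_le_iff) (auto simp: D_def)
  qed
  moreover have "0 \<le> 2 * D / \<tau>" using \<tau>_pos by (simp add: D_def)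
  ultimately show ?thesis using that by blast
qed

lemma overlap_le_S: "overlap d \<le> S"
proof -
  have "overlap d \<le> sqrt S * sqrt S"
    unfolding overlap_def using powr_half_product_integral(2)[OF _ _ g_int g_shift_int(1)[of d]]
    by (simp add: S_def[symmetric] g_shift_int(2))
  then show ?thesis using S_pos by simp
qed

text \<open>
  At every point one of \<open>y\<close> and \<open>y - d\<close> is at least \<open>\<bar>d\<bar> / 2\<close> in absolute value, so one of the two factors may be
  replaced by its tail before the Cauchy-Schwarz inequality is applied.
\<close>

lemma overlap_tail: "overlap d \<le> 2 * (sqrt (tail (\<bar>d\<bar> / 2)) * sqrt S)"
proof -
  let ?R = "\<bar>d\<bar> / 2"
  let ?h = "\<lambda>y. g y * indicator {y. ?R \<le> \<bar>y\<bar>} y"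
  have hm[measurable]: "?h \<in> borel_measurable borel" by measurable
  have h_shift: "integrable lborel (\<lambda>y. \<bar>?h (y - d)\<bar> powr \<alpha>)"
    "(\<integral>y. \<bar>?h (y - d)\<bar> powr \<alpha> \<partial>lborel) = tail ?R"
    using lborel_integrable_real_affine[OF tail_int, of 1 "- d" ?R]
      lborel_integral_real_affine[of 1 "\<lambda>y. \<bar>?h y\<bar> powr \<alpha>" "- d"] by (simp_all add: tail_def)
  have i1: "integrable lborel (\<lambda>y. \<bar>?h y\<bar> powr (\<alpha>/2) * \<bar>g (y - d)\<bar> powr (\<alpha>/2))"
    "(\<integral>y. \<bar>?h y\<bar> powr (\<alpha>/2) * \<bar>g (y - d)\<bar> powr (\<alpha>/2) \<partial>lborel) \<le> sqrt (tail ?R) * sqrt S"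
    using powr_half_product_integral[OF _ _ tail_int g_shift_int(1), of ?R d]
    unfolding tail_def g_shift_int(2) by simp_all
  have i2: "integrable lborel (\<lambda>y. \<bar>g y\<bar> powr (\<alpha>/2) * \<bar>?h (y - d)\<bar> powr (\<alpha>/2))"
    "(\<integral>y. \<bar>g y\<bar> powr (\<alpha>/2) * \<bar>?h (y - d)\<bar> powr (\<alpha>/2) \<partial>lborel) \<le> sqrt S * sqrt (tail ?R)"
    using powr_half_product_integral[OF _ _ g_int h_shift(1)]
    unfolding h_shift(2) S_def[symmetric] by simp_all
  have "overlap d \<le> (\<integral>y. \<bar>?h y\<bar> powr (\<alpha>/2) * \<bar>g (y - d)\<bar> powr (\<alpha>/2)
       + \<bar>g y\<bar> powr (\<alpha>/2) * \<bar>?h (y - d)\<bar> powr (\<alpha>/2) \<partial>lborel)"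
    unfolding overlap_def
  proof (rule integral_mono)
    show "integrable lborel (\<lambda>y. \<bar>g y\<bar> powr (\<alpha>/2) * \<bar>g (y - d)\<bar> powr (\<alpha>/2))"
      by (rule powr_half_product_integral(1)[OF _ _ g_int g_shift_int(1)]) auto
    show "integrable lborel (\<lambda>y. \<bar>?h y\<bar> powr (\<alpha>/2) * \<bar>g (y - d)\<bar> powr (\<alpha>/2)
       + \<bar>g y\<bar> powr (\<alpha>/2) * \<bar>?h (y - d)\<bar> powr (\<alpha>/2))"
      using i1(1) i2(1) by (rule Bochner_Integration.integrable_add)
    fix y
    have "?R \<le> \<bar>y\<bar> \<or> ?R \<le> \<bar>y - d\<bar>" by linarith
    then show "\<bar>g y\<bar> powr (\<alpha>/2) * \<bar>g (y - d)\<bar> powr (\<alpha>/2) \<le> \<bar>?h y\<bar> powr (\<alpha>/2) * \<bar>g (y - d)\<bar> powr (\<alpha>/2)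
       + \<bar>g y\<bar> powr (\<alpha>/2) * \<bar>?h (y - d)\<bar> powr (\<alpha>/2)"
      by auto
  qed
  also have "\<dots> \<le> sqrt (tail ?R) * sqrt S + sqrt S * sqrt (tail ?R)"
    unfolding Bochner_Integration.integral_add[OF i1(1) i2(1)] by (rule add_mono[OF i1(2) i2(2)])
  finally show ?thesis by (simp add: mult.commute)
qed

text \<open>
  Small \<open>d\<close>, for which the tail bound is not available, are covered by the trivial bound \<open>S\<close>; adding \<open>1\<close> to \<open>\<bar>d\<bar>\<close>
  keeps the right-hand side from degenerating at \<open>d = 0\<close>.
\<close>

lemma overlap_decay:
  obtains B where "0 < B" "\<And>d. overlap d \<le> B * (1 + \<bar>d\<bar>) powr (- \<tau> / 2)"
proof -
  obtain D where D: "0 \<le> D" "\<And>R. 0 < R \<Longrightarrow> 2 * real K \<le> R \<Longrightarrow> tail R \<le> D * R powr (- \<tau>)"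
    using tail_le by blast
  define R0 where "R0 = 4 * real K + 1"
  define B1 where "B1 = 2 * (sqrt D * sqrt S) * 4 powr (\<tau> / 2)"
  define B2 where "B2 = S * (1 + R0) powr (\<tau> / 2)"
  have pos: "0 \<le> B1" "0 < B2" "0 < R0" using D S_pos by (auto simp: B1_def B2_def R0_def)
  have "overlap d \<le> (B1 + B2) * (1 + \<bar>d\<bar>) powr (- \<tau> / 2)" for d
  proof (cases "R0 \<le> \<bar>d\<bar>")
    case True
    then have d: "1 \<le> \<bar>d\<bar>" "4 * real K \<le> \<bar>d\<bar>" unfolding R0_def by linarith+
    have "tail (\<bar>d\<bar> / 2) \<le> D * (\<bar>d\<bar> / 2) powr (- \<tau>)" using d by (intro D) auto
    also have "\<dots> \<le> D * ((1 + \<bar>d\<bar>) / 4) powr (- \<tau>)"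
      using d D \<tau>_pos by (intro mult_left_mono powr_mono2') auto
    finally have "sqrt (tail (\<bar>d\<bar> / 2)) \<le> sqrt (D * ((1 + \<bar>d\<bar>) / 4) powr (- \<tau>))" by simp
    also have "\<dots> = sqrt D * ((1 + \<bar>d\<bar>) / 4) powr (- \<tau> / 2)"
      by (simp add: real_sqrt_mult powr_half_sqrt[symmetric] powr_powr)
    also have "((1 + \<bar>d\<bar>) / 4) powr (- \<tau> / 2) = 4 powr (\<tau> / 2) * (1 + \<bar>d\<bar>) powr (- \<tau> / 2)"
      by (simp add: powr_divide powr_minus field_simps)
    finally have "overlap d \<le> 2 * (sqrt D * (4 powr (\<tau> / 2) * (1 + \<bar>d\<bar>) powr (- \<tau> / 2)) * sqrt S)"
      using overlap_tail[of d] S_pos by (smt (verit) mult_right_mono real_sqrt_ge_zero)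
    also have "\<dots> = B1 * (1 + \<bar>d\<bar>) powr (- \<tau> / 2)" by (simp add: B1_def)
    also have "\<dots> \<le> (B1 + B2) * (1 + \<bar>d\<bar>) powr (- \<tau> / 2)" using pos by (intro mult_right_mono) auto
    finally show ?thesis .
  next
    case False
    have "overlap d \<le> S * 1" using overlap_le_S by simp
    also have "1 = (1 + R0) powr (\<tau> / 2) * (1 + R0) powr (- \<tau> / 2)"
      using pos by (simp add: powr_add[symmetric])
    also have "S * \<dots> \<le> S * ((1 + R0) powr (\<tau> / 2) * (1 + \<bar>d\<bar>) powr (- \<tau> / 2))"
      using False S_pos \<tau>_pos by (intro mult_left_mono powr_mono2') auto
    also have "\<dots> = B2 * (1 + \<bar>d\<bar>) powr (- \<tau> / 2)" by (simp add: B2_def)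
    also have "\<dots> \<le> (B1 + B2) * (1 + \<bar>d\<bar>) powr (- \<tau> / 2)" using pos by (intro mult_right_mono) auto
    finally show ?thesis .
  qed
  moreover have "0 < B1 + B2" using pos by simp
  ultimately show ?thesis using that by blast
qed

lemma shifted_overlap:
  "(\<integral>y. \<bar>g (y - p)\<bar> powr (\<alpha>/2) * \<bar>g (y - q)\<bar> powr (\<alpha>/2) \<partial>lborel) = overlap (q - p)"
  using lborel_integral_real_affine[of 1 "\<lambda>y. \<bar>g y\<bar> powr (\<alpha>/2) * \<bar>g (y - (q - p))\<bar> powr (\<alpha>/2)" "- p"]
  by (simp add: overlap_def algebra_simps)

lemma overlap_nonneg: "0 \<le> overlap d" by (simp add: overlap_def)

lemma pair_norm_defect:
  "\<bar>(\<integral>y. \<bar>u * g (y - p) + v * g (y - q)\<bar> powr \<alpha> \<partial>lborel) - S * \<bar>u\<bar> powr \<alpha> - S * \<bar>v\<bar> powr \<alpha>\<bar>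
     \<le> 2 * overlap (q - p) * (\<bar>u\<bar> powr (\<alpha>/2) * \<bar>v\<bar> powr (\<alpha>/2))"
proof -
  have 1: "integrable lborel (\<lambda>y. \<bar>w * g (y - d)\<bar> powr \<alpha>)"
    "(\<integral>y. \<bar>w * g (y - d)\<bar> powr \<alpha> \<partial>lborel) = S * \<bar>w\<bar> powr \<alpha>" for w d
    using g_shift_int[of d] by (simp_all add: abs_mult powr_mult)
  have "(\<integral>y. \<bar>u * g (y - p)\<bar> powr (\<alpha>/2) * \<bar>v * g (y - q)\<bar> powr (\<alpha>/2) \<partial>lborel)
      = (\<integral>y. (\<bar>u\<bar> powr (\<alpha>/2) * \<bar>v\<bar> powr (\<alpha>/2)) * (\<bar>g (y - p)\<bar> powr (\<alpha>/2) * \<bar>g (y - q)\<bar> powr (\<alpha>/2)) \<partial>lborel)"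
    by (simp add: abs_mult powr_mult mult_ac)
  also have "\<dots> = overlap (q - p) * (\<bar>u\<bar> powr (\<alpha>/2) * \<bar>v\<bar> powr (\<alpha>/2))"
    by (simp add: shifted_overlap)
  finally have 2: "(\<integral>y. \<bar>u * g (y - p)\<bar> powr (\<alpha>/2) * \<bar>v * g (y - q)\<bar> powr (\<alpha>/2) \<partial>lborel)
      = overlap (q - p) * (\<bar>u\<bar> powr (\<alpha>/2) * \<bar>v\<bar> powr (\<alpha>/2))" .
  show ?thesis
    using integral_powr_add_defect(2)[OF alpha _ _ 1(1)[of u p] 1(1)[of v q]] unfolding 1(2) 2 by simp
qed

end

section \<open>Mean and variance of the power variations\<close>

lemma sum_powr_le_rate:
  fixes e :: real and n :: nat
  shows "e < 1 \<Longrightarrow> 0 < e \<Longrightarrow> (\<Sum>j<n. (1 + real j) powr (- e)) \<le> real n powr (1 - e) / (1 - e)"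
    and "n \<ge> 1 \<Longrightarrow> (\<Sum>j<n. (1 + real j) powr (- 1)) \<le> 1 + ln (real n)"
    and "e > 1 \<Longrightarrow> (\<Sum>j<n. (1 + real j) powr (- e)) \<le> (\<Sum>j. (1 + real j) powr (- e))"
proof -
  assume e: "e < 1" "0 < e"
  show "(\<Sum>j<n. (1 + real j) powr (- e)) \<le> real n powr (1 - e) / (1 - e)"
  proof (induction n)
    case (Suc n)
    have "(1 + real n) powr (- e) \<le> (real (Suc n) powr (1 - e) - real n powr (1 - e)) / (1 - e)"
    proof (cases "n = 0")
      case True
      then show ?thesis using e by (simp add: field_simps)
    next
      case False
      have "\<exists>z>real n. z < real (Suc n) \<and> real (Suc n) powr (1 - e) - real n powr (1 - e)
          = (real (Suc n) - real n) * ((1 - e) * z powr (1 - e - 1))"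
        using False by (intro MVT2 has_real_derivative_powr) auto
      then obtain z where z: "real n < z" "z < real (Suc n)"
        "real (Suc n) powr (1 - e) - real n powr (1 - e) = (1 - e) * z powr (- e)" by auto
      have "(1 + real n) powr (- e) \<le> z powr (- e)"
        using z e False by (intro powr_mono2') auto
      then show ?thesis unfolding z(3) using e by simp
    qed
    then show ?case using Suc by (simp add: diff_divide_distrib)
  qed simp
next
  assume "n \<ge> 1"
  then show "(\<Sum>j<n. (1 + real j) powr (- 1)) \<le> 1 + ln (real n)"
  proof (induction n rule: dec_induct)
    case (step n)
    have "ln (real n / (real n + 1)) \<le> real n / (real n + 1) - 1"
      using step by (intro ln_le_minus_one) auto
    also have "real n / (real n + 1) - 1 = - ((1 + real n) powr (- 1))"
      by (simp add: powr_minus field_simps)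
    finally have "(1 + real n) powr (- 1) \<le> ln (real n + 1) - ln (real n)"
      using step by (simp add: ln_div)
    then show ?case using step by (simp add: add.commute)
  qed simp
next
  assume e: "e > 1"
  have "summable (\<lambda>n. real n powr (- e))" using e by (simp add: summable_real_powr_iff)
  then have "summable (\<lambda>n. real (Suc n) powr (- e))" by (subst summable_Suc_iff)
  then have "summable (\<lambda>n. (1 + real n) powr (- e))" by simp
  then show "(\<Sum>j<n. (1 + real j) powr (- e)) \<le> (\<Sum>j. (1 + real j) powr (- e))"
    by (rule sum_le_suminf) auto
qed

text \<open>
  Each row of the double sum splits at the diagonal into two pieces of the sum over \<open>j\<close>.
\<close>

lemma double_sum_le:
  fixes f :: "nat \<Rightarrow> real"
  assumes "\<And>j. 0 \<le> f j"
  shows "(\<Sum>p\<le>N. \<Sum>q\<le>N. f (nat \<bar>int q - int p\<bar>)) \<le> 2 * real (N + 1) * (\<Sum>j\<le>N. f j)"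
proof -
  have row: "(\<Sum>q\<le>N. f (nat \<bar>int q - int p\<bar>)) \<le> 2 * (\<Sum>j\<le>N. f j)" if p: "p \<le> N" for p
  proof -
    have "(\<Sum>q\<le>N. f (nat \<bar>int q - int p\<bar>)) = (\<Sum>q\<in>{..p} \<union> {p<..N}. f (nat \<bar>int q - int p\<bar>))"
      using p by (intro sum.cong) auto
    also have "\<dots> = (\<Sum>q\<le>p. f (nat \<bar>int q - int p\<bar>)) + (\<Sum>q\<in>{p<..N}. f (nat \<bar>int q - int p\<bar>))"
      by (rule sum.union_disjoint) auto
    also have "(\<Sum>q\<le>p. f (nat \<bar>int q - int p\<bar>)) = (\<Sum>j\<in>{..p}. f j)"
      by (rule sum.reindex_bij_witness[of _ "\<lambda>j. p - j" "\<lambda>q. p - q"]) (auto intro!: arg_cong[where f=f])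
    also have "\<dots> \<le> (\<Sum>j\<le>N. f j)"
      using p assms by (intro sum_mono2) auto
    also have "(\<Sum>q\<in>{p<..N}. f (nat \<bar>int q - int p\<bar>)) = (\<Sum>j\<in>{0<..N - p}. f j)"
      by (rule sum.reindex_bij_witness[of _ "\<lambda>j. p + j" "\<lambda>q. q - p"]) (use p in \<open>auto intro!: arg_cong[where f=f]\<close>)
    also have "\<dots> \<le> (\<Sum>j\<le>N. f j)"
      using assms by (intro sum_mono2) auto
    finally show ?thesis by simp
  qed
  have "(\<Sum>p\<le>N. \<Sum>q\<le>N. f (nat \<bar>int q - int p\<bar>)) \<le> (\<Sum>p\<le>N. 2 * (\<Sum>j\<le>N. f j))"
    by (intro sum_mono row) auto
  then show ?thesis by (simp add: algebra_simps)
qed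

locale lfsm =
  fixes P :: "'w measure" and M :: "real set \<Rightarrow> 'w \<Rightarrow> real" and X :: "real \<Rightarrow> 'w \<Rightarrow> real"
    and \<alpha> H :: real and K L :: nat and a :: "nat \<Rightarrow> real"
  assumes alpha_range: "0 < \<alpha>" "\<alpha> < 2" and H: "0 < H" "H < 1" "H \<noteq> 1 / \<alpha>"
    and X: "well_balanced_lfsm P H \<alpha> M X"
    and LK: "L \<ge> 1" "K \<ge> 1"
    and moments: "\<And>q. q \<le> L \<Longrightarrow> (\<Sum>k=0..K. real k ^ q * a k) = 0"
    and moment_nz: "(\<Sum>k=0..K. real k ^ (L + 1) * a k) \<noteq> 0"
begin

sublocale stable_measure P \<alpha> M
  using X alpha_range by unfold_locales (auto simp: well_balanced_lfsm_def)

definition c :: real where "c = H - 1 / \<alpha>"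

sublocale increment_kernel \<alpha> c K L a
proof unfold_locales
  show "c < 1" "c \<noteq> 0" using alpha_range H by (auto simp: c_def intro: less_trans[of _ H])
  have "\<alpha> * (real L + 1 - c) - 1 = \<alpha> * (real L + 1 - H)"
    using alpha_range by (simp add: c_def field_simps)
  also have "\<dots> > 0" using alpha_range H LK by (intro mult_pos_pos) auto
  finally show "0 < \<alpha> * (real L + 1 - c) - 1" .
qed (use alpha_range moments moment_nz in auto)

lemma increment_integral:
  assumes "n > 0"
  shows "is_stable_integral P \<alpha> M (\<lambda>x. \<Sum>k=0..K. a k * \<bar>real (k + p) / real n - x\<bar> powr c) (increment K a X p n)"
proof -
  have "is_stable_integral P \<alpha> M
     (\<lambda>x. \<Sum>k=0..K. a k * (\<bar>real (k + p) / real n - x\<bar> powr (H - 1 / \<alpha>) - \<bar>x\<bar> powr (H - 1 / \<alpha>)))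
     (\<lambda>\<omega>. \<Sum>k=0..K. a k * X (real (k + p) / real n) \<omega>)"
    using X unfolding well_balanced_lfsm_def by (intro stable_integral_sum) auto
  moreover have "(\<Sum>k=0..K. a k * (\<bar>real (k + p) / real n - x\<bar> powr (H - 1 / \<alpha>) - \<bar>x\<bar> powr (H - 1 / \<alpha>)))
      = (\<Sum>k=0..K. a k * \<bar>real (k + p) / real n - x\<bar> powr c)" for x
    using moments[of 0]
    by (simp add: right_diff_distrib sum_subtractf sum_distrib_right[symmetric] c_def)
  ultimately show ?thesis by (simp add: increment_def[abs_def])
qed

sublocale integrable_increment_kernel \<alpha> c K L a
proof
  \<comment> \<open>The kernel is the integrand of the increment with \<open>n = 1\<close> and \<open>p = 0\<close>, and integrands are in \<open>L\<^sup>\<alpha>\<close>.\<close>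
  have "(\<lambda>x. \<Sum>k=0..K. a k * \<bar>real (k + 0) / real 1 - x\<bar> powr c) = g"
    by (auto simp: g_def)
  then have "is_stable_integral P \<alpha> M g (increment K a X 0 1)"
    using increment_integral[of 1 0] by (simp only: zero_less_one)
  then show "integrable lborel (\<lambda>y. \<bar>g y\<bar> powr \<alpha>)" by (rule stable_integral_char(1))
qed

lemma increment_measurable: "n > 0 \<Longrightarrow> increment K a X p n \<in> borel_measurable P"
  using stable_integral_measurable(1)[OF increment_integral] .

text \<open>
  The substitution \<open>x = y / n\<close> contributes \<open>n\<^sup>-\<^sup>1\<close>, and the factors \<open>n\<^sup>H\<close> and \<open>n\<^sup>-\<^sup>c\<close> contribute
  \<open>n\<^sup>\<alpha>\<^sup>(\<^sup>H\<^sup>-\<^sup>c\<^sup>) = n\<close>; they cancel, so that the joint law does not depend on \<open>n\<close>.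
\<close>

lemma increment_pair_char:
  assumes n: "n > 0"
  shows "(CLINT \<omega>|P. iexp (u * (real n powr H * increment K a X p n \<omega>) + v * (real n powr H * increment K a X q n \<omega>)))
    = complex_of_real (exp (- (\<integral>y. \<bar>u * g (y - real p) + v * g (y - real q)\<bar> powr \<alpha> \<partial>lborel)))"
proof -
  let ?f = "\<lambda>p x. \<Sum>k=0..K. a k * \<bar>real (k + p) / real n - x\<bar> powr c"
  let ?u = "u * real n powr H" and ?v = "v * real n powr H"
  let ?Y = "\<lambda>\<omega>. ?u * increment K a X p n \<omega> + ?v * increment K a X q n \<omega>"
  have I: "is_stable_integral P \<alpha> M (\<lambda>x. ?u * ?f p x + ?v * ?f q x) ?Y"
    by (intro stable_integral_linear increment_integral n)
  have cf1: "(CLINT \<omega>|P. iexp (u * (real n powr H * increment K a X p n \<omega>) + v * (real n powr H * increment K a X q n \<omega>)))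
     = char (distr P borel ?Y) 1"
  proof -
    have "char (distr P borel ?Y) 1 = (CLINT \<omega>|P. iexp (1 * ?Y \<omega>))"
      unfolding char_def by (rule integral_distr[OF stable_integral_measurable(1)[OF I]]) simp
    then show ?thesis by (simp only: mult_1 mult.assoc)
  qed
  have cf2: "char (distr P borel ?Y) 1 = exp (- (\<integral>x. \<bar>?u * ?f p x + ?v * ?f q x\<bar> powr \<alpha> \<partial>lborel))"
    using stable_integral_char(2)[OF I, of 1] by (simp only: abs_one powr_one_eq_one mult_1)
  have s1: "(\<integral>x. \<bar>?u * ?f p x + ?v * ?f q x\<bar> powr \<alpha> \<partial>lborel)
     = (1 / real n) * (\<integral>y. \<bar>?u * ?f p (y / real n) + ?v * ?f q (y / real n)\<bar> powr \<alpha> \<partial>lborel)"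
  proof -
    have "(\<integral>x. F x \<partial>lborel) = (1 / real n) * (\<integral>y. F (y / real n) \<partial>lborel)" for F :: "real \<Rightarrow> real"
      using n lborel_integral_real_affine[of "1 / real n" F 0] by simp
    then show ?thesis .
  qed
  have s2: "(\<integral>y. \<bar>?u * ?f p (y / real n) + ?v * ?f q (y / real n)\<bar> powr \<alpha> \<partial>lborel)
     = (\<integral>y. real n * \<bar>u * g (y - real p) + v * g (y - real q)\<bar> powr \<alpha> \<partial>lborel)"
  proof (rule Bochner_Integration.integral_cong[OF refl])
    fix y
    have f: "?f p (y / real n) = real n powr (- c) * g (y - real p)" for p
    proof -
      have "\<bar>real (k + p) / real n - y / real n\<bar> powr c = real n powr (- c) * \<bar>real k - (y - real p)\<bar> powr c" for k
      proof -
        have "\<bar>real (k + p) / real n - y / real n\<bar> = \<bar>real k - (y - real p)\<bar> / real n"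
          by (simp add: diff_divide_distrib[symmetric] algebra_simps)
        then show ?thesis by (simp add: powr_divide powr_minus field_simps)
      qed
      then show ?thesis by (simp add: g_def sum_distrib_left mult_ac)
    qed
    have "?u * ?f p (y / real n) + ?v * ?f q (y / real n)
       = (real n powr H * real n powr (- c)) * (u * g (y - real p) + v * g (y - real q))"
      unfolding f by (simp add: algebra_simps)
    also have "real n powr H * real n powr (- c) = real n powr (1 / \<alpha>)"
      by (simp add: powr_add[symmetric] c_def)
    finally have "\<bar>?u * ?f p (y / real n) + ?v * ?f q (y / real n)\<bar> powr \<alpha>
       = (real n powr (1 / \<alpha>)) powr \<alpha> * \<bar>u * g (y - real p) + v * g (y - real q)\<bar> powr \<alpha>"
      by (simp add: abs_mult powr_mult)
    also have "(real n powr (1 / \<alpha>)) powr \<alpha> = real n" using alpha_range by (simp add: powr_powr)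
    finally show "\<bar>?u * ?f p (y / real n) + ?v * ?f q (y / real n)\<bar> powr \<alpha>
       = real n * \<bar>u * g (y - real p) + v * g (y - real q)\<bar> powr \<alpha>" .
  qed
  have s3: "(1 / real n) * (\<integral>y. real n * \<bar>u * g (y - real p) + v * g (y - real q)\<bar> powr \<alpha> \<partial>lborel)
     = (\<integral>y. \<bar>u * g (y - real p) + v * g (y - real q)\<bar> powr \<alpha> \<partial>lborel)"
    using n by simp
  show ?thesis unfolding cf1 cf2 s1 s2 s3 ..
qed

definition Z :: "real \<Rightarrow> nat \<Rightarrow> nat \<Rightarrow> 'w \<Rightarrow> real" where
  "Z s n p \<omega> = \<bar>real n powr H * increment K a X p n \<omega>\<bar> powr (- s)"

definition mean :: "real \<Rightarrow> real" where "mean s = neg_moment s S \<alpha>"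

lemma mean_pos: "0 < s \<Longrightarrow> s < 1 \<Longrightarrow> 0 < mean s"
  using S_pos alpha_range by (simp add: mean_def neg_moment_pos)

lemma Z_measurable: "n > 0 \<Longrightarrow> Z s n p \<in> borel_measurable P"
  using increment_measurable[of n p] unfolding Z_def[abs_def] by measurable

lemma Z_mean:
  assumes n: "n > 0" and s: "0 < s" "s < 1/2"
  shows "integrable P (Z s n p)" "expectation (Z s n p) = mean s"
proof -
  have cf: "(CLINT \<omega>|P. iexp (u * (real n powr H * increment K a X p n \<omega>))) = complex_of_real (exp (- (S * \<bar>u\<bar> powr \<alpha>)))" for u
  proof -
    have "(\<integral>y. \<bar>u * g (y - real p)\<bar> powr \<alpha> \<partial>lborel) = S * \<bar>u\<bar> powr \<alpha>"
      using g_shift_int(2) by (simp add: abs_mult powr_mult)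
    then show ?thesis using increment_pair_char[OF n, of u p 0 p] by simp
  qed
  have m: "(\<lambda>\<omega>. real n powr H * increment K a X p n \<omega>) \<in> borel_measurable P"
    using increment_measurable[OF n] by measurable
  show "integrable P (Z s n p)" "expectation (Z s n p) = mean s"
    using neg_moment[OF m cf S_pos alpha_range(1), of s] s by (auto simp: Z_def[abs_def] mean_def)
qed

lemma Z_pair:
  assumes n: "n > 0" and s: "0 < s" "s < 1/2"
  shows "integrable P (\<lambda>\<omega>. Z s n p \<omega> * Z s n q \<omega>)"
    "\<bar>expectation (\<lambda>\<omega>. Z s n p \<omega> * Z s n q \<omega>) - (mean s)\<^sup>2\<bar> \<le> cov_const s S \<alpha> * overlap (real q - real p)"
proof -
  have m: "(\<lambda>\<omega>. real n powr H * increment K a X p n \<omega>) \<in> borel_measurable P" for p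
    using increment_measurable[OF n] by measurable
  note pair = neg_moment_pair[OF m m increment_pair_char[OF n] pair_norm_defect S_pos alpha_range(1)
      overlap_nonneg s]
  show "integrable P (\<lambda>\<omega>. Z s n p \<omega> * Z s n q \<omega>)"
    "\<bar>expectation (\<lambda>\<omega>. Z s n p \<omega> * Z s n q \<omega>) - (mean s)\<^sup>2\<bar> \<le> cov_const s S \<alpha> * overlap (real q - real p)"
    unfolding Z_def mean_def by (rule pair)+
qed

definition W :: "real \<Rightarrow> nat \<Rightarrow> 'w \<Rightarrow> real" where
  "W s n = scaled_variation H K a X (- s) n"

lemma W_eq:
  assumes "K \<le> n" "n > 0"
  shows "W s n \<omega> = (\<Sum>p\<le>n - K. Z s n p \<omega>) / real (n - K + 1)"
proof -
  have Z: "Z s n p \<omega> = real n powr (- s * H) * \<bar>increment K a X p n \<omega>\<bar> powr (- s)" for p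
    unfolding Z_def by (simp add: abs_mult powr_mult powr_powr mult.commute)
  have N: "real n - real K + 1 = real (n - K + 1)" using assms by simp
  have "A * (1 / N * B) = A * B / N" for A B N :: real by simp
  then show ?thesis
    unfolding W_def scaled_variation_def power_variation_def N Z atLeast0AtMost sum_distrib_left[symmetric] .
qed

lemma power_variation_measurable: "n > 0 \<Longrightarrow> power_variation K a X \<gamma> n \<in> borel_measurable P"
  using increment_measurable[of n] unfolding power_variation_def[abs_def] by measurable

lemma W_measurable: "n > 0 \<Longrightarrow> W s n \<in> borel_measurable P"
  using power_variation_measurable[of n] unfolding W_def scaled_variation_def[abs_def] by measurable

lemma W_variance:
  assumes n: "K \<le> n" "n > 0" and s: "0 < s" "s < 1/2"
  shows "integrable P (\<lambda>\<omega>. (W s n \<omega> - mean s)\<^sup>2)"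
    and "expectation (\<lambda>\<omega>. (W s n \<omega> - mean s)\<^sup>2)
      \<le> (\<Sum>p\<le>n - K. \<Sum>q\<le>n - K. cov_const s S \<alpha> * overlap (real q - real p)) / (real (n - K + 1))\<^sup>2"
proof -
  define N where "N = real (n - K + 1)"
  have N: "N > 0" by (simp add: N_def)
  define D where "D = (\<lambda>p \<omega>. Z s n p \<omega> - mean s)"
  have DD: "D p \<omega> * D q \<omega> = Z s n p \<omega> * Z s n q \<omega> - mean s * Z s n p \<omega> - mean s * Z s n q \<omega> + (mean s)\<^sup>2" for p q \<omega>
    by (simp add: D_def algebra_simps power2_eq_square)
  note int = Z_mean(1)[OF n(2) s] Z_pair(1)[OF n(2) s]
  have DDi: "integrable P (\<lambda>\<omega>. D p \<omega> * D q \<omega>)" for p q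
    unfolding DD using int by simp
  have DDe: "expectation (\<lambda>\<omega>. D p \<omega> * D q \<omega>) = expectation (\<lambda>\<omega>. Z s n p \<omega> * Z s n q \<omega>) - (mean s)\<^sup>2" for p q
    unfolding DD using int by (simp add: Z_mean(2)[OF n(2) s] prob_space power2_eq_square)
  have "W s n \<omega> - mean s = (\<Sum>p\<le>n - K. D p \<omega>) / N" for \<omega>
    using N by (simp add: W_eq[OF n] D_def sum_subtractf N_def field_simps)
  then have sq: "(W s n \<omega> - mean s)\<^sup>2 = (\<Sum>p\<le>n - K. \<Sum>q\<le>n - K. D p \<omega> * D q \<omega>) / N\<^sup>2" for \<omega>
    by (simp add: power2_eq_square sum_product)
  show "integrable P (\<lambda>\<omega>. (W s n \<omega> - mean s)\<^sup>2)"
    unfolding sq using DDi by simp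
  have "expectation (\<lambda>\<omega>. (W s n \<omega> - mean s)\<^sup>2) = (\<Sum>p\<le>n - K. \<Sum>q\<le>n - K. expectation (\<lambda>\<omega>. D p \<omega> * D q \<omega>)) / N\<^sup>2"
    unfolding sq using DDi by (simp add: Bochner_Integration.integral_sum)
  also have "\<dots> \<le> (\<Sum>p\<le>n - K. \<Sum>q\<le>n - K. cov_const s S \<alpha> * overlap (real q - real p)) / N\<^sup>2"
    unfolding DDe using Z_pair(2)[OF n(2) s]
    by (intro divide_right_mono sum_mono) (auto simp: abs_le_iff)
  finally show "expectation (\<lambda>\<omega>. (W s n \<omega> - mean s)\<^sup>2)
      \<le> (\<Sum>p\<le>n - K. \<Sum>q\<le>n - K. cov_const s S \<alpha> * overlap (real q - real p)) / (real (n - K + 1))\<^sup>2"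
    by (simp add: N_def)
qed

lemma cov_const_nonneg: "0 < s \<Longrightarrow> s < 1/2 \<Longrightarrow> 0 \<le> cov_const s S \<alpha>"
  using S_pos alpha_range neg_moment_pos[of "2 * s" S \<alpha>]
  by (auto simp: cov_const_def intro!: add_nonneg_nonneg divide_nonneg_pos)

lemma \<tau>_eq: "\<tau> = \<alpha> * (real L + 1 - H)"
  unfolding \<tau>_def unfolding c_def using alpha_range by (simp add: field_simps)

lemma sum_le_rate:
  obtains B where "0 < B"
    "\<And>n. 2 \<le> n \<Longrightarrow> (\<Sum>j<n. (1 + real j) powr (- \<tau> / 2)) / real n \<le> B * (rate H \<alpha> L n)\<^sup>2"
proof -
  consider "\<tau> / 2 > 1" | "\<tau> / 2 < 1" | "\<tau> / 2 = 1" by linarith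
  then show ?thesis
  proof cases
    case 1
    then have "H < real L + 1 - 2 / \<alpha>" using alpha_range by (simp add: \<tau>_eq field_simps)
    then have r: "(rate H \<alpha> L n)\<^sup>2 = 1 / real n" if "2 \<le> n" for n
      using that by (simp add: rate_def powr_minus powr_half_sqrt power_inverse inverse_eq_divide power_divide)
    define B where "B = (\<Sum>j. (1 + real j) powr (- (\<tau> / 2))) + 1"
    have "0 \<le> (\<Sum>j<0. (1 + real j) powr (- (\<tau> / 2)))" by simp
    also have "\<dots> \<le> (\<Sum>j. (1 + real j) powr (- (\<tau> / 2)))" by (rule sum_powr_le_rate(3)[OF 1])
    finally have "0 < B" by (simp add: B_def)
    moreover have "(\<Sum>j<n. (1 + real j) powr (- \<tau> / 2)) / real n \<le> B * (rate H \<alpha> L n)\<^sup>2" if "2 \<le> n" for n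
      unfolding r[OF that] using sum_powr_le_rate(3)[OF 1, of n] that
      by (simp add: B_def field_simps)
    ultimately show ?thesis using that by blast
  next
    case 2
    then have *: "H > real L + 1 - 2 / \<alpha>" using alpha_range by (simp add: \<tau>_eq field_simps)
    have r: "(rate H \<alpha> L n)\<^sup>2 = real n powr (- (\<tau> / 2))" if "2 \<le> n" for n
    proof -
      have "(rate H \<alpha> L n)\<^sup>2 = real n powr ((\<alpha> * H - (real L + 1) * \<alpha>) / 4) * real n powr ((\<alpha> * H - (real L + 1) * \<alpha>) / 4)"
        using * by (simp add: rate_def power2_eq_square)
      also have "\<dots> = real n powr (- (\<tau> / 2))"
        unfolding powr_add[symmetric] by (intro arg_cong[where f="\<lambda>x. real n powr x"]) (simp add: \<tau>_eq field_simps)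
      finally show ?thesis .
    qed
    define B where "B = 1 / (1 - \<tau> / 2)"
    have "0 < B" using 2 by (simp add: B_def)
    moreover have "(\<Sum>j<n. (1 + real j) powr (- \<tau> / 2)) / real n \<le> B * (rate H \<alpha> L n)\<^sup>2" if "2 \<le> n" for n
    proof -
      have "(\<Sum>j<n. (1 + real j) powr (- \<tau> / 2)) / real n \<le> (real n powr (1 - \<tau> / 2) / (1 - \<tau> / 2)) / real n"
        using sum_powr_le_rate(1)[OF 2, of n] \<tau>_pos by (intro divide_right_mono) auto
      also have "\<dots> = B * (real n powr (1 - \<tau> / 2) / real n powr 1)" using that by (simp add: B_def)
      also have "real n powr (1 - \<tau> / 2) / real n powr 1 = real n powr (- (\<tau> / 2))"
        unfolding powr_diff[symmetric] by simp
      finally show ?thesis unfolding r[OF that] .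
    qed
    ultimately show ?thesis using that by blast
  next
    case 3
    then have "H = real L + 1 - 2 / \<alpha>" using alpha_range by (simp add: \<tau>_eq field_simps)
    then have r: "(rate H \<alpha> L n)\<^sup>2 = ln (real n) / real n" if "2 \<le> n" for n
      using that by (simp add: rate_def)
    define B where "B = 1 + 1 / ln (2::real)"
    have "0 < B" by (simp add: B_def add_pos_pos)
    moreover have "(\<Sum>j<n. (1 + real j) powr (- \<tau> / 2)) / real n \<le> B * (rate H \<alpha> L n)\<^sup>2" if "2 \<le> n" for n
    proof -
      have "ln 2 \<le> ln (real n)" using that by simp
      then have "1 \<le> ln (real n) / ln 2" by simp
      then have "1 + ln (real n) \<le> B * ln (real n)" by (simp add: B_def algebra_simps)
      moreover have "- \<tau> / 2 = - 1" using 3 by simp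
      ultimately have "(\<Sum>j<n. (1 + real j) powr (- \<tau> / 2)) \<le> B * ln (real n)"
        using sum_powr_le_rate(2)[of n] that by simp
      then have "(\<Sum>j<n. (1 + real j) powr (- \<tau> / 2)) / real n \<le> B * ln (real n) / real n"
        by (rule divide_right_mono) simp
      then show ?thesis unfolding r[OF that] by simp
    qed
    ultimately show ?thesis using that by blast
  qed
qed

theorem W_variance_rate:
  assumes s: "0 < s" "s < 1/2"
  obtains B where "0 < B"
    "\<And>n. K \<le> n \<Longrightarrow> 2 \<le> n \<Longrightarrow> integrable P (\<lambda>\<omega>. (W s n \<omega> - mean s)\<^sup>2)"
    "\<And>n. K \<le> n \<Longrightarrow> 2 \<le> n \<Longrightarrow> expectation (\<lambda>\<omega>. (W s n \<omega> - mean s)\<^sup>2) \<le> B * (rate H \<alpha> L n)\<^sup>2"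
proof -
  obtain B1 where B1: "0 < B1" "\<And>d. overlap d \<le> B1 * (1 + \<bar>d\<bar>) powr (- \<tau> / 2)"
    using overlap_decay by blast
  obtain B2 where B2: "0 < B2"
    "\<And>n. 2 \<le> n \<Longrightarrow> (\<Sum>j<n. (1 + real j) powr (- \<tau> / 2)) / real n \<le> B2 * (rate H \<alpha> L n)\<^sup>2"
    using sum_le_rate by blast
  define C where "C = cov_const s S \<alpha> * B1"
  have C: "0 \<le> C" using cov_const_nonneg[OF s] B1 by (simp add: C_def)
  \<comment> \<open>The factor \<open>2\<close> comes from the two sides of the diagonal, \<open>K\<close> from the number of increments; adding \<open>1\<close> makes \<open>B\<close> positive.\<close>
  define B where "B = 2 * C * real K * B2 + 1"
  have "0 < B" using C B2 by (simp add: B_def add_nonneg_pos)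
  moreover have "expectation (\<lambda>\<omega>. (W s n \<omega> - mean s)\<^sup>2) \<le> B * (rate H \<alpha> L n)\<^sup>2" if n: "K \<le> n" "2 \<le> n" for n
  proof -
    let ?N = "real (n - K + 1)"
    let ?f = "\<lambda>j. C * (1 + real j) powr (- \<tau> / 2)"
    let ?s = "\<Sum>j<n. (1 + real j) powr (- \<tau> / 2)"
    have n0: "n > 0" using n by simp
    have N: "?N > 0" by simp
    \<comment> \<open>The number of increments is at least a fixed fraction of \<open>n\<close>, even for \<open>n = K\<close>.\<close>
    have nN: "real n \<le> real K * ?N"
    proof -
      have "n \<le> K * (n - K + 1)"
      proof -
        have "n = (n - K) + K" using n by simp
        also have "\<dots> \<le> K * (n - K) + K" using LK by simp
        finally show ?thesis by simp
      qed
      then show ?thesis by (metis of_nat_le_iff of_nat_mult)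
    qed
    have "expectation (\<lambda>\<omega>. (W s n \<omega> - mean s)\<^sup>2)
        \<le> (\<Sum>p\<le>n - K. \<Sum>q\<le>n - K. cov_const s S \<alpha> * overlap (real q - real p)) / ?N\<^sup>2"
      by (rule W_variance(2)[OF n(1) n0 s])
    also have "\<dots> \<le> (\<Sum>p\<le>n - K. \<Sum>q\<le>n - K. ?f (nat \<bar>int q - int p\<bar>)) / ?N\<^sup>2"
    proof (intro divide_right_mono sum_mono)
      fix p q
      have "\<bar>real q - real p\<bar> = real (nat \<bar>int q - int p\<bar>)" by simp
      then have "overlap (real q - real p) \<le> B1 * (1 + real (nat \<bar>int q - int p\<bar>)) powr (- \<tau> / 2)"
        using B1(2)[of "real q - real p"] by simp
      then show "cov_const s S \<alpha> * overlap (real q - real p) \<le> ?f (nat \<bar>int q - int p\<bar>)"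
        unfolding C_def mult.assoc using cov_const_nonneg[OF s] by (intro mult_left_mono)
    qed simp
    also have "\<dots> \<le> (2 * ?N * (\<Sum>j\<le>n - K. ?f j)) / ?N\<^sup>2"
      using double_sum_le[of ?f "n - K"] C by (intro divide_right_mono) auto
    also have "\<dots> = 2 * (\<Sum>j\<le>n - K. ?f j) / ?N"
      unfolding power2_eq_square mult.commute[of 2 ?N] mult.assoc
      by (rule mult_divide_mult_cancel_left) (use N in simp)
    also have "\<dots> \<le> 2 * (C * ?s) / ?N"
    proof (intro divide_right_mono mult_left_mono)
      have "(\<Sum>j\<le>n - K. ?f j) \<le> (\<Sum>j<n. ?f j)"
        using n LK C by (intro sum_mono2) auto
      then show "(\<Sum>j\<le>n - K. ?f j) \<le> C * ?s" by (simp add: sum_distrib_left)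
    qed auto
    also have "\<dots> = 2 * C * (?s / ?N)" by simp
    also have "\<dots> \<le> 2 * C * (real K * (?s / real n))"
    proof (rule mult_left_mono)
      have "0 \<le> ?s" by (intro sum_nonneg) simp
      then have "?s * real n \<le> ?s * (real K * ?N)" using nN by (intro mult_left_mono) auto
      then show "?s / ?N \<le> real K * (?s / real n)" using N n0 by (simp add: field_simps)
    qed (use C in simp)
    also have "\<dots> \<le> 2 * C * (real K * (B2 * (rate H \<alpha> L n)\<^sup>2))"
      using B2(2)[OF n(2)] C by (intro mult_left_mono) auto
    also have "\<dots> \<le> B * (rate H \<alpha> L n)\<^sup>2" by (simp add: B_def algebra_simps)
    finally show ?thesis .
  qed
  moreover have "integrable P (\<lambda>\<omega>. (W s n \<omega> - mean s)\<^sup>2)" if "K \<le> n" "2 \<le> n" for n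
    using W_variance(1)[of n s] that s by simp
  ultimately show ?thesis using that by blast
qed

end

section \<open>From variance bounds to rates of convergence\<close>

lemma (in prob_space) tight_single:
  assumes [measurable]: "Y \<in> borel_measurable M" and "\<epsilon> > (0::real)"
  obtains A :: real where "0 < A" "\<And>C. A \<le> C \<Longrightarrow> prob {\<omega> \<in> space M. \<bar>Y \<omega>\<bar> > C} \<le> \<epsilon>"
proof -
  let ?E = "\<lambda>k::nat. {\<omega> \<in> space M. \<bar>Y \<omega>\<bar> > real k}"
  have "decseq ?E" by (rule decseq_SucI) auto
  then have "(\<lambda>k. prob (?E k)) \<longlonglongrightarrow> prob (\<Inter>k. ?E k)"
    by (intro finite_Lim_measure_decseq) auto
  also have "(\<Inter>k. ?E k) = {}"
  proof -
    have "\<exists>k. \<not> \<bar>Y \<omega>\<bar> > real k" for \<omega> using reals_Archimedean2[of "\<bar>Y \<omega>\<bar>"] by (auto simp: not_less intro: less_imp_le)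
    then show ?thesis by auto
  qed
  finally have "eventually (\<lambda>k. prob (?E k) < \<epsilon>) sequentially"
    using assms by (intro order_tendstoD(2)) auto
  then obtain k where k: "prob (?E k) < \<epsilon>" by (auto simp: eventually_sequentially)
  have "prob {\<omega> \<in> space M. \<bar>Y \<omega>\<bar> > C} \<le> \<epsilon>" if "real k + 1 \<le> C" for C
  proof -
    have "prob {\<omega> \<in> space M. \<bar>Y \<omega>\<bar> > C} \<le> prob (?E k)"
      using that by (intro finite_measure_mono) auto
    then show ?thesis using k by simp
  qed
  then show ?thesis using that[of "real k + 1"] by auto
qed

text \<open>
  By Markov's inequality, \<open>D n\<close> exceeds \<open>x\<close> with probability at most \<open>B (b n)\<^sup>2 / x\<^sup>2\<close>. Taking \<open>x\<close> constant gives convergence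
  in probability and makes the event \<open>D n > \<delta>\<close>, on which nothing is known about \<open>T n\<close>, negligible; taking \<open>x\<close>
  proportional to \<open>b n\<close> gives the rate. Boundedness in probability is uniform over all indices, so the
  finitely many small ones are treated one by one.
\<close>

lemma (in prob_space) delta_method:
  fixes T D :: "nat \<Rightarrow> 'a \<Rightarrow> real" and b :: "nat \<Rightarrow> real"
  assumes N: "N \<noteq> {}"
    and T[measurable]: "\<And>n. n \<in> N \<Longrightarrow> T n \<in> borel_measurable M"
    and D[measurable]: "\<And>n. n \<in> N \<Longrightarrow> D n \<in> borel_measurable M"
    and D0: "\<And>n \<omega>. n \<in> N \<Longrightarrow> 0 \<le> D n \<omega>"
    and Dint: "\<And>n. n \<in> N \<Longrightarrow> integrable M (\<lambda>\<omega>. (D n \<omega>)\<^sup>2)"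
    and DB: "\<And>n. n \<in> N \<Longrightarrow> expectation (\<lambda>\<omega>. (D n \<omega>)\<^sup>2) \<le> B * (b n)\<^sup>2"
    and b0: "\<And>n. n \<in> N \<Longrightarrow> 0 < b n" and b: "b \<longlonglongrightarrow> 0"
    and \<delta>: "0 < \<delta>" and C: "0 < C" and B: "0 \<le> B"
    and lip: "\<And>n \<omega>. n \<in> N \<Longrightarrow> D n \<omega> \<le> \<delta> \<Longrightarrow> \<bar>T n \<omega> - \<theta>\<bar> \<le> C * D n \<omega>"
  shows "conv_in_prob M N T (\<lambda>_. \<theta>)" "big_O_prob M N (\<lambda>n \<omega>. T n \<omega> - \<theta>) b"
proof -
  have markov: "prob {\<omega> \<in> space M. D n \<omega> > x} \<le> B * (b n)\<^sup>2 / x\<^sup>2" if n: "n \<in> N" and x: "x > 0" for n x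
  proof -
    note [measurable] = D[OF n]
    have "prob {\<omega> \<in> space M. D n \<omega> > x} \<le> prob {\<omega> \<in> space M. (D n \<omega>)\<^sup>2 \<ge> x\<^sup>2}"
      using x by (intro finite_measure_mono) (auto intro!: power_mono)
    also have "\<dots> \<le> expectation (\<lambda>\<omega>. (D n \<omega>)\<^sup>2) / x\<^sup>2"
      using x by (intro integral_Markov_inequality_measure[where A="space M", OF Dint[OF n]]) auto
    also have "\<dots> \<le> B * (b n)\<^sup>2 / x\<^sup>2"
      using DB[OF n] by (intro divide_right_mono) auto
    finally show ?thesis .
  qed
  have blim: "(\<lambda>n. B * (b n)\<^sup>2 / x\<^sup>2) \<longlonglongrightarrow> 0" for x
  proof -
    have "(\<lambda>n. B * (b n)\<^sup>2 / x\<^sup>2) \<longlonglongrightarrow> B * 0\<^sup>2 / x\<^sup>2"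
      unfolding divide_inverse by (intro tendsto_intros b)
    then show ?thesis by simp
  qed
  have "((\<lambda>n. prob {\<omega> \<in> space M. \<bar>T n \<omega> - \<theta>\<bar> > \<epsilon>}) \<longlongrightarrow> 0) (inf sequentially (principal N))" if \<epsilon>: "\<epsilon> > 0" for \<epsilon>
  proof (rule Lim_null_comparison)
    define \<eta> where "\<eta> = min \<delta> (\<epsilon> / C)"
    have \<eta>: "\<eta> > 0" using \<delta> C \<epsilon> by (simp add: \<eta>_def)
    have "prob {\<omega> \<in> space M. \<bar>T n \<omega> - \<theta>\<bar> > \<epsilon>} \<le> B * (b n)\<^sup>2 / \<eta>\<^sup>2" if n: "n \<in> N" for n
    proof -
      note [measurable] = T[OF n] D[OF n]
      have "D n \<omega> > \<eta>" if "\<bar>T n \<omega> - \<theta>\<bar> > \<epsilon>" for \<omega>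
      proof (rule ccontr)
        assume "\<not> D n \<omega> > \<eta>"
        then have "D n \<omega> \<le> \<delta>" "D n \<omega> \<le> \<epsilon> / C" by (simp_all add: \<eta>_def not_less)
        then have "D n \<omega> \<le> \<delta>" "C * D n \<omega> \<le> \<epsilon>" using C by (simp_all add: pos_le_divide_eq mult.commute)
        then show False using lip[OF n, of \<omega>] that by linarith
      qed
      then have "prob {\<omega> \<in> space M. \<bar>T n \<omega> - \<theta>\<bar> > \<epsilon>} \<le> prob {\<omega> \<in> space M. D n \<omega> > \<eta>}"
        by (intro finite_measure_mono) auto
      then show ?thesis using markov[OF n \<eta>] by linarith
    qed
    then show "\<forall>\<^sub>F n in inf sequentially (principal N). norm (prob {\<omega> \<in> space M. \<bar>T n \<omega> - \<theta>\<bar> > \<epsilon>}) \<le> B * (b n)\<^sup>2 / \<eta>\<^sup>2"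
      by (simp add: eventually_inf_principal)
    show "((\<lambda>n. B * (b n)\<^sup>2 / \<eta>\<^sup>2) \<longlongrightarrow> 0) (inf sequentially (principal N))"
      by (rule tendsto_mono[OF inf_le1 blim])
  qed
  then show "conv_in_prob M N T (\<lambda>_. \<theta>)" using T by (simp add: conv_in_prob_def)
  define R where "R = (\<lambda>n \<omega>. (T n \<omega> - \<theta>) / b n)"
  have R[measurable]: "R n \<in> borel_measurable M" if "n \<in> N" for n
    using T[OF that] unfolding R_def by measurable
  have "\<exists>A>0. (SUP n\<in>N. prob {\<omega> \<in> space M. \<bar>R n \<omega>\<bar> > A}) < \<epsilon>" if \<epsilon>: "\<epsilon> > 0" for \<epsilon> :: real
  proof -
    have "eventually (\<lambda>n. B * (b n)\<^sup>2 / \<delta>\<^sup>2 < \<epsilon> / 4) sequentially"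
      using blim \<epsilon> by (intro order_tendstoD(2)) auto
    then obtain n1 where n1: "\<And>n. n1 \<le> n \<Longrightarrow> B * (b n)\<^sup>2 / \<delta>\<^sup>2 < \<epsilon> / 4"
      by (auto simp: eventually_sequentially)
    \<comment> \<open>With this choice \<open>B C\<^sup>2 / A1\<^sup>2 \<le> \<epsilon> / 4\<close>.\<close>
    define A1 where "A1 = 1 + sqrt (4 * B * C\<^sup>2 / \<epsilon>)"
    have s0: "0 \<le> sqrt (4 * B * C\<^sup>2 / \<epsilon>)" using B \<epsilon> by simp
    have A1: "0 < A1" using s0 by (simp add: A1_def add_pos_nonneg)
    have A1sq: "4 * B * C\<^sup>2 / \<epsilon> \<le> A1\<^sup>2"
    proof -
      have "(sqrt (4 * B * C\<^sup>2 / \<epsilon>))\<^sup>2 \<le> A1\<^sup>2" unfolding A1_def by (intro power_mono s0) simp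
      then show ?thesis using B \<epsilon> by simp
    qed
    have large: "prob {\<omega> \<in> space M. \<bar>R n \<omega>\<bar> > A} \<le> \<epsilon> / 2" if n: "n \<in> N" "n1 \<le> n" and A: "A1 \<le> A" for n A
    proof -
      note [measurable] = R[OF n(1)] D[OF n(1)]
      have bn: "b n > 0" by (rule b0[OF n(1)])
      have x: "A1 * b n / C > 0" using A1 bn C by simp
      have "D n \<omega> > \<delta> \<or> D n \<omega> > A1 * b n / C" if "\<bar>R n \<omega>\<bar> > A" for \<omega>
      proof (rule ccontr)
        assume *: "\<not> (D n \<omega> > \<delta> \<or> D n \<omega> > A1 * b n / C)"
        then have "\<bar>T n \<omega> - \<theta>\<bar> \<le> C * D n \<omega>" using lip[OF n(1)] by auto
        also have "\<dots> \<le> A1 * b n" using * C by (simp add: field_simps)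
        also have "\<dots> \<le> A * b n" using A bn by simp
        finally have "\<bar>R n \<omega>\<bar> \<le> A" using bn by (simp add: R_def field_simps)
        then show False using that by simp
      qed
      then have "prob {\<omega> \<in> space M. \<bar>R n \<omega>\<bar> > A} \<le> prob ({\<omega> \<in> space M. D n \<omega> > \<delta>} \<union> {\<omega> \<in> space M. D n \<omega> > A1 * b n / C})"
        by (intro finite_measure_mono) auto
      also have "\<dots> \<le> prob {\<omega> \<in> space M. D n \<omega> > \<delta>} + prob {\<omega> \<in> space M. D n \<omega> > A1 * b n / C}"
        by (rule measure_Un_le) measurable
      also have "\<dots> \<le> B * (b n)\<^sup>2 / \<delta>\<^sup>2 + B * (b n)\<^sup>2 / (A1 * b n / C)\<^sup>2"
        by (intro add_mono markov n \<delta> x)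
      also have "B * (b n)\<^sup>2 / (A1 * b n / C)\<^sup>2 = B * C\<^sup>2 / A1\<^sup>2"
        using bn C A1 by (simp add: power_mult_distrib power_divide)
      also have "\<dots> \<le> \<epsilon> / 4" using A1sq A1 \<epsilon> by (simp add: field_simps)
      also have "B * (b n)\<^sup>2 / \<delta>\<^sup>2 + \<epsilon> / 4 \<le> \<epsilon> / 2" using n1[OF n(2)] by linarith
      finally show ?thesis by simp
    qed
    have fin: "\<exists>A>0. \<forall>n\<in>N. n < m \<longrightarrow> (\<forall>C\<ge>A. prob {\<omega> \<in> space M. \<bar>R n \<omega>\<bar> > C} \<le> \<epsilon> / 2)" for m
    proof (induction m)
      case 0
      show ?case by (intro exI[of _ 1]) auto
    next
      case (Suc m)
      then obtain A where A: "A > 0" "\<forall>n\<in>N. n < m \<longrightarrow> (\<forall>C\<ge>A. prob {\<omega> \<in> space M. \<bar>R n \<omega>\<bar> > C} \<le> \<epsilon> / 2)" by blast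
      show ?case
      proof (cases "m \<in> N")
        case True
        obtain A' where A': "0 < A'" "\<And>C. A' \<le> C \<Longrightarrow> prob {\<omega> \<in> space M. \<bar>R m \<omega>\<bar> > C} \<le> \<epsilon> / 2"
          using tight_single[OF R[OF True], of "\<epsilon> / 2"] \<epsilon> by auto
        show ?thesis using A A' by (intro exI[of _ "max A A'"]) (auto simp: less_Suc_eq)
      next
        case False
        then show ?thesis using A by (intro exI[of _ A]) (auto simp: less_Suc_eq)
      qed
    qed
    obtain A2 where A2: "A2 > 0" "\<forall>n\<in>N. n < n1 \<longrightarrow> (\<forall>C\<ge>A2. prob {\<omega> \<in> space M. \<bar>R n \<omega>\<bar> > C} \<le> \<epsilon> / 2)"
      using fin[of n1] by (elim exE conjE)
    have "(SUP n\<in>N. prob {\<omega> \<in> space M. \<bar>R n \<omega>\<bar> > max A1 A2}) \<le> \<epsilon> / 2"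
    proof (rule cSUP_least[OF N])
      fix n assume n: "n \<in> N"
      show "prob {\<omega> \<in> space M. \<bar>R n \<omega>\<bar> > max A1 A2} \<le> \<epsilon> / 2"
      proof (cases "n1 \<le> n")
        case True
        show ?thesis by (rule large[OF n True max.cobounded1])
      next
        case False
        then show ?thesis using A2(2)[rule_format, OF n _ max.cobounded2] by simp
      qed
    qed
    then show ?thesis using \<epsilon> A1 by (intro exI[of _ "max A1 A2"]) auto
  qed
  then have "bounded_in_prob M N R" using R by (simp add: bounded_in_prob_def)
  moreover have "\<forall>n\<in>N. \<forall>\<omega>\<in>space M. T n \<omega> - \<theta> = b n * R n \<omega>"
    using b0 by (simp add: R_def less_imp_neq[symmetric])
  ultimately show "big_O_prob M N (\<lambda>n \<omega>. T n \<omega> - \<theta>) b" unfolding big_O_prob_def by blast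
qed

lemma square_sum_le: "(x + y)\<^sup>2 \<le> 2 * x\<^sup>2 + 2 * y\<^sup>2" for x y :: real
proof -
  have "0 \<le> (x - y)\<^sup>2" by simp
  then show ?thesis by (simp add: power2_diff power2_sum)
qed

lemma (in prob_space) delta_method_pair:
  fixes T U V :: "nat \<Rightarrow> 'a \<Rightarrow> real" and b :: "nat \<Rightarrow> real"
  assumes N: "N \<noteq> {}"
    and T: "\<And>n. n \<in> N \<Longrightarrow> T n \<in> borel_measurable M"
    and U: "\<And>n. n \<in> N \<Longrightarrow> U n \<in> borel_measurable M"
      "\<And>n. n \<in> N \<Longrightarrow> integrable M (\<lambda>\<omega>. (U n \<omega> - m)\<^sup>2)"
      "\<And>n. n \<in> N \<Longrightarrow> expectation (\<lambda>\<omega>. (U n \<omega> - m)\<^sup>2) \<le> B * (b n)\<^sup>2"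
    and V: "\<And>n. n \<in> N \<Longrightarrow> V n \<in> borel_measurable M"
      "\<And>n. n \<in> N \<Longrightarrow> integrable M (\<lambda>\<omega>. (V n \<omega> - m')\<^sup>2)"
      "\<And>n. n \<in> N \<Longrightarrow> expectation (\<lambda>\<omega>. (V n \<omega> - m')\<^sup>2) \<le> B' * (b n)\<^sup>2"
    and B: "0 \<le> B" "0 \<le> B'"
    and b0: "\<And>n. n \<in> N \<Longrightarrow> 0 < b n" and b: "b \<longlonglongrightarrow> 0" and \<delta>: "0 < \<delta>" and C: "0 < C"
    and lip: "\<And>n \<omega>. n \<in> N \<Longrightarrow> \<bar>U n \<omega> - m\<bar> + \<bar>V n \<omega> - m'\<bar> \<le> \<delta> \<Longrightarrow>
      \<bar>T n \<omega> - \<theta>\<bar> \<le> C * (\<bar>U n \<omega> - m\<bar> + \<bar>V n \<omega> - m'\<bar>)"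
  shows "conv_in_prob M N T (\<lambda>_. \<theta>)" "big_O_prob M N (\<lambda>n \<omega>. T n \<omega> - \<theta>) b"
proof -
  define D where "D = (\<lambda>n \<omega>. \<bar>U n \<omega> - m\<bar> + \<bar>V n \<omega> - m'\<bar>)"
  have Dm: "D n \<in> borel_measurable M" if "n \<in> N" for n
  proof -
    note [measurable] = U(1)[OF that] V(1)[OF that]
    show ?thesis unfolding D_def by measurable
  qed
  have D2: "(D n \<omega>)\<^sup>2 \<le> 2 * (U n \<omega> - m)\<^sup>2 + 2 * (V n \<omega> - m')\<^sup>2" for n \<omega>
    using square_sum_le[of "\<bar>U n \<omega> - m\<bar>" "\<bar>V n \<omega> - m'\<bar>"] by (simp add: D_def)
  have bound_int: "integrable M (\<lambda>\<omega>. 2 * (U n \<omega> - m)\<^sup>2 + 2 * (V n \<omega> - m')\<^sup>2)" if "n \<in> N" for n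
    using U(2)[OF that] V(2)[OF that] by simp
  have Dint: "integrable M (\<lambda>\<omega>. (D n \<omega>)\<^sup>2)" if "n \<in> N" for n
    by (rule Bochner_Integration.integrable_bound[OF bound_int[OF that]])
      (use Dm[OF that] D2 in \<open>auto intro!: AE_I2\<close>)
  have DB: "expectation (\<lambda>\<omega>. (D n \<omega>)\<^sup>2) \<le> (2 * B + 2 * B') * (b n)\<^sup>2" if n: "n \<in> N" for n
  proof -
    have "expectation (\<lambda>\<omega>. (D n \<omega>)\<^sup>2) \<le> expectation (\<lambda>\<omega>. 2 * (U n \<omega> - m)\<^sup>2 + 2 * (V n \<omega> - m')\<^sup>2)"
      by (intro integral_mono Dint bound_int n D2)
    also have "\<dots> = 2 * expectation (\<lambda>\<omega>. (U n \<omega> - m)\<^sup>2) + 2 * expectation (\<lambda>\<omega>. (V n \<omega> - m')\<^sup>2)"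
      using U(2)[OF n] V(2)[OF n] by simp
    finally show ?thesis using U(3)[OF n] V(3)[OF n] by (simp add: algebra_simps)
  qed
  note dm = delta_method[OF N T Dm _ Dint DB b0 b \<delta> C]
  show "conv_in_prob M N T (\<lambda>_. \<theta>)" "big_O_prob M N (\<lambda>n \<omega>. T n \<omega> - \<theta>) b"
    using dm B lip by (simp_all add: D_def)
qed

lemma ln_lipschitz:
  fixes x m :: real
  assumes "m > 0" "\<bar>x - m\<bar> \<le> m / 2"
  shows "x > 0" "\<bar>ln x - ln m\<bar> \<le> 2 / m * \<bar>x - m\<bar>"
proof -
  show x: "x > 0" using assms by linarith
  have "ln x - ln m = ln (x / m)" using x assms by (simp add: ln_div)
  also have "\<dots> \<le> x / m - 1" using x assms by (intro ln_le_minus_one) auto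
  also have "\<dots> = (x - m) / m" using assms by (simp add: field_simps)
  also have "\<dots> \<le> \<bar>x - m\<bar> / m" using assms by (intro divide_right_mono) auto
  also have "\<dots> \<le> 2 / m * \<bar>x - m\<bar>" using assms by (simp add: field_simps)
  finally have 1: "ln x - ln m \<le> 2 / m * \<bar>x - m\<bar>" .
  have "ln m - ln x = ln (m / x)" using x assms by (simp add: ln_div)
  also have "\<dots> \<le> m / x - 1" using x assms by (intro ln_le_minus_one) auto
  also have "\<dots> = (m - x) / x" using x by (simp add: field_simps)
  also have "\<dots> \<le> \<bar>x - m\<bar> / x" using x by (intro divide_right_mono) auto
  also have "\<dots> \<le> \<bar>x - m\<bar> / (m / 2)"
  proof (rule divide_left_mono)
    show "m / 2 \<le> x" using assms by linarith
  qed (use x assms in auto)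
  also have "\<dots> = 2 / m * \<bar>x - m\<bar>" by simp
  finally show "\<bar>ln x - ln m\<bar> \<le> 2 / m * \<bar>x - m\<bar>" using 1 by (simp add: abs_le_iff)
qed

section \<open>The function whose inverse defines the estimator of the stability index\<close>

lemma has_real_derivative_ln_Gamma:
  "x > 0 \<Longrightarrow> ((\<lambda>x. ln (Gamma x)) has_real_derivative Digamma x) (at (x::real))"
  by (auto intro!: derivative_eq_intros simp: Gamma_eq_zero_iff nonpos_Ints_def)

context
  fixes u v :: real
  assumes uv: "0 < v" "v < u"
begin

lemma h_fun_deriv:
  assumes "x > 0"
  shows "(h_fun u v has_real_derivative (u * v / x\<^sup>2) * (Digamma (1 + u / x) - Digamma (1 + v / x))) (at x)"
    and "(u * v / x\<^sup>2) * (Digamma (1 + u / x) - Digamma (1 + v / x)) > 0"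
proof -
  have d: "((\<lambda>x. ln (Gamma (1 + w / x))) has_real_derivative Digamma (1 + w / x) * (- (w / x\<^sup>2))) (at x)" if "w > 0" for w
    by (rule DERIV_chain2[where f="\<lambda>x. ln (Gamma x)"], rule has_real_derivative_ln_Gamma)
      (use that assms in \<open>auto intro!: derivative_eq_intros add_pos_pos simp: power2_eq_square\<close>)
  show "(h_fun u v has_real_derivative (u * v / x\<^sup>2) * (Digamma (1 + u / x) - Digamma (1 + v / x))) (at x)"
    unfolding h_fun_def[abs_def]
    by (rule DERIV_cong[OF DERIV_diff[OF DERIV_cmult[OF d] DERIV_cmult[OF d]]]) (use uv in \<open>auto simp: algebra_simps\<close>)
  have "Digamma (1 + v / x) < Digamma (1 + u / x)"
    using uv assms by (intro Digamma_real_strict_mono) (auto simp: divide_strict_right_mono intro: add_pos_pos)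
  then show "(u * v / x\<^sup>2) * (Digamma (1 + u / x) - Digamma (1 + v / x)) > 0"
    using uv assms by simp
qed

lemma h_fun_mono: "0 < x \<Longrightarrow> x < y \<Longrightarrow> h_fun u v x < h_fun u v y"
  by (rule DERIV_pos_imp_increasing[of x y]) (use h_fun_deriv less_le_trans in blast)+

lemma h_fun_inj: "inj_on (h_fun u v) {0<..}"
  by (rule linorder_inj_onI') (use h_fun_mono in \<open>force+\<close>)

lemma h_fun_cont: "x > 0 \<Longrightarrow> isCont (h_fun u v) x"
  using h_fun_deriv(1) DERIV_isCont by blast

text \<open>
  The function increases strictly and tends to \<open>0\<close> at infinity.
\<close>

lemma h_fun_neg:
  assumes "x > 0"
  shows "h_fun u v x < 0"
proof -
  have lim: "((\<lambda>y. ln (Gamma (1 + w / y))) \<longlongrightarrow> 0) at_top" for w :: real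
  proof -
    have "((\<lambda>y. w / y) \<longlongrightarrow> 0) at_top" by (rule real_tendsto_divide_at_top[OF tendsto_const filterlim_ident])
    then have "((\<lambda>y. 1 + w / y) \<longlongrightarrow> 1 + 0) at_top" by (intro tendsto_intros)
    then have "((\<lambda>y. 1 + w / y) \<longlongrightarrow> 1) at_top" by simp
    moreover have "isCont (\<lambda>x. ln (Gamma x)) (1 :: real)"
      by (rule DERIV_isCont[OF has_real_derivative_ln_Gamma]) simp
    ultimately have "((\<lambda>y. ln (Gamma (1 + w / y))) \<longlongrightarrow> ln (Gamma 1)) at_top"
      by (rule isCont_tendsto_compose[rotated])
    then show ?thesis by simp
  qed
  have "(h_fun u v \<longlongrightarrow> u * 0 - v * 0) at_top"
    unfolding h_fun_def[abs_def] by (intro tendsto_intros lim)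
  then have "(h_fun u v \<longlongrightarrow> 0) at_top" by simp
  moreover have "eventually (\<lambda>y. h_fun u v (x + 1) \<le> h_fun u v y) at_top"
    using eventually_gt_at_top[of "x + 1"]
  proof eventually_elim
    case (elim y)
    then show ?case using h_fun_mono[of "x + 1" y] assms by simp
  qed
  ultimately have "h_fun u v (x + 1) \<le> 0"
    by (intro tendsto_lowerbound) auto
  then show ?thesis using h_fun_mono[of x "x + 1"] assms by simp
qed

lemma phi_h: "x > 0 \<Longrightarrow> phi_fun u v (h_fun u v x) = x"
  using h_fun_neg[of x] by (simp add: phi_fun_def the_inv_into_f_f[OF h_fun_inj])

lemma phi_cont:
  assumes "x > 0" shows "isCont (phi_fun u v) (h_fun u v x)"
proof (rule isCont_inverse_function[where f="h_fun u v" and x=x and d="x/2"])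
  show "0 < x / 2" using assms by simp
  fix z assume "\<bar>z - x\<bar> \<le> x / 2"
  then have "z > 0" using assms by linarith
  then show "phi_fun u v (h_fun u v z) = z" "isCont (h_fun u v) z"
    by (simp_all add: phi_h h_fun_cont)
qed

lemma h_fun_between:
  assumes "0 < l" "l \<le> r" "h_fun u v l \<le> y" "y \<le> h_fun u v r"
  shows "\<exists>x>0. h_fun u v x = y"
proof -
  have "\<exists>x. l \<le> x \<and> x \<le> r \<and> h_fun u v x = y"
    using assms h_fun_cont by (intro IVT) auto
  then show ?thesis using assms(1) less_le_trans by blast
qed

lemma h_fun_range_open: "open (h_fun u v ` {0<..})"
proof -
  have "h_fun u v ` {0<..} = (\<Union>x\<in>{0<..}. {h_fun u v (x/2)<..<h_fun u v (2*x)})"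
  proof (intro equalityI subsetI)
    fix y assume "y \<in> h_fun u v ` {0<..}"
    then obtain x where "x > 0" "y = h_fun u v x" by auto
    then have "y \<in> {h_fun u v (x/2)<..<h_fun u v (2*x)}" by (auto intro!: h_fun_mono)
    then show "y \<in> (\<Union>x\<in>{0<..}. {h_fun u v (x/2)<..<h_fun u v (2*x)})" using \<open>x > 0\<close> by blast
  next
    fix y assume "y \<in> (\<Union>x\<in>{0<..}. {h_fun u v (x/2)<..<h_fun u v (2*x)})"
    then obtain x where "x > 0" "h_fun u v (x/2) < y" "y < h_fun u v (2*x)" by auto
    then show "y \<in> h_fun u v ` {0<..}" using h_fun_between[of "x/2" "2*x" y] by force
  qed
  then show ?thesis by auto
qed

text \<open>
  On the open range of \<open>h\<close> the function is the continuous inverse; off the range it takes at most two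
  values, the second one being the unspecified value of the inverse.
\<close>

lemma phi_measurable: "phi_fun u v \<in> borel_measurable borel"
proof -
  let ?I = "h_fun u v ` {0<..}"
  let ?c = "THE y::real. False"
  have "(\<lambda>x. if x \<in> ?I then phi_fun u v x else (if 0 \<le> x then 0 else ?c)) \<in> borel_measurable borel"
  proof -
    have "continuous_on ?I (phi_fun u v)"
      using phi_cont by (intro continuous_at_imp_continuous_on) auto
    then have m1: "(\<lambda>x. if x \<in> ?I then phi_fun u v x else 0) \<in> borel_measurable borel"
      using h_fun_range_open by (intro borel_measurable_continuous_on_if) auto
    have m2: "(\<lambda>x::real. if 0 \<le> x then 0 else ?c) \<in> borel_measurable borel"
      by (intro measurable_If) auto
    have I: "?I \<inter> space borel \<in> sets borel" using h_fun_range_open by simp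
    have "(\<lambda>x. if x \<in> ?I then (if x \<in> ?I then phi_fun u v x else 0) else (if 0 \<le> x then 0 else ?c)) \<in> borel_measurable borel"
      by (rule measurable_If_set[OF m1 m2 I])
    then show ?thesis by (simp cong: if_cong)
  qed
  moreover have "(if x \<in> ?I then phi_fun u v x else (if 0 \<le> x then 0 else ?c)) = phi_fun u v x" for x
  proof (cases "x \<in> ?I")
    case False
    then have "(THE y. y \<in> {0<..} \<and> h_fun u v y = x) = ?c"
      by (intro arg_cong[where f=The]) auto
    then show ?thesis using False by (auto simp: phi_fun_def the_inv_into_def)
  qed simp
  ultimately show ?thesis by simp
qed

text \<open>
  The inverse is differentiable at \<open>h (x)\<close>, which bounds its difference quotients there. A Lipschitz bound
  relative to this one point is what the comparison of the estimator with its limit uses.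
\<close>

lemma phi_lipschitz:
  assumes "x > 0"
  obtains \<delta> C where "\<delta> > 0" "C > 0"
    "\<And>y. \<bar>y - h_fun u v x\<bar> \<le> \<delta> \<Longrightarrow> \<bar>phi_fun u v y - x\<bar> \<le> C * \<bar>y - h_fun u v x\<bar>"
proof -
  define d where "d = (u * v / x\<^sup>2) * (Digamma (1 + u / x) - Digamma (1 + v / x))"
  have d: "d > 0" "(h_fun u v has_real_derivative d) (at x)"
    using h_fun_deriv[OF assms] by (auto simp: d_def)
  let ?y = "h_fun u v x"
  have "DERIV (phi_fun u v) ?y :> inverse d"
  proof (rule DERIV_inverse_function[where f="h_fun u v" and a="h_fun u v (x/2)" and b="h_fun u v (2*x)"])
    show "DERIV (h_fun u v) (phi_fun u v ?y) :> d" using d by (simp add: phi_h assms)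
    show "h_fun u v (x/2) < ?y" "?y < h_fun u v (2*x)" using assms by (auto intro!: h_fun_mono)
    show "isCont (phi_fun u v) ?y" by (rule phi_cont[OF assms])
    fix y assume "h_fun u v (x/2) < y" "y < h_fun u v (2*x)"
    then obtain z where "z > 0" "h_fun u v z = y" using h_fun_between[of "x/2" "2*x" y] assms by force
    then show "h_fun u v (phi_fun u v y) = y" using phi_h by auto
  qed (use d in auto)
  then have "((\<lambda>h. (phi_fun u v (?y + h) - x) / h) \<longlongrightarrow> inverse d) (at 0)"
    by (simp add: DERIV_def phi_h assms)
  then have "eventually (\<lambda>h. dist ((phi_fun u v (?y + h) - x) / h) (inverse d) < 1) (at 0)"
    by (rule tendstoD) simp
  then obtain e where e: "e > 0" "\<And>h. h \<noteq> 0 \<Longrightarrow> \<bar>h\<bar> < e \<Longrightarrow> \<bar>(phi_fun u v (?y + h) - x) / h - inverse d\<bar> < 1"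
    by (auto simp: eventually_at dist_real_def)
  have "\<bar>phi_fun u v y - x\<bar> \<le> (inverse d + 1) * \<bar>y - ?y\<bar>" if "\<bar>y - ?y\<bar> \<le> e / 2" for y
  proof (cases "y = ?y")
    case True
    then show ?thesis by (simp add: phi_h assms)
  next
    case False
    define h where "h = y - ?y"
    have "\<bar>(phi_fun u v (?y + h) - x) / h - inverse d\<bar> < 1"
      using False that e(1) by (intro e) (auto simp: h_def)
    moreover have "?y + h = y" "0 < inverse d" using d by (simp_all add: h_def)
    ultimately have "\<bar>(phi_fun u v y - x) / h\<bar> \<le> inverse d + 1" by (simp only:)
    then have "\<bar>phi_fun u v y - x\<bar> \<le> (inverse d + 1) * \<bar>h\<bar>"
      using False by (simp add: h_def abs_divide divide_le_eq)
    then show ?thesis by (simp add: h_def)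
  qed
  moreover have "inverse d + 1 > 0" using d by (simp add: add_pos_pos)
  ultimately show ?thesis using that[of "e / 2" "inverse d + 1"] e(1) by auto
qed

end

text \<open>
  The scale \<open>S\<close> and the power of \<open>2\<close> enter linearly in \<open>s\<close>. The combination \<open>u ln m\<^sub>v - v ln m\<^sub>u\<close> of two
  moments therefore cancels both and leaves a quantity that depends on \<open>\<alpha>\<close>, \<open>u\<close> and \<open>v\<close> only.
\<close>

lemma ln_neg_moment:
  assumes "0 < s" "s < 1" "0 < S" "0 < \<alpha>"
  shows "ln (neg_moment s S \<alpha>) = ln (Gamma (1 + s / \<alpha>)) - s / \<alpha> * ln S - s * ln 2
     + ln (Gamma ((1 - s) / 2)) - ln pi / 2 - ln (Gamma (1 + s / 2))"
proof -
  have G: "ln (Gamma (1 + x)) = ln x + ln (Gamma x)" if "x > 0" for x :: real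
  proof -
    have "x \<notin> \<int>\<^sub>\<le>\<^sub>0" using that by (auto elim: nonpos_Ints_cases)
    then have "Gamma (1 + x) = x * Gamma x" using Gamma_plus1[of x] by (simp add: add.commute)
    moreover have "Gamma x \<noteq> 0" using Gamma_real_pos[OF that] by linarith
    ultimately show ?thesis using that by (simp add: ln_mult)
  qed
  have pos: "Gamma (s / \<alpha>) \<noteq> 0" "Gamma ((1 - s) / 2) \<noteq> 0" "Gamma (s / 2) \<noteq> 0"
    using assms Gamma_real_pos[of "s / \<alpha>"] Gamma_real_pos[of "(1 - s) / 2"] Gamma_real_pos[of "s / 2"]
    by (simp_all add: less_imp_neq[symmetric] del: Gamma_real_pos)
  have "ln (neg_moment s S \<alpha>) = ln (Gamma (s / \<alpha>)) - (ln \<alpha> + s / \<alpha> * ln S) + (- s / 2 * ln 2 + ln (Gamma ((1 - s) / 2)) - ln pi / 2)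
     - (ln (Gamma (s / 2)) + (s / 2 - 1) * ln 2)"
    unfolding neg_moment_def mix_val_def gauss_const_def
    using assms pos by (simp add: ln_mult ln_div ln_powr ln_sqrt)
  also have "\<dots> = ln (Gamma (1 + s / \<alpha>)) - s / \<alpha> * ln S - s * ln 2
     + ln (Gamma ((1 - s) / 2)) - ln pi / 2 - ln (Gamma (1 + s / 2))"
    using assms by (simp add: G ln_div algebra_simps)
  finally show ?thesis .
qed

lemma psi_neg_moments:
  assumes "0 < v" "v < u" "u < 1" "0 < S" "0 < \<alpha>"
  shows "psi_fun u v (neg_moment u S \<alpha>) (neg_moment v S \<alpha>) = h_fun u v \<alpha>"
proof -
  have u: "0 < u" "u < 1" and v: "0 < v" "v < 1" using assms by auto
  show ?thesis
    unfolding psi_fun_def h_fun_def C_const_def ln_neg_moment[OF u assms(4,5)] ln_neg_moment[OF v assms(4,5)]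
    by (simp add: field_simps)
qed

section \<open>Consistency and rates of the estimators\<close>

context lfsm begin

text \<open>
  Vanishing moments of order \<open>0\<close> and \<open>1\<close> leave no room for a nontrivial \<open>a\<close> on \<open>{0, 1}\<close>. Hence \<open>n / 2 \<ge> 2\<close> for the indices of
  the estimator of \<open>H\<close>, where the rate is positive.
\<close>

lemma K_ge_2: "K \<ge> 2"
proof (rule ccontr)
  assume "\<not> K \<ge> 2"
  then have "K = 1" using LK by simp
  then have "a 1 = 0" using moments[of 1] LK by simp
  then show False using moment_nz \<open>K = 1\<close> by simp
qed

lemma rate_pos: "n \<ge> 2 \<Longrightarrow> rate H \<alpha> L n > 0"
  by (simp add: rate_def)

lemma rate_tendsto: "rate H \<alpha> L \<longlonglongrightarrow> 0"
proof -
  have p: "(\<lambda>n. real n powr e) \<longlonglongrightarrow> 0" if "e < 0" for e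
    by (rule tendsto_neg_powr[OF that filterlim_real_sequentially])
  have s: "(\<lambda>n. sqrt (ln (real n) / real n)) \<longlonglongrightarrow> 0"
    using tendsto_real_sqrt[OF lim_ln_over_n] by simp
  have neg: "(\<alpha> * H - (real L + 1) * \<alpha>) / 4 < 0"
  proof -
    have "\<alpha> * H < \<alpha> * (real L + 1)" using alpha_range H LK by (intro mult_strict_left_mono) auto
    then show ?thesis by (simp add: mult.commute)
  qed
  show ?thesis
    unfolding rate_def[abs_def] using s p[OF neg] p[of "- 1 / 2"]
    by (cases "H < real L + 1 - 2 / \<alpha>"; cases "H > real L + 1 - 2 / \<alpha>") simp_all
qed

lemma rate_half:
  obtains C where "C > 0" "\<And>n. even n \<Longrightarrow> 4 \<le> n \<Longrightarrow> rate H \<alpha> L (n div 2) \<le> C * rate H \<alpha> L n"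
proof -
  have half: "real (n div 2) = real n / 2" if "even n" for n :: nat using that by (auto elim!: evenE)
  consider "H < real L + 1 - 2 / \<alpha>" | "H > real L + 1 - 2 / \<alpha>" | "H = real L + 1 - 2 / \<alpha>" by linarith
  then show ?thesis
  proof cases
    case 1
    then have "rate H \<alpha> L (n div 2) \<le> 2 powr (1/2) * rate H \<alpha> L n" if "even n" for n
      unfolding rate_def half[OF that] by (simp add: powr_divide powr_minus field_simps)
    then show ?thesis using that[of "2 powr (1/2)"] by simp
  next
    case 2
    define e where "e = (\<alpha> * H - (real L + 1) * \<alpha>) / 4"
    have "rate H \<alpha> L (n div 2) \<le> 2 powr (- e) * rate H \<alpha> L n" if "even n" for n
      using 2 unfolding rate_def half[OF that] e_def[symmetric] by (simp add: powr_divide powr_minus field_simps)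
    then show ?thesis using that[of "2 powr (- e)"] by simp
  next
    case 3
    have "rate H \<alpha> L (n div 2) \<le> sqrt 2 * rate H \<alpha> L n" if "even n" "4 \<le> n" for n
    proof -
      have "ln (real n / 2) / (real n / 2) \<le> 2 * (ln (real n) / real n)"
      proof -
        have "ln (real n / 2) \<le> ln (real n)" using that by (simp add: ln_div)
        then have "ln (real n / 2) / real n \<le> ln (real n) / real n" by (rule divide_right_mono) simp
        then have "2 * (ln (real n / 2) / real n) \<le> 2 * (ln (real n) / real n)"
          by (rule mult_left_mono) simp
        then show ?thesis by (simp only: divide_divide_eq_right times_divide_eq_right mult.commute)
      qed
      then have "sqrt (ln (real n / 2) / (real n / 2)) \<le> sqrt (2 * (ln (real n) / real n))" by simp
      then show ?thesis using 3 unfolding rate_def half[OF that(1)] real_sqrt_mult by simp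
    qed
    then show ?thesis using that[of "sqrt 2"] by simp
  qed
qed

lemma H_estimator_measurable:
  assumes "n \<in> H_indices K"
  shows "H_estimator K a X \<beta> n \<in> borel_measurable P"
proof -
  have "n > 0" "n div 2 > 0" using assms K_ge_2 by (auto simp: H_indices_def)
  then have [measurable]: "power_variation K a X \<beta> n \<in> borel_measurable P"
    "power_variation K a X \<beta> (n div 2) \<in> borel_measurable P"
    by (simp_all add: power_variation_measurable)
  show ?thesis unfolding H_estimator_def[abs_def] log_def by measurable
qed

text \<open>
  The powers of \<open>n\<close> that relate the plain and the scaled variations contribute exactly \<open>H\<close>.
\<close>

lemma H_estimator_eq:
  assumes n: "n \<in> H_indices K" and s: "s > 0"
    and W: "W s n \<omega> > 0" "W s (n div 2) \<omega> > 0"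
  shows "H_estimator K a X (- s) n \<omega> - H = (ln (W s n \<omega>) - ln (W s (n div 2) \<omega>)) / (s * ln 2)"
proof -
  have n0: "n > 0" and half: "real (n div 2) = real n / 2"
    using n K_ge_2 by (auto simp: H_indices_def elim!: evenE)
  have h0: "real (n div 2) > 0" using n0 half by simp
  have V: "power_variation K a X (- s) m \<omega> = real m powr (s * H) * W s m \<omega>" if "real m > 0" for m
    using that by (simp add: W_def scaled_variation_def powr_minus)
  have "power_variation K a X (- s) (n div 2) \<omega> / power_variation K a X (- s) n \<omega>
     = (1/2) powr (s * H) * (W s (n div 2) \<omega> / W s n \<omega>)"
    using n0 unfolding V[OF h0] half by (subst V) (simp_all add: powr_divide)
  also have "ln \<dots> = - (s * H) * ln 2 + (ln (W s (n div 2) \<omega>) - ln (W s n \<omega>))"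
    using W by (simp add: ln_mult ln_div ln_powr)
  finally have "H_estimator K a X (- s) n \<omega>
     = 1 / (- s) * ((- (s * H) * ln 2 + (ln (W s (n div 2) \<omega>) - ln (W s n \<omega>))) / ln 2)"
    by (simp only: H_estimator_def log_def)
  also have "\<dots> = H + (ln (W s n \<omega>) - ln (W s (n div 2) \<omega>)) / (s * ln 2)"
    using s by (simp add: field_simps)
  finally show ?thesis by simp
qed

lemma H_estimator_rate:
  assumes s: "0 < s" "s < 1/2"
  shows "conv_in_prob P (H_indices K) (H_estimator K a X (- s)) (\<lambda>_. H)"
    and "big_O_prob P (H_indices K) (\<lambda>n \<omega>. H_estimator K a X (- s) n \<omega> - H) (rate H \<alpha> L)"
proof -
  define m where "m = mean s"
  have m: "m > 0" using s by (simp add: m_def mean_pos)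
  obtain B where B: "0 < B"
    "\<And>n. K \<le> n \<Longrightarrow> 2 \<le> n \<Longrightarrow> integrable P (\<lambda>\<omega>. (W s n \<omega> - m)\<^sup>2)"
    "\<And>n. K \<le> n \<Longrightarrow> 2 \<le> n \<Longrightarrow> expectation (\<lambda>\<omega>. (W s n \<omega> - m)\<^sup>2) \<le> B * (rate H \<alpha> L n)\<^sup>2"
    using W_variance_rate[OF s] unfolding m_def by metis
  obtain C where C: "C > 0" "\<And>n. even n \<Longrightarrow> 4 \<le> n \<Longrightarrow> rate H \<alpha> L (n div 2) \<le> C * rate H \<alpha> L n"
    using rate_half by blast
  let ?D = "\<lambda>n \<omega>. \<bar>W s n \<omega> - m\<bar> + \<bar>W s (n div 2) \<omega> - m\<bar>"
  have idx: "K \<le> n" "2 \<le> n" "K \<le> n div 2" "2 \<le> n div 2" "even n" "4 \<le> n" if "n \<in> H_indices K" for n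
    using that K_ge_2 by (auto simp: H_indices_def)
  have half: "B * (rate H \<alpha> L (n div 2))\<^sup>2 \<le> B * C\<^sup>2 * (rate H \<alpha> L n)\<^sup>2" if "n \<in> H_indices K" for n
  proof -
    have "(rate H \<alpha> L (n div 2))\<^sup>2 \<le> (C * rate H \<alpha> L n)\<^sup>2"
      using C(2) idx[OF that] rate_pos[of "n div 2"] by (intro power_mono) auto
    then show ?thesis using B(1) by (simp add: power_mult_distrib mult.assoc)
  qed
  have var: "integrable P (\<lambda>\<omega>. (W s n \<omega> - m)\<^sup>2)" "integrable P (\<lambda>\<omega>. (W s (n div 2) \<omega> - m)\<^sup>2)"
    "expectation (\<lambda>\<omega>. (W s n \<omega> - m)\<^sup>2) \<le> B * (rate H \<alpha> L n)\<^sup>2"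
    "expectation (\<lambda>\<omega>. (W s (n div 2) \<omega> - m)\<^sup>2) \<le> B * C\<^sup>2 * (rate H \<alpha> L n)\<^sup>2"
    if n: "n \<in> H_indices K" for n
    using B(2,3) idx[OF n] order_trans[OF B(3) half[OF n]] by simp_all
  have Wm: "W s n \<in> borel_measurable P" "W s (n div 2) \<in> borel_measurable P" if "n \<in> H_indices K" for n
    using idx[OF that] by (auto intro!: W_measurable)
  have rp: "0 < rate H \<alpha> L n" if "n \<in> H_indices K" for n
    using idx[OF that] by (intro rate_pos) simp
  have lip: "\<bar>H_estimator K a X (- s) n \<omega> - H\<bar> \<le> (2 / (m * s * ln 2)) * ?D n \<omega>"
    if n: "n \<in> H_indices K" and D: "?D n \<omega> \<le> m / 2" for n \<omega>
  proof -
    have le: "\<bar>W s n \<omega> - m\<bar> \<le> m / 2" "\<bar>W s (n div 2) \<omega> - m\<bar> \<le> m / 2"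
      using D by linarith+
    note l1 = ln_lipschitz[OF m le(1)] and l2 = ln_lipschitz[OF m le(2)]
    have "\<bar>H_estimator K a X (- s) n \<omega> - H\<bar> = \<bar>ln (W s n \<omega>) - ln (W s (n div 2) \<omega>)\<bar> / (s * ln 2)"
      unfolding H_estimator_eq[OF n s(1) l1(1) l2(1)] using s by (simp add: abs_divide abs_mult)
    also have "\<dots> \<le> (2 / m * ?D n \<omega>) / (s * ln 2)"
    proof (rule divide_right_mono)
      have "2 / m * ?D n \<omega> = 2 / m * \<bar>W s n \<omega> - m\<bar> + 2 / m * \<bar>W s (n div 2) \<omega> - m\<bar>"
        by (simp only: distrib_left)
      then show "\<bar>ln (W s n \<omega>) - ln (W s (n div 2) \<omega>)\<bar> \<le> 2 / m * ?D n \<omega>"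
        using l1(2) l2(2) by linarith
    qed (use s in simp)
    finally show ?thesis by (simp add: mult_ac)
  qed
  have ne: "H_indices K \<noteq> {}"
  proof -
    have "2 * K \<in> H_indices K" by (simp add: H_indices_def)
    then show ?thesis by blast
  qed
  have m2: "0 < m / 2" using m by simp
  have cpos: "0 < 2 / (m * s * ln 2)" using m s by simp
  show "conv_in_prob P (H_indices K) (H_estimator K a X (- s)) (\<lambda>_. H)"
    and "big_O_prob P (H_indices K) (\<lambda>n \<omega>. H_estimator K a X (- s) n \<omega> - H) (rate H \<alpha> L)"
    using delta_method_pair[OF ne H_estimator_measurable Wm(1) var(1,3) Wm(2) var(2,4) _ _ rp
        rate_tendsto m2 cpos lip] B(1) by simp_all
qed

lemma alpha_estimator_rate:
  assumes v: "0 < v" "v < u" "u < 1/2"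
  shows "conv_in_prob P (alpha_indices K) (alpha_estimator H K a X (- u) (- v)) (\<lambda>_. \<alpha>)"
    and "big_O_prob P (alpha_indices K) (\<lambda>n \<omega>. alpha_estimator H K a X (- u) (- v) n \<omega> - \<alpha>) (rate H \<alpha> L)"
proof -
  let ?T = "alpha_estimator H K a X (- u) (- v)"
  have s: "0 < u" "u < 1/2" "0 < v" "v < 1/2" using v by auto
  define m1 m2 where "m1 = mean u" and "m2 = mean v"
  have m: "m1 > 0" "m2 > 0" using s by (simp_all add: m1_def m2_def mean_pos)
  have T: "?T n \<omega> = phi_fun u v (psi_fun u v (W u n \<omega>) (W v n \<omega>))" for n \<omega>
    by (simp add: alpha_estimator_def W_def)
  have psi0: "psi_fun u v m1 m2 = h_fun u v \<alpha>"
    unfolding m1_def m2_def mean_def using v S_pos alpha_range by (intro psi_neg_moments) auto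
  obtain B1 where B1: "0 < B1"
    "\<And>n. K \<le> n \<Longrightarrow> 2 \<le> n \<Longrightarrow> integrable P (\<lambda>\<omega>. (W u n \<omega> - m1)\<^sup>2)"
    "\<And>n. K \<le> n \<Longrightarrow> 2 \<le> n \<Longrightarrow> expectation (\<lambda>\<omega>. (W u n \<omega> - m1)\<^sup>2) \<le> B1 * (rate H \<alpha> L n)\<^sup>2"
    using W_variance_rate[OF s(1,2)] unfolding m1_def by metis
  obtain B2 where B2: "0 < B2"
    "\<And>n. K \<le> n \<Longrightarrow> 2 \<le> n \<Longrightarrow> integrable P (\<lambda>\<omega>. (W v n \<omega> - m2)\<^sup>2)"
    "\<And>n. K \<le> n \<Longrightarrow> 2 \<le> n \<Longrightarrow> expectation (\<lambda>\<omega>. (W v n \<omega> - m2)\<^sup>2) \<le> B2 * (rate H \<alpha> L n)\<^sup>2"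
    using W_variance_rate[OF s(3,4)] unfolding m2_def by metis
  obtain \<delta> C where \<delta>: "\<delta> > 0" "C > 0"
    "\<And>y. \<bar>y - h_fun u v \<alpha>\<bar> \<le> \<delta> \<Longrightarrow> \<bar>phi_fun u v y - \<alpha>\<bar> \<le> C * \<bar>y - h_fun u v \<alpha>\<bar>"
    using phi_lipschitz[OF v(1,2) alpha_range(1)] by blast
  let ?D = "\<lambda>n \<omega>. \<bar>W u n \<omega> - m1\<bar> + \<bar>W v n \<omega> - m2\<bar>"
  define G where "G = 2 * v / m1 + 2 * u / m2"
  have G: "G > 0" using m s by (simp add: G_def add_pos_pos)
  have idx: "K \<le> n" "2 \<le> n" "n > 0" if "n \<in> alpha_indices K" for n
    using that by (auto simp: alpha_indices_def)
  have Wm: "W u n \<in> borel_measurable P" "W v n \<in> borel_measurable P" if "n \<in> alpha_indices K" for n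
    using idx[OF that] by (auto intro!: W_measurable)
  have var: "integrable P (\<lambda>\<omega>. (W u n \<omega> - m1)\<^sup>2)" "integrable P (\<lambda>\<omega>. (W v n \<omega> - m2)\<^sup>2)"
    "expectation (\<lambda>\<omega>. (W u n \<omega> - m1)\<^sup>2) \<le> B1 * (rate H \<alpha> L n)\<^sup>2"
    "expectation (\<lambda>\<omega>. (W v n \<omega> - m2)\<^sup>2) \<le> B2 * (rate H \<alpha> L n)\<^sup>2"
    if "n \<in> alpha_indices K" for n
    using B1(2,3) B2(2,3) idx[OF that] by simp_all
  have rp: "0 < rate H \<alpha> L n" if "n \<in> alpha_indices K" for n
    using idx[OF that] by (intro rate_pos) simp
  have Tm: "?T n \<in> borel_measurable P" if "n \<in> alpha_indices K" for n
  proof -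
    note [measurable] = Wm[OF that] phi_measurable[OF v(1,2)]
    have "(\<lambda>\<omega>. phi_fun u v (psi_fun u v (W u n \<omega>) (W v n \<omega>))) \<in> borel_measurable P"
      unfolding psi_fun_def by measurable
    then show ?thesis by (simp add: T[abs_def])
  qed
  \<comment> \<open>The first two bounds keep the logarithms Lipschitz, the third one keeps their combination where the inverse of \<open>h\<close> is controlled.\<close>
  define \<eta> where "\<eta> = min (min (m1 / 2) (m2 / 2)) (\<delta> / G)"
  have \<eta>: "\<eta> > 0" using m \<delta> G by (simp add: \<eta>_def)
  have lip: "\<bar>?T n \<omega> - \<alpha>\<bar> \<le> (C * G) * ?D n \<omega>" if n: "n \<in> alpha_indices K" and D: "?D n \<omega> \<le> \<eta>" for n \<omega>
  proof -
    have "?D n \<omega> \<le> m1 / 2" "?D n \<omega> \<le> m2 / 2" and le3: "?D n \<omega> \<le> \<delta> / G"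
      using D unfolding \<eta>_def by simp_all
    then have le: "\<bar>W u n \<omega> - m1\<bar> \<le> m1 / 2" "\<bar>W v n \<omega> - m2\<bar> \<le> m2 / 2"
      by linarith+
    note l1 = ln_lipschitz[OF m(1) le(1)] and l2 = ln_lipschitz[OF m(2) le(2)]
    let ?y = "psi_fun u v (W u n \<omega>) (W v n \<omega>)"
    have "?y - h_fun u v \<alpha> = u * (ln (W v n \<omega>) - ln m2) - v * (ln (W u n \<omega>) - ln m1)"
      unfolding psi0[symmetric] by (simp add: psi_fun_def algebra_simps)
    also have "\<bar>\<dots>\<bar> \<le> u * \<bar>ln (W v n \<omega>) - ln m2\<bar> + v * \<bar>ln (W u n \<omega>) - ln m1\<bar>"
      using s abs_triangle_ineq4[of "u * (ln (W v n \<omega>) - ln m2)" "v * (ln (W u n \<omega>) - ln m1)"]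
      by (simp add: abs_mult)
    also have "\<dots> \<le> u * (2 / m2 * ?D n \<omega>) + v * (2 / m1 * ?D n \<omega>)"
    proof (intro add_mono mult_left_mono)
      have "2 / m2 * \<bar>W v n \<omega> - m2\<bar> \<le> 2 / m2 * ?D n \<omega>" "2 / m1 * \<bar>W u n \<omega> - m1\<bar> \<le> 2 / m1 * ?D n \<omega>"
        using m by (auto intro!: mult_left_mono simp del: times_divide_eq_left)
      then show "\<bar>ln (W v n \<omega>) - ln m2\<bar> \<le> 2 / m2 * ?D n \<omega>" "\<bar>ln (W u n \<omega>) - ln m1\<bar> \<le> 2 / m1 * ?D n \<omega>"
        using l1(2) l2(2) by linarith+
    qed (use s in auto)
    also have "\<dots> = G * ?D n \<omega>" by (simp add: G_def algebra_simps)
    finally have y: "\<bar>?y - h_fun u v \<alpha>\<bar> \<le> G * ?D n \<omega>" .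
    also have "G * ?D n \<omega> \<le> \<delta>" using le3 G by (simp add: pos_le_divide_eq mult.commute)
    finally have "\<bar>?T n \<omega> - \<alpha>\<bar> \<le> C * \<bar>?y - h_fun u v \<alpha>\<bar>" unfolding T by (rule \<delta>(3))
    also have "\<dots> \<le> C * (G * ?D n \<omega>)" using y \<delta>(2) by (intro mult_left_mono) auto
    finally show ?thesis by (simp add: mult.assoc)
  qed
  have ne: "alpha_indices K \<noteq> {}"
  proof -
    have "K + 2 \<in> alpha_indices K" by (simp add: alpha_indices_def)
    then show ?thesis by blast
  qed
  have CG: "0 < C * G" using \<delta>(2) G by simp
  show "conv_in_prob P (alpha_indices K) ?T (\<lambda>_. \<alpha>)"
    and "big_O_prob P (alpha_indices K) (\<lambda>n \<omega>. ?T n \<omega> - \<alpha>) (rate H \<alpha> L)"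
    using delta_method_pair[OF ne Tm Wm(1) var(1,3) Wm(2) var(2,4) _ _ rp rate_tendsto \<eta> CG lip]
      B1(1) B2(1) by simp_all
qed

end

theorem theorem3p3:
  fixes P :: "'w measure"
    and M :: "real set \<Rightarrow> 'w \<Rightarrow> real"
    and X :: "real \<Rightarrow> 'w \<Rightarrow> real"
    and \<alpha> H \<beta> \<beta>\<^sub>1 \<beta>\<^sub>2 :: real
    and K L :: nat
    and a :: "nat \<Rightarrow> real"
  assumes "0 < \<alpha>" and "\<alpha> < 2" and "0 < H" and "H < 1" and "H \<noteq> 1 / \<alpha>"
    and "well_balanced_lfsm P H \<alpha> M X"
    and "L \<ge> 1" and "K \<ge> 1"
    and "\<And>q. q \<le> L \<Longrightarrow> (\<Sum>k=0..K. real k ^ q * a k) = 0"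
    and "(\<Sum>k=0..K. real k ^ (L + 1) * a k) \<noteq> 0"
    and "- 1 / 2 < \<beta>" and "\<beta> < 0"
    and "- 1 / 2 < \<beta>\<^sub>1" and "\<beta>\<^sub>1 < \<beta>\<^sub>2" and "\<beta>\<^sub>2 < 0"
  shows "conv_in_prob P (H_indices K) (H_estimator K a X \<beta>) (\<lambda>_. H) \<and>
         conv_in_prob P (alpha_indices K) (alpha_estimator H K a X \<beta>\<^sub>1 \<beta>\<^sub>2) (\<lambda>_. \<alpha>) \<and>
         big_O_prob P (H_indices K) (\<lambda>n \<omega>. H_estimator K a X \<beta> n \<omega> - H) (rate H \<alpha> L) \<and>
         big_O_prob P (alpha_indices K)
           (\<lambda>n \<omega>. alpha_estimator H K a X \<beta>\<^sub>1 \<beta>\<^sub>2 n \<omega> - \<alpha>) (rate H \<alpha> L)"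
proof -
  interpret lfsm P M X \<alpha> H K L a
    by (rule lfsm.intro[OF assms(1-10)])
  show ?thesis
    using H_estimator_rate[of "- \<beta>"] alpha_estimator_rate[of "- \<beta>\<^sub>2" "- \<beta>\<^sub>1"] assms by simp
qed

end
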